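(* Let $\kappa$ be a one domain wall function with parameter $\kappa_\infty>0$ such that the Spectral Gap Assumption holds for $\mathcal D_\kappa$, and let $[-K,K]\subset(-\kappa_\infty,\kappa_\infty)$ be any compact interval. Let $\mathcal D_{\kappa^\delta}$ be the three domain wall Dirac operator. Then there is a constant $\delta(K)\ge2$ such that for all $\delta>\delta(K)$, in addition to the eigenvalue $0$ with exact zero mode $$\alpha^\delta_\star(x)=\gamma^\delta\begin{pmatrix}1\\i\end{pmatrix}e^{-\int_0^x\kappa^\delta(y)\,dy},\qquad\gamma^\delta=\frac{1}{\sqrt2\,\|e^{-\int_0^x\kappa^\delta(y)\,dy}\|_{L^2(\mathbb R)}},$$ the operator $\mathcal D_{\kappa^\delta}$ has two near-zero eigenvalues $E_\pm(\delta)$ in the interval $[-K,K]$, which satisfy $$E_\pm=\pm2\sqrt2\,\gamma^2e^{-2\int_0^\delta\kappa(y)\,dy}+O(e^{-4\kappa_\infty\delta}).$$ Their associated normalized eigenfunctions $\alpha_\pm$ (suitably chosen up to a constant phase) satisfy $$\alpha_+=\tfrac12\left(\alpha_\star^R+\sqrt2\,i\,\alpha_\star^0-\alpha_\star^L\right)+O(e^{-2\kappa_\infty\delta}),\qquad\alpha_-=\tfrac12\left(\alpha_\star^R-\sqrt2\,i\,\alpha_\star^0-\alpha_\star^L\right)+O(e^{-2\kappa_\infty\delta}),$$ with errors measured in the norm of $\mathcal H$. The constants implied in the $O$ terms are independent of $\delta$.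
   Context: Let $\mathcal H=L^2(\mathbb R;\mathbb C^2)$ with inner product $\langle f|g\rangle_{\mathcal H}=\int_{\mathbb R}\sum_{j=1,2}\overline{f_j(x)}g_j(x)\,dx$ and induced norm, and $\mathcal H^1=H^1(\mathbb R;\mathbb C^2)$. Pauli matrices: $\sigma_1=\begin{pmatrix}0&1\\1&0\end{pmatrix}$, $\sigma_3=\begin{pmatrix}1&0\\0&-1\end{pmatrix}$. For a real function $m$, $\mathcal D_m=i\sigma_3\partial_x+m(x)\sigma_1$, with domain $\mathcal H^1$ (self-adjoint on $\mathcal H$). One domain wall function: a real function $\kappa\in C^1(\mathbb R)$ that is odd, with $\kappa(x)=-\kappa_\infty$ for $x\le-1$ and $\kappa(x)=\kappa_\infty$ for $x\ge1$, where $\kappa_\infty>0$ is a fixed constant. Zero mode of $\mathcal D_\kappa$: $\alpha_\star(x)=\gamma\begin{pmatrix}1\\i\end{pmatrix}e^{-\int_0^x\kappa(y)\,dy}$, with $\gamma=\dfrac{1}{\sqrt2\,\|e^{-\int_0^x\kappa(y)\,dy}\|_{L^2(\mathbb R)}}$, so $\|\alpha_\star\|_{\mathcal H}=1$ and $\mathcal D_\kappa\alpha_\star=0$. Spectral Gap Assumption: $0$ is the unique eigenvalue of $\mathcal D_\kappa$ in $(-\kappa_\infty,\kappa_\infty)$; that is, for all $f\in\mathcal H^1$ with $\langle\alpha_\star|f\rangle_{\mathcal H}=0$ one has $\|\mathcal D_\kappa f\|_{\mathcal H}\ge\kappa_\infty\|f\|_{\mathcal H}$. Three domain wall mass function, for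 $\delta>1$: $\kappa^\delta(x)=\kappa(x+2\delta)$ for $x\le-\delta$, $\kappa^\delta(x)=-\kappa(x)$ for $-\delta\le x\le\delta$, $\kappa^\delta(x)=\kappa(x-2\delta)$ for $x\ge\delta$. The three domain wall Dirac operator is $\mathcal D_{\kappa^\delta}$. Shifted zero modes: $\alpha_\star^R(x)=\alpha_\star(x-2\delta)$, $\alpha_\star^0(x)=\overline{\alpha_\star(x)}$ (componentwise complex conjugate), $\alpha_\star^L(x)=\alpha_\star(x+2\delta)$. *)

theory Defs
  imports "HOL-Analysis.Analysis"
begin

text \<open>Elements of \<open>L\<^sup>2(\<real>; \<complex>\<^sup>2)\<close> are represented by Borel functions; every class has a Borel
  representative, and everything below is invariant under changes on null sets.\<close>

definition L2_space :: "(real \<Rightarrow> complex ^ 2) set" where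
  "L2_space = {f. f \<in> borel_measurable lborel \<and> integrable lborel (\<lambda>x. (norm (f x))\<^sup>2)}"

definition inner_H :: "(real \<Rightarrow> complex ^ 2) \<Rightarrow> (real \<Rightarrow> complex ^ 2) \<Rightarrow> complex" where
  "inner_H f g = (\<integral>x. (\<Sum>j\<in>UNIV. cnj (f x $ j) * g x $ j) \<partial>lborel)"

definition norm_H :: "(real \<Rightarrow> complex ^ 2) \<Rightarrow> real" where
  "norm_H f = sqrt (Re (inner_H f f))"

definition L2_norm_real :: "(real \<Rightarrow> real) \<Rightarrow> real" where
  "L2_norm_real h = sqrt (\<integral>x. (h x)\<^sup>2 \<partial>lborel)"

text \<open>The Sobolev space \<open>H\<^sup>1(\<real>; \<complex>\<^sup>2)\<close> via weak derivatives, tested against compactly supported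
  \<open>C\<^sup>1\<close> functions (as in Brezis; by mollification this agrees with \<open>C\<^sup>\<infinity>\<close> test functions).\<close>

definition test_function :: "(real \<Rightarrow> real) \<Rightarrow> bool" where
  "test_function \<phi> \<longleftrightarrow> \<phi> C1_differentiable_on UNIV \<and> compact (closure {x. \<phi> x \<noteq> 0})"

definition is_weak_deriv :: "(real \<Rightarrow> complex ^ 2) \<Rightarrow> (real \<Rightarrow> complex ^ 2) \<Rightarrow> bool" where
  "is_weak_deriv f g \<longleftrightarrow> (\<forall>\<phi>. test_function \<phi> \<longrightarrow>
     (\<integral>x. deriv \<phi> x *\<^sub>R f x \<partial>lborel) = - (\<integral>x. \<phi> x *\<^sub>R g x \<partial>lborel))"

definition H1_space :: "(real \<Rightarrow> complex ^ 2) set" where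
  "H1_space = {f \<in> L2_space. \<exists>g \<in> L2_space. is_weak_deriv f g}"

text \<open>Determined up to null sets for arguments in \<^const>\<open>H1_space\<close>, arbitrary otherwise.\<close>

definition weak_deriv :: "(real \<Rightarrow> complex ^ 2) \<Rightarrow> real \<Rightarrow> complex ^ 2" where
  "weak_deriv f = (SOME g. g \<in> L2_space \<and> is_weak_deriv f g)"

definition sigma1 :: "complex ^ 2 ^ 2" where
  "sigma1 = vector [vector [0, 1], vector [1, 0]]"

definition sigma3 :: "complex ^ 2 ^ 2" where
  "sigma3 = vector [vector [1, 0], vector [0, -1]]"

text \<open>Only meaningful on the domain \<^const>\<open>H1_space\<close>; all uses below carry that restriction.\<close>

definition dirac :: "(real \<Rightarrow> real) \<Rightarrow> (real \<Rightarrow> complex ^ 2) \<Rightarrow> real \<Rightarrow> complex ^ 2" where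
  "dirac m f = (\<lambda>x. \<i> *s (sigma3 *v weak_deriv f x) + of_real (m x) *s (sigma1 *v f x))"

definition eigenfunction :: "(real \<Rightarrow> real) \<Rightarrow> real \<Rightarrow> (real \<Rightarrow> complex ^ 2) \<Rightarrow> bool" where
  "eigenfunction m E f \<longleftrightarrow> f \<in> H1_space \<and> norm_H f \<noteq> 0 \<and>
     (AE x in lborel. dirac m f x = of_real E *s f x)"

text \<open>The operator is self-adjoint, so only real eigenvalues are considered.\<close>

definition eigenvalue :: "(real \<Rightarrow> real) \<Rightarrow> real \<Rightarrow> bool" where
  "eigenvalue m E \<longleftrightarrow> (\<exists>f. eigenfunction m E f)"

definition normalized_eigenfunction ::
    "(real \<Rightarrow> real) \<Rightarrow> real \<Rightarrow> (real \<Rightarrow> complex ^ 2) \<Rightarrow> bool" where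
  "normalized_eigenfunction m E f \<longleftrightarrow> eigenfunction m E f \<and> norm_H f = 1"

definition one_domain_wall :: "real \<Rightarrow> (real \<Rightarrow> real) \<Rightarrow> bool" where
  "one_domain_wall \<kappa>_inf \<kappa> \<longleftrightarrow> 0 < \<kappa>_inf \<and> \<kappa> C1_differentiable_on UNIV \<and>
     (\<forall>x. \<kappa> (- x) = - \<kappa> x) \<and> (\<forall>x \<le> -1. \<kappa> x = - \<kappa>_inf) \<and> (\<forall>x \<ge> 1. \<kappa> x = \<kappa>_inf)"

text \<open>The interval integral is oriented, as needed for negative \<open>x\<close>.\<close>

definition mass_integral :: "(real \<Rightarrow> real) \<Rightarrow> real \<Rightarrow> real" where
  "mass_integral m x = (LBINT y=ereal 0..ereal x. m y)"

definition gamma_const :: "(real \<Rightarrow> real) \<Rightarrow> real" where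
  "gamma_const m = 1 / (sqrt 2 * L2_norm_real (\<lambda>x. exp (- mass_integral m x)))"

definition zero_mode :: "(real \<Rightarrow> real) \<Rightarrow> real \<Rightarrow> complex ^ 2" where
  "zero_mode m = (\<lambda>x. of_real (gamma_const m * exp (- mass_integral m x)) *s vector [1, \<i>])"

definition spectral_gap :: "real \<Rightarrow> (real \<Rightarrow> real) \<Rightarrow> bool" where
  "spectral_gap \<kappa>_inf \<kappa> \<longleftrightarrow> (\<forall>f \<in> H1_space. inner_H (zero_mode \<kappa>) f = 0 \<longrightarrow>
     norm_H (dirac \<kappa> f) \<ge> \<kappa>_inf * norm_H f)"

text \<open>Used for \<open>\<delta> > 1\<close> only, where the three pieces agree at \<open>x = \<plusminus>\<delta>\<close>.\<close>

definition three_domain_wall :: "(real \<Rightarrow> real) \<Rightarrow> real \<Rightarrow> real \<Rightarrow> real" where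
  "three_domain_wall \<kappa> \<delta> x =
     (if x \<le> - \<delta> then \<kappa> (x + 2 * \<delta>) else if x \<le> \<delta> then - \<kappa> x else \<kappa> (x - 2 * \<delta>))"

definition zero_mode_R :: "(real \<Rightarrow> real) \<Rightarrow> real \<Rightarrow> real \<Rightarrow> complex ^ 2" where
  "zero_mode_R \<kappa> \<delta> x = zero_mode \<kappa> (x - 2 * \<delta>)"

definition zero_mode_0 :: "(real \<Rightarrow> real) \<Rightarrow> real \<Rightarrow> complex ^ 2" where
  "zero_mode_0 \<kappa> x = (\<chi> j. cnj (zero_mode \<kappa> x $ j))"

definition zero_mode_L :: "(real \<Rightarrow> real) \<Rightarrow> real \<Rightarrow> real \<Rightarrow> complex ^ 2" where
  "zero_mode_L \<kappa> \<delta> x = zero_mode \<kappa> (x + 2 * \<delta>)"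

text \<open>The leading term of the eigenfunctions, with \<open>s = 1\<close> for \<open>\<alpha>\<^sub>+\<close> and \<open>s = -1\<close> for \<open>\<alpha>\<^sub>-\<close>.\<close>

definition approx_mode :: "(real \<Rightarrow> real) \<Rightarrow> real \<Rightarrow> real \<Rightarrow> real \<Rightarrow> complex ^ 2" where
  "approx_mode \<kappa> s \<delta> x = (1 / 2) *s
     (zero_mode_R \<kappa> \<delta> x + (of_real (s * sqrt 2) * \<i>) *s zero_mode_0 \<kappa> x - zero_mode_L \<kappa> \<delta> x)"

end

theory Submission
  imports Defs
begin

text \<open>
  The spinor basis \<open>(1, \<i>) / \<surd>2\<close>, \<open>-\<i> (1, -\<i>) / \<surd>2\<close> turns the eigenvalue equation of the Dirac
  operator with mass \<open>m\<close> into the real system \<open>a' = - m a - E c\<close>, \<open>c' = m c + E a\<close>.  A weak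
  eigenfunction has almost everywhere constant Wronskian with every classical solution, and the
  constant is zero when that solution decays at one end.  Eigenfunctions are therefore multiples of
  classical solutions decaying at both ends (\<open>eigenfunction_classification\<close>), and the problem is one
  about ordinary differential equations.

  In polar coordinates \<open>a = r cos \<theta>\<close>, \<open>c = r sin \<theta>\<close> the angle obeys \<open>\<theta>' = E + m sin 2\<theta>\<close>, which is
  increasing in \<open>E\<close>.  All masses here are odd and equal to a constant \<open>k > 0\<close> far to the right, where the
  decaying solution has the constant angle \<open>- arcsin (E / k) / 2\<close>.  Let \<open>\<Theta>(E)\<close> be the value at the origin
  of this angle.  It is odd, continuous and strictly decreasing in \<open>E\<close>.  Because reflection maps solutions
  to solutions, \<open>E\<close> is an eigenvalue exactly if \<open>sin 2\<Theta>(E) = 0\<close> (\<open>eigenvalue_iff\<close>).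

  For one wall the gap assumption forces \<open>\<Theta>(E) > - \<pi>/2\<close> on \<open>[0, k)\<close>: a first energy with value \<open>- \<pi>/2\<close>
  would be an eigenvalue in the gap whose eigenfunction is, by parity, orthogonal to the zero mode
  (\<open>Theta_gt\<close>).  For three walls the angle is followed from the right.  Behind the right wall it relaxes,
  along the plateau of length comparable to \<open>2\<delta>\<close>, to the attracting value \<open>- \<pi>/2 - arcsin (E / k) / 2\<close>.
  This is the decaying angle of a single wall shifted by \<open>- \<pi>/2\<close>, and up to the origin the middle wall
  turns it into \<open>- \<pi>/2\<close> plus the one-wall value in \<open>(- \<pi>/2, 0)\<close>.  So \<open>- \<pi> < \<Theta>(K) < - \<pi>/2\<close> for large \<open>\<delta>\<close> (\<open>three_Theta\<close>), and
  monotonicity leaves exactly the eigenvalues \<open>0\<close> and \<open>\<plusminus> E\<close> in \<open>[-K, K]\<close>, with \<open>\<Theta>(E) = - \<pi>/2\<close>.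

  For the asymptotics write the solution at this \<open>E\<close>, normalized at the origin, as \<open>p = e\<^sup>-\<^sup>P Q\<close>, \<open>-c = e\<^sup>P C\<close>
  with \<open>P\<close> the primitive of the mass.  Then \<open>Q' = E e\<^sup>2\<^sup>P C\<close>, \<open>C' = - E e\<^sup>-\<^sup>2\<^sup>P Q\<close>, so \<open>Q\<close> increases and \<open>C\<close>
  decreases.  Near the origin \<open>e\<^sup>P\<close> is the one-wall profile \<open>h\<close>, so \<open>C\<close> stays close to \<open>1\<close> while \<open>Q\<close> grows
  to \<open>E N / 2\<close>, where \<open>N\<close> is the integral of \<open>h\<^sup>2\<close>.  Near \<open>2\<delta>\<close> it is \<open>e\<^sup>-\<^sup>P\<close> that is a multiple of the shifted
  profile, with factor \<open>1 / h(\<delta>)\<^sup>2\<close>, so \<open>Q\<close> is nearly constant and \<open>C\<close> drops from \<open>1\<close> to \<open>0\<close> by about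
  \<open>E\<^sup>2 (N / 2) N / h(\<delta>)\<^sup>4\<close>.  Hence \<open>E\<close> is close to \<open>\<surd>2 h(\<delta>)\<^sup>2 / N\<close> (\<open>E_error\<close>).  Keeping track of the errors
  gives pointwise bounds by exponentials centred at the walls (\<open>c_error\<close>, \<open>p_error\<close>), and these integrate to
  the estimate in the norm (\<open>eigenfunction_error\<close>).
\<close>

section \<open>Antiderivatives and comparison of growth\<close>

lemma mass_integral_0 [simp]: "mass_integral m 0 = 0"
  by (simp add: mass_integral_def)

lemma mass_integral_deriv:
  fixes m :: "real \<Rightarrow> real"
  assumes "continuous_on UNIV m"
  shows "(mass_integral m has_real_derivative m x) (at x)"
proof -
  define R where "R = \<bar>x\<bar> + 1"
  have "((\<lambda>u. LBINT y=ereal 0..ereal u. m y) has_vector_derivative m x) (at x within {-R..R})"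
    by (rule interval_integral_FTC2)
      (auto simp: R_def intro: continuous_on_subset[OF assms])
  moreover have "x \<in> interior {-R..R}"
    by (auto simp: R_def)
  ultimately show ?thesis
    unfolding mass_integral_def has_real_derivative_iff_has_vector_derivative
    by (metis at_within_interior)
qed

lemma mass_integral_continuous:
  assumes "continuous_on UNIV m"
  shows "continuous_on UNIV (mass_integral m)"
  using mass_integral_deriv[OF assms] by (meson DERIV_isCont continuous_at_imp_continuous_on)

lemma real_derivative_unique:
  fixes F G f :: "real \<Rightarrow> real"
  assumes "\<And>x. (F has_real_derivative f x) (at x)" "\<And>x. (G has_real_derivative f x) (at x)"
    "F c = G c"
  shows "F x = G x"
proof -
  have "((\<lambda>x. F x - G x) has_real_derivative 0) (at x)" for x
    by (rule derivative_eq_intros assms)+ simp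
  then have "F x - G x = F c - G c"
    using DERIV_isconst_all by blast
  then show ?thesis using assms by simp
qed

lemma mass_integral_unique:
  assumes "\<And>x. (F has_real_derivative m x) (at x)" "continuous_on UNIV m" "F 0 = 0"
  shows "mass_integral m x = F x"
  using real_derivative_unique[OF mass_integral_deriv[OF assms(2)] assms(1), of 0 x] assms(3) by simp

lemma deriv_le_imp_le:
  fixes F G :: "real \<Rightarrow> real"
  assumes "a \<le> b"
    and "\<And>x. a \<le> x \<Longrightarrow> x \<le> b \<Longrightarrow> (F has_real_derivative F' x) (at x)"
    and "\<And>x. a \<le> x \<Longrightarrow> x \<le> b \<Longrightarrow> (G has_real_derivative G' x) (at x)"
    and "\<And>x. a \<le> x \<Longrightarrow> x \<le> b \<Longrightarrow> F' x \<le> G' x"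
  shows "F b - F a \<le> G b - G a"
proof -
  have "(\<lambda>x. G x - F x) a \<le> (\<lambda>x. G x - F x) b"
  proof (rule DERIV_nonneg_imp_nondecreasing[OF assms(1)])
    fix x assume x: "a \<le> x" "x \<le> b"
    show "\<exists>y. ((\<lambda>x. G x - F x) has_real_derivative y) (at x) \<and> 0 \<le> y"
      using assms(4)[OF x] DERIV_diff[OF assms(3)[OF x] assms(2)[OF x]]
      by (intro exI[of _ "G' x - F' x"]) simp
  qed
  then show ?thesis by simp
qed

text \<open>Integrating an exponential weight gains the factor \<open>1 / w\<close>; with \<open>w\<close> large this makes the Picard
  map a contraction on the whole line at once.\<close>

lemma abs_le_exp_of_deriv:
  fixes F :: "real \<Rightarrow> real"
  assumes F0: "F 0 = 0" and F: "\<And>x. (F has_real_derivative f x) (at x)"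
    and f: "\<And>x. \<bar>f x\<bar> \<le> A * exp (w * \<bar>x\<bar>)" and w: "0 < w" and A: "0 \<le> A"
  shows "\<bar>F x\<bar> \<le> A / w * exp (w * \<bar>x\<bar>)"
proof -
  have *: "\<bar>F y\<bar> \<le> A / w * exp (w * \<bar>y\<bar>)"
    if F0: "F 0 = 0" and F: "\<And>x. (F has_real_derivative f x) (at x)"
    and f: "\<And>x. \<bar>f x\<bar> \<le> A * exp (w * \<bar>x\<bar>)" and y: "0 \<le> y" for F f :: "real \<Rightarrow> real" and y
  proof -
    have G: "((\<lambda>x. A / w * exp (w * x)) has_real_derivative A * exp (w * x)) (at x)" for x
      using w by (auto intro!: derivative_eq_intros)
    have f': "\<bar>f x\<bar> \<le> A * exp (w * x)" if "0 \<le> x" for x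
      using f[of x] that by simp
    have "F y - F 0 \<le> A / w * exp (w * y) - A / w * exp (w * 0)"
      by (rule deriv_le_imp_le[OF y F G]) (use f' in \<open>force simp: abs_le_iff\<close>)
    moreover have "(- F y) - (- F 0) \<le> A / w * exp (w * y) - A / w * exp (w * 0)"
      by (rule deriv_le_imp_le[OF y _ G]) (use f' F in \<open>auto simp: abs_le_iff intro!: derivative_eq_intros\<close>)
    moreover have "A / w * exp (w * 0) \<ge> 0" using A w by simp
    ultimately show ?thesis using F0 y by simp
  qed
  show ?thesis
  proof (cases "0 \<le> x")
    case True
    then show ?thesis using *[OF F0 F f] by simp
  next
    case False
    have "((\<lambda>x. F (- x)) has_real_derivative - f (- y)) (at y)" for y
      using DERIV_mirror[of F "f (-y)" y] F by simp
    from *[of "\<lambda>x. F (- x)" "\<lambda>y. - f (- y)" "- x", OF _ this] F0 f[of "- _"] False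
    show ?thesis by simp
  qed
qed

section \<open>The Pruefer angle\<close>

text \<open>The equation of the angle \<open>\<theta>\<close> of a solution \<open>(r cos \<theta>, r sin \<theta>)\<close> of \<open>a' = - m a - E c\<close>, \<open>c' = m c + E a\<close>.
  It is stated at one point because angles are compared on intervals where a constant or a translate
  solves the equation only there.\<close>

definition prufer_at :: "(real \<Rightarrow> real) \<Rightarrow> real \<Rightarrow> (real \<Rightarrow> real) \<Rightarrow> real \<Rightarrow> bool" where
  "prufer_at m E \<theta> x \<longleftrightarrow> (\<theta> has_real_derivative E + m x * sin (2 * \<theta> x)) (at x)"

lemma sin_diff_le: "\<bar>sin x - sin y\<bar> \<le> \<bar>x - y :: real\<bar>"
proof -
  have "sin x - sin y = 2 * sin ((x - y) / 2) * cos ((x + y) / 2)"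
    by (rule sin_diff_sin)
  then have "\<bar>sin x - sin y\<bar> = 2 * \<bar>sin ((x - y) / 2)\<bar> * \<bar>cos ((x + y) / 2)\<bar>"
    by (simp add: abs_mult)
  also have "\<dots> \<le> 2 * \<bar>(x - y) / 2\<bar> * 1"
    by (intro mult_mono abs_sin_x_le_abs_x) auto
  finally show ?thesis by simp
qed

text \<open>The right-hand side is globally Lipschitz in the angle with constant \<open>2 B\<close>.  Banach's fixed point
  theorem is applied to \<open>v = (\<theta> - t0) / exp (w \<bar>x\<bar>)\<close>, a bounded continuous function, where \<open>w = 4 B + 1\<close>
  makes the contraction factor at most \<open>1 / 2\<close>.\<close>

lemma prufer_exists_0:
  fixes m :: "real \<Rightarrow> real"
  assumes m: "continuous_on UNIV m" and B: "\<And>x. \<bar>m x\<bar> \<le> B"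
  obtains \<theta> where "\<theta> 0 = t0" "\<And>x. prufer_at m E \<theta> x"
proof -
  have B0: "0 \<le> B" using B[of 0] by linarith
  \<comment> \<open>any weight of at least twice the Lipschitz constant \<open>2 B\<close> halves distances\<close>
  define w where "w = 4 * B + 1"
  have w: "w > 0" using B0 by (simp add: w_def)
  define g where "g v s = E + m s * sin (2 * (t0 + exp (w * \<bar>s\<bar>) * v s))" for v :: "real \<Rightarrow> real" and s
  define T where "T v x = exp (- (w * \<bar>x\<bar>)) * mass_integral (g v) x" for v x
  have gc: "continuous_on UNIV (g v)" if "continuous_on UNIV v" for v
    unfolding g_def by (intro continuous_intros m that)
  have gd: "(mass_integral (g v) has_real_derivative g v x) (at x)" if "continuous_on UNIV v" for v x
    by (rule mass_integral_deriv[OF gc[OF that]])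
  have Tb: "T v \<in> bcontfun" if v: "continuous_on UNIV v" for v
  proof (rule bcontfun_normI)
    show "continuous_on UNIV (T v)"
      unfolding T_def by (intro continuous_intros mass_integral_continuous gc v)
    fix x :: real
    have "\<bar>mass_integral (g v) x\<bar> \<le> (\<bar>E\<bar> + B) / w * exp (w * \<bar>x\<bar>)"
    proof (rule abs_le_exp_of_deriv[OF _ gd[OF v]])
      fix x
      have "\<bar>g v x\<bar> \<le> \<bar>E\<bar> + \<bar>m x\<bar> * \<bar>sin (2 * (t0 + exp (w * \<bar>x\<bar>) * v x))\<bar>"
        unfolding g_def abs_mult[symmetric] by (rule abs_triangle_ineq)
      also have "\<dots> \<le> \<bar>E\<bar> + B * 1"
        using B B0 by (intro add_left_mono mult_mono) auto
      also have "\<dots> \<le> (\<bar>E\<bar> + B) * exp (w * \<bar>x\<bar>)"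
      proof -
        have "1 \<le> exp (w * \<bar>x\<bar>)" using w by simp
        then show ?thesis using B0 mult_left_mono[of 1 "exp (w * \<bar>x\<bar>)" "\<bar>E\<bar> + B"] by simp
      qed
      finally show "\<bar>g v x\<bar> \<le> (\<bar>E\<bar> + B) * exp (w * \<bar>x\<bar>)" .
    qed (use w B0 in auto)
    then have "exp (- (w * \<bar>x\<bar>)) * \<bar>mass_integral (g v) x\<bar> \<le> exp (- (w * \<bar>x\<bar>)) * ((\<bar>E\<bar> + B) / w * exp (w * \<bar>x\<bar>))"
      by (intro mult_left_mono) auto
    also have "\<dots> = (\<bar>E\<bar> + B) / w" by (simp add: exp_minus)
    finally show "norm (T v x) \<le> (\<bar>E\<bar> + B) / w"
      by (simp add: T_def abs_mult)
  qed
  have cb: "continuous_on UNIV (apply_bcontfun v)" for v :: "real \<Rightarrow>\<^sub>C real"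
    by (simp add: continuous_on_apply_bcontfun)
  define F where "F v = Bcontfun (T (apply_bcontfun v))" for v :: "real \<Rightarrow>\<^sub>C real"
  have Fap: "apply_bcontfun (F v) x = T (apply_bcontfun v) x" for v x
    unfolding F_def by (subst Bcontfun_inverse[OF Tb[OF cb]]) simp
  have contr: "dist (F u) (F v) \<le> (1/2) * dist u v" for u v
  proof (rule dist_bound)
    fix x
    define D where "D y = mass_integral (g (apply_bcontfun u)) y - mass_integral (g (apply_bcontfun v)) y" for y
    have "\<bar>D x\<bar> \<le> (2 * B * dist u v) / w * exp (w * \<bar>x\<bar>)"
    proof (rule abs_le_exp_of_deriv)
      show "(D has_real_derivative g (apply_bcontfun u) y - g (apply_bcontfun v) y) (at y)" for y
        unfolding D_def by (intro DERIV_diff gd cb)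
      fix y
      have "g (apply_bcontfun u) y - g (apply_bcontfun v) y = m y * (sin (2 * (t0 + exp (w * \<bar>y\<bar>) * u y)) - sin (2 * (t0 + exp (w * \<bar>y\<bar>) * v y)))"
        by (simp add: g_def algebra_simps)
      then have "\<bar>g (apply_bcontfun u) y - g (apply_bcontfun v) y\<bar> = \<bar>m y\<bar> * \<bar>sin (2 * (t0 + exp (w * \<bar>y\<bar>) * u y)) - sin (2 * (t0 + exp (w * \<bar>y\<bar>) * v y))\<bar>"
        by (simp add: abs_mult)
      also have "\<dots> \<le> B * (2 * exp (w * \<bar>y\<bar>) * dist u v)"
      proof (intro mult_mono B)
        have "\<bar>sin (2 * (t0 + exp (w * \<bar>y\<bar>) * u y)) - sin (2 * (t0 + exp (w * \<bar>y\<bar>) * v y))\<bar>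
          \<le> \<bar>2 * (t0 + exp (w * \<bar>y\<bar>) * u y) - 2 * (t0 + exp (w * \<bar>y\<bar>) * v y)\<bar>"
          by (rule sin_diff_le)
        also have "\<dots> = \<bar>2 * exp (w * \<bar>y\<bar>) * (u y - v y)\<bar>" by (simp add: algebra_simps)
        also have "\<dots> = 2 * exp (w * \<bar>y\<bar>) * \<bar>u y - v y\<bar>" by (simp add: abs_mult)
        also have "\<dots> \<le> 2 * exp (w * \<bar>y\<bar>) * dist u v"
          using dist_bounded[of u y v] by (intro mult_left_mono) (auto simp: dist_real_def)
        finally show "\<bar>sin (2 * (t0 + exp (w * \<bar>y\<bar>) * u y)) - sin (2 * (t0 + exp (w * \<bar>y\<bar>) * v y))\<bar>
          \<le> 2 * exp (w * \<bar>y\<bar>) * dist u v" .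
      qed (use B0 in auto)
      finally show "\<bar>g (apply_bcontfun u) y - g (apply_bcontfun v) y\<bar> \<le> 2 * B * dist u v * exp (w * \<bar>y\<bar>)"
        by (simp add: algebra_simps)
    qed (use w B0 in \<open>auto simp: D_def\<close>)
    then have "exp (- (w * \<bar>x\<bar>)) * \<bar>D x\<bar> \<le> exp (- (w * \<bar>x\<bar>)) * ((2 * B * dist u v) / w * exp (w * \<bar>x\<bar>))"
      by (intro mult_left_mono) auto
    also have "\<dots> = 2 * B / w * dist u v" by (simp add: exp_minus field_simps)
    also have "\<dots> \<le> (1/2) * dist u v"
      using B0 w by (intro mult_right_mono) (auto simp: w_def field_simps)
    finally have "exp (- (w * \<bar>x\<bar>)) * \<bar>D x\<bar> \<le> (1/2) * dist u v" .
    moreover have "dist (F u x) (F v x) = exp (- (w * \<bar>x\<bar>)) * \<bar>D x\<bar>"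
    proof -
      have "F u x - F v x = exp (- (w * \<bar>x\<bar>)) * D x"
        by (simp add: Fap T_def D_def algebra_simps)
      then show ?thesis by (simp add: dist_real_def abs_mult)
    qed
    ultimately show "dist (F u x) (F v x) \<le> (1/2) * dist u v" by simp
  qed
  obtain v where v: "F v = v"
    using banach_fix_type[of "1/2" F] contr by auto
  define \<theta> where "\<theta> x = t0 + exp (w * \<bar>x\<bar>) * apply_bcontfun v x" for x
  have \<theta>: "\<theta> x = t0 + mass_integral (g (apply_bcontfun v)) x" for x
  proof -
    have "apply_bcontfun v x = T (apply_bcontfun v) x" by (metis Fap v)
    then show ?thesis by (simp add: \<theta>_def T_def exp_minus)
  qed
  have "\<theta> 0 = t0" by (simp add: \<theta>)
  moreover have "prufer_at m E \<theta> x" for x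
  proof -
    have "(\<theta> has_real_derivative g (apply_bcontfun v) x) (at x)"
      unfolding \<theta>[abs_def] using gd[OF cb] by (auto intro!: derivative_eq_intros)
    then show ?thesis by (simp add: prufer_at_def g_def \<theta>_def)
  qed
  ultimately show ?thesis by (rule that)
qed

lemma prufer_exists:
  fixes m :: "real \<Rightarrow> real"
  assumes m: "continuous_on UNIV m" and B: "\<And>x. \<bar>m x\<bar> \<le> B"
  obtains \<theta> where "\<theta> x0 = t0" "\<And>x. prufer_at m E \<theta> x"
proof -
  have c: "continuous_on UNIV (\<lambda>x. m (x + x0))"
    by (intro continuous_on_compose2[OF m] continuous_intros) auto
  obtain t where t: "t 0 = t0" "\<And>x. prufer_at (\<lambda>x. m (x + x0)) E t x"
    using prufer_exists_0[OF c, of B t0 E] B by blast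
  have "prufer_at m E (\<lambda>x. t (x - x0)) x" for x
    using t(2)[of "x - x0"] DERIV_shift[of "\<lambda>x. t (x - x0)" _ "x - x0" x0] unfolding prufer_at_def by simp
  with t(1) show ?thesis by (intro that[of "\<lambda>x. t (x - x0)"]) auto
qed

text \<open>Since \<open>sin 2\<theta>\<^sub>1 - sin 2\<theta>\<^sub>2 = 2 cos (\<theta>\<^sub>1 + \<theta>\<^sub>2) sin (\<theta>\<^sub>1 - \<theta>\<^sub>2)\<close> and \<open>sin w / w\<close> extends continuously to \<open>0\<close>,
  the difference of two angles solves a linear equation with source \<open>E1 - E2\<close>, and \<open>\<mu>\<close> is its integrating
  factor.  Comparison, uniqueness and continuous dependence all follow from this one identity.\<close>

lemma prufer_difference:
  fixes m :: "real \<Rightarrow> real"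
  assumes m: "continuous_on UNIV m" and B: "\<And>x. \<bar>m x\<bar> \<le> B"
    and c1: "continuous_on UNIV \<theta>1" and c2: "continuous_on UNIV \<theta>2"
  obtains \<mu> where "\<And>x. \<mu> x > 0" "\<mu> x0 = 1" "\<And>x. \<mu> x \<le> exp (2 * B * \<bar>x - x0\<bar>)"
    "\<And>x. exp (- (2 * B * \<bar>x - x0\<bar>)) \<le> \<mu> x"
    "\<And>x. prufer_at m E1 \<theta>1 x \<Longrightarrow> prufer_at m E2 \<theta>2 x \<Longrightarrow>
       ((\<lambda>x. \<mu> x * (\<theta>1 x - \<theta>2 x)) has_real_derivative \<mu> x * (E1 - E2)) (at x)"
proof -
  define sc where "sc x = (if x = 0 then 1 else sin x / x)" for x :: real
  have sc: "sin x = x * sc x" for x by (simp add: sc_def)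
  have sc1: "\<bar>sc x\<bar> \<le> 1" for x
    using abs_sin_x_le_abs_x[of x] by (auto simp: sc_def abs_divide divide_le_eq_1)
  have "isCont sc x" for x
  proof (cases "x = 0")
    case True
    have "((\<lambda>x::real. sin x / x) \<longlongrightarrow> 1) (at 0)"
      using DERIV_sin[of 0] by (simp add: has_field_derivative_iff)
    then have "(sc \<longlongrightarrow> 1) (at 0)"
      by (rule Lim_transform_eventually) (auto simp: sc_def eventually_at_filter)
    then show ?thesis by (simp add: True isCont_def sc_def)
  next
    case False
    have "isCont (\<lambda>x. sin x / x) x" using False by (intro continuous_intros) auto
    moreover have "eventually (\<lambda>y. sin y / y = sc y) (nhds x)"
      by (rule eventually_mono[OF t1_space_nhds[OF False]]) (simp add: sc_def)
    ultimately show ?thesis using isCont_cong[of "\<lambda>x. sin x / x" sc x] by blast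
  qed
  then have scc: "continuous_on UNIV sc" by (simp add: continuous_at_imp_continuous_on)
  define q where "q x = 2 * m x * cos (\<theta>1 x + \<theta>2 x) * sc (\<theta>1 x - \<theta>2 x)" for x
  have qc: "continuous_on UNIV q"
    unfolding q_def by (intro continuous_intros m c1 c2 continuous_on_compose2[OF scc]) auto
  have qb: "\<bar>q x\<bar> \<le> 2 * B" for x
  proof -
    have "\<bar>q x\<bar> = 2 * \<bar>m x\<bar> * \<bar>cos (\<theta>1 x + \<theta>2 x)\<bar> * \<bar>sc (\<theta>1 x - \<theta>2 x)\<bar>"
      by (simp add: q_def abs_mult)
    also have "\<dots> \<le> 2 * B * 1 * 1"
      using B[of x] sc1 by (intro mult_mono) auto
    finally show ?thesis by simp
  qed
  define Q where "Q x = mass_integral q x - mass_integral q x0" for x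
  have Qd: "(Q has_real_derivative q x) (at x)" for x
    unfolding Q_def using mass_integral_deriv[OF qc] by (auto intro!: derivative_eq_intros)
  have Qb: "\<bar>Q x\<bar> \<le> 2 * B * \<bar>x - x0\<bar>" for x
  proof -
    have "norm (Q x - Q x0) \<le> 2 * B * norm (x - x0)"
      by (rule field_differentiable_bound[of UNIV Q q]) (use Qd qb in auto)
    then show ?thesis by (simp add: Q_def)
  qed
  define \<mu> where "\<mu> x = exp (- Q x)" for x
  show ?thesis
  proof (rule that[of \<mu>])
    show "\<mu> x > 0" for x by (simp add: \<mu>_def)
    show "\<mu> x0 = 1" by (simp add: \<mu>_def Q_def)
    show "\<mu> x \<le> exp (2 * B * \<bar>x - x0\<bar>)" "exp (- (2 * B * \<bar>x - x0\<bar>)) \<le> \<mu> x" for x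
      using Qb[of x] by (auto simp: \<mu>_def abs_le_iff)
    fix x assume p: "prufer_at m E1 \<theta>1 x" "prufer_at m E2 \<theta>2 x"
    have "(2 * \<theta>1 x - 2 * \<theta>2 x) / 2 = \<theta>1 x - \<theta>2 x" "(2 * \<theta>1 x + 2 * \<theta>2 x) / 2 = \<theta>1 x + \<theta>2 x"
      by auto
    then have "sin (2 * \<theta>1 x) - sin (2 * \<theta>2 x) = 2 * sin (\<theta>1 x - \<theta>2 x) * cos (\<theta>1 x + \<theta>2 x)"
      using sin_diff_sin[of "2 * \<theta>1 x" "2 * \<theta>2 x"] by metis
    then have "m x * sin (2 * \<theta>1 x) - m x * sin (2 * \<theta>2 x) = q x * (\<theta>1 x - \<theta>2 x)"
      unfolding right_diff_distrib[symmetric] q_def sc[of "\<theta>1 x - \<theta>2 x"] by simp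
    then have eq: "(E1 + m x * sin (2 * \<theta>1 x)) - (E2 + m x * sin (2 * \<theta>2 x)) = E1 - E2 + q x * (\<theta>1 x - \<theta>2 x)"
      by linarith
    have "((\<lambda>x. \<mu> x * (\<theta>1 x - \<theta>2 x)) has_real_derivative
       (- q x * \<mu> x) * (\<theta>1 x - \<theta>2 x) + \<mu> x * ((E1 + m x * sin (2 * \<theta>1 x)) - (E2 + m x * sin (2 * \<theta>2 x)))) (at x)"
      unfolding \<mu>_def using p Qd unfolding prufer_at_def
      by (auto intro!: derivative_eq_intros)
    then show "((\<lambda>x. \<mu> x * (\<theta>1 x - \<theta>2 x)) has_real_derivative \<mu> x * (E1 - E2)) (at x)"
      unfolding eq by (simp add: algebra_simps)
  qed
qed

section \<open>Weak derivatives on the line\<close>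

lemma test_functionI:
  assumes d: "\<And>x. (\<phi> has_real_derivative \<phi>' x) (at x)" and c: "continuous_on UNIV \<phi>'"
    and s: "\<And>x. R < \<bar>x\<bar> \<Longrightarrow> \<phi> x = 0"
  shows "test_function \<phi>" "deriv \<phi> = \<phi>'"
proof -
  have "\<phi> C1_differentiable_on UNIV"
    unfolding C1_differentiable_on_def
    using d c by (auto simp: has_real_derivative_iff_has_vector_derivative)
  moreover have "closure {x. \<phi> x \<noteq> 0} \<subseteq> {-R..R}"
    by (rule closure_minimal) (use s in \<open>force+\<close>)
  then have "compact (closure {x. \<phi> x \<noteq> 0})"
    by (meson bounded_closed_interval bounded_subset closed_closure compact_eq_bounded_closed)
  ultimately show "test_function \<phi>" by (simp add: test_function_def)
  show "deriv \<phi> = \<phi>'" using d DERIV_imp_deriv by blast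
qed

text \<open>The radius is taken strictly beyond the support, so that the derivative vanishes on \<open>R \<le> \<bar>x\<bar>\<close> as well.\<close>

lemma test_functionE:
  assumes "test_function \<phi>"
  obtains R where "R > 0" "\<And>x. R \<le> \<bar>x\<bar> \<Longrightarrow> \<phi> x = 0" "\<And>x. R \<le> \<bar>x\<bar> \<Longrightarrow> deriv \<phi> x = 0"
    "\<And>x. (\<phi> has_real_derivative deriv \<phi> x) (at x)" "continuous_on UNIV (deriv \<phi>)"
    "continuous_on UNIV \<phi>"
proof -
  obtain D where D: "\<And>x. (\<phi> has_real_derivative D x) (at x)" "continuous_on UNIV D"
    using assms unfolding test_function_def C1_differentiable_on_def
    by (auto simp: has_real_derivative_iff_has_vector_derivative)
  have DD: "deriv \<phi> = D" using D DERIV_imp_deriv by blast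
  have "bounded (closure {x. \<phi> x \<noteq> 0})"
    using assms by (simp add: test_function_def compact_imp_bounded)
  then obtain r where r: "\<And>x. x \<in> closure {x. \<phi> x \<noteq> 0} \<Longrightarrow> \<bar>x\<bar> \<le> r"
    unfolding bounded_iff by auto
  have z: "\<phi> x = 0" if "\<bar>x\<bar> > r" for x
    using r[of x] closure_subset[of "{x. \<phi> x \<noteq> 0}"] that by force
  define R where "R = \<bar>r\<bar> + 1"
  have dz: "D x = 0" if "\<bar>x\<bar> \<ge> R" for x
  proof -
    have "((\<lambda>x. 0) has_real_derivative D x) (at x)"
    proof (rule has_field_derivative_transform_within_open[OF D(1), of "- {-\<bar>r\<bar>..\<bar>r\<bar>}"])
      show "open (- {-\<bar>r\<bar>..\<bar>r\<bar>})" by auto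
      show "x \<in> - {- \<bar>r\<bar>..\<bar>r\<bar>}" using that by (auto simp: R_def)
      show "\<phi> y = 0" if "y \<in> - {- \<bar>r\<bar>..\<bar>r\<bar>}" for y
        using that by (intro z) (auto simp: abs_if split: if_splits)
    qed
    then show ?thesis using DERIV_unique[of "\<lambda>x. 0" "D x" x 0] by simp
  qed
  show ?thesis
  proof (rule that[of R])
    show "continuous_on UNIV \<phi>"
      using D(1) by (meson DERIV_isCont continuous_at_imp_continuous_on)
  qed (use D dz z in \<open>auto simp: R_def DD\<close>)
qed

lemma integrable_compact_support_mult:
  fixes h :: "real \<Rightarrow> 'b::euclidean_space"
  assumes c: "continuous_on UNIV \<psi>" and s: "\<And>x. R \<le> \<bar>x\<bar> \<Longrightarrow> \<psi> x = (0::real)"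
    and h: "\<And>R. set_integrable lborel {-R..R} h" and hm: "h \<in> borel_measurable lborel"
  shows "integrable lborel (\<lambda>x. \<psi> x *\<^sub>R h x)"
proof -
  have "compact (\<psi> ` {-R..R})"
    by (intro compact_continuous_image continuous_on_subset[OF c]) auto
  then have "bounded (\<psi> ` {-R..R})" by (rule compact_imp_bounded)
  then obtain B where "\<forall>y \<in> \<psi> ` {-R..R}. norm y \<le> B"
    unfolding bounded_iff ..
  then have B: "\<And>x. x \<in> {-R..R} \<Longrightarrow> \<bar>\<psi> x\<bar> \<le> B" by simp
  have "integrable lborel (\<lambda>x. B *\<^sub>R (indicator {-R..R} x *\<^sub>R h x))"
    using h[of R] unfolding set_integrable_def by (rule integrable_scaleR_right)
  then show ?thesis
  proof (rule Bochner_Integration.integrable_bound)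
    show "(\<lambda>x. \<psi> x *\<^sub>R h x) \<in> borel_measurable lborel"
      using borel_measurable_continuous_onI[OF c] hm by simp
    have "norm (\<psi> x *\<^sub>R h x) \<le> norm (B *\<^sub>R indicat_real {- R..R} x *\<^sub>R h x)" for x
    proof (cases "x \<in> {-R..R}")
      case True
      then show ?thesis using B[OF True] by (auto intro!: mult_right_mono)
    next
      case False
      then have "R \<le> \<bar>x\<bar>" by auto
      then show ?thesis using s by simp
    qed
    then show "AE x in lborel. norm (\<psi> x *\<^sub>R h x) \<le> norm (B *\<^sub>R indicat_real {- R..R} x *\<^sub>R h x)" by simp
  qed
qed

text \<open>With \<open>v = n (max 0 ((x - a) (b - x)))\<^sup>2\<close> the quotient \<open>v / (1 + v)\<close> is continuously differentiable,
  because the square of a positive part is, and it increases with \<open>n\<close> to the indicator of the open interval.\<close>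

definition bump :: "real \<Rightarrow> real \<Rightarrow> real \<Rightarrow> real \<Rightarrow> real" where
  "bump n a b x = (let v = n * (max 0 ((x - a) * (b - x)))\<^sup>2 in v / (1 + v))"

lemma max_0_square_deriv: "((\<lambda>u::real. (max 0 u)\<^sup>2) has_real_derivative 2 * max 0 u) (at u)"
proof -
  consider "u < 0" | "u = 0" | "u > 0" by linarith
  then show ?thesis
  proof cases
    case 1
    have "((\<lambda>u::real. 0) has_real_derivative 2 * max 0 u) (at u)" using 1 by simp
    then show ?thesis
      by (rule has_field_derivative_transform_within_open[of _ _ _ "{..<0}"]) (use 1 in auto)
  next
    case 3
    have "((\<lambda>u::real. u\<^sup>2) has_real_derivative 2 * max 0 u) (at u)"
      using 3 by (auto intro!: derivative_eq_intros)
    then show ?thesis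
      by (rule has_field_derivative_transform_within_open[of _ _ _ "{0<..}"]) (use 3 in auto)
  next
    case 2
    have "((\<lambda>y::real. ((max 0 y)\<^sup>2 - 0) / (y - 0)) \<longlongrightarrow> 0) (at 0)"
    proof (rule Lim_null_comparison)
      show "\<forall>\<^sub>F y in at 0. norm (((max 0 y)\<^sup>2 - 0) / (y - 0)) \<le> \<bar>y::real\<bar>"
        by (auto simp: eventually_at_filter max_def power2_eq_square)
      show "((\<lambda>y::real. \<bar>y\<bar>) \<longlongrightarrow> 0) (at 0)"
        using tendsto_rabs_zero[OF tendsto_ident_at[of "0::real" UNIV]] by simp
    qed
    then show ?thesis using 2 by (simp add: has_field_derivative_iff)
  qed
qed

lemma bump_test_function:
  assumes n: "n \<ge> 0" and ab: "a < b"
  shows "test_function (bump n a b)"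
proof -
  define v where "v x = n * (max 0 ((x - a) * (b - x)))\<^sup>2" for x
  define v' where "v' x = n * (2 * max 0 ((x - a) * (b - x)) * (b - x - (x - a)))" for x
  have vd: "(v has_real_derivative v' x) (at x)" for x
    unfolding v_def v'_def
    by (rule DERIV_cmult, rule DERIV_chain2[where f = "\<lambda>u. (max 0 u)\<^sup>2", OF max_0_square_deriv])
      (auto intro!: derivative_eq_intros)
  have v0: "v x \<ge> 0" for x using n by (simp add: v_def)
  have c: "continuous_on UNIV v" "continuous_on UNIV v'"
    unfolding v_def v'_def by (intro continuous_intros)+
  show ?thesis
  proof (rule test_functionI)
    show "(bump n a b has_real_derivative v' x / (1 + v x)\<^sup>2) (at x)" for x
    proof -
      have "((\<lambda>x. v x / (1 + v x)) has_real_derivative (v' x * (1 + v x) - v x * (0 + v' x)) / ((1 + v x) * (1 + v x))) (at x)"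
        using v0[of x] by (intro derivative_intros vd) auto
      moreover have "(v' x * (1 + v x) - v x * (0 + v' x)) / ((1 + v x) * (1 + v x)) = v' x / (1 + v x)\<^sup>2"
        by (simp add: power2_eq_square algebra_simps)
      ultimately show ?thesis by (simp add: bump_def[abs_def] v_def Let_def)
    qed
    show "continuous_on UNIV (\<lambda>x. v' x / (1 + v x)\<^sup>2)"
      using v0 by (intro continuous_intros c) (simp add: add_nonneg_eq_0_iff)
    show "bump n a b x = 0" if "max \<bar>a\<bar> \<bar>b\<bar> < \<bar>x\<bar>" for x
    proof -
      have "x > b \<and> x > a \<or> x < a \<and> x < b" using that ab by auto
      then have "(x - a) * (b - x) \<le> 0" by (auto simp: mult_le_0_iff)
      then show ?thesis by (simp add: bump_def)
    qed
  qed
qed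

lemma bump_bounds:
  assumes n: "n \<ge> 0" shows "0 \<le> bump n a b x" "bump n a b x \<le> 1"
proof -
  define v where "v = n * (max 0 ((x - a) * (b - x)))\<^sup>2"
  have "v \<ge> 0" using n by (simp add: v_def)
  then show "0 \<le> bump n a b x" "bump n a b x \<le> 1" by (auto simp: bump_def Let_def simp flip: v_def)
qed

lemma bump_outside: "x \<notin> {a<..<b} \<Longrightarrow> a < b \<Longrightarrow> bump n a b x = 0"
proof -
  assume "x \<notin> {a<..<b}" "a < b"
  then have "(x - a) * (b - x) \<le> 0" by (auto simp: mult_le_0_iff not_less)
  then show ?thesis by (simp add: bump_def)
qed

lemma bump_tendsto:
  assumes "a < b"
  shows "(\<lambda>n. bump (real n) a b x) \<longlonglongrightarrow> indicator {a<..<b} x"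
proof (cases "x \<in> {a<..<b}")
  case True
  define v where "v = (max 0 ((x - a) * (b - x)))\<^sup>2"
  have v: "v > 0" using True by (auto simp: v_def)
  have "(\<lambda>n. 1 - inverse (1 + real n * v)) \<longlonglongrightarrow> 1 - 0"
  proof (intro tendsto_intros)
    have "filterlim (\<lambda>n. 1 + real n * v) at_top sequentially"
      using v
      by (intro filterlim_tendsto_add_at_top[OF tendsto_const] filterlim_at_top_mult_tendsto_pos[OF tendsto_const _ filterlim_real_sequentially])
    then show "(\<lambda>n. inverse (1 + real n * v)) \<longlonglongrightarrow> 0"
      by (rule tendsto_inverse_0_at_top)
  qed
  moreover have "bump (real n) a b x = 1 - inverse (1 + real n * v)" for n
  proof -
    have "1 + real n * v > 0" using v by (simp add: add_pos_nonneg)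
    then show ?thesis by (simp add: bump_def Let_def flip: v_def) (simp add: field_simps)
  qed
  ultimately show ?thesis using True by simp
next
  case False
  then show ?thesis using bump_outside[OF False assms] by simp
qed

text \<open>The bumps converge to indicators, so the integral over every interval vanishes; by Lebesgue's
  differentiation theorem the function is zero almost everywhere.\<close>

lemma fundamental_lemma:
  fixes h :: "real \<Rightarrow> 'b::euclidean_space"
  assumes h: "\<And>R. set_integrable lborel {-R..R} h" and hm: "h \<in> borel_measurable lborel"
    and z: "\<And>\<phi>. test_function \<phi> \<Longrightarrow> (\<integral>x. \<phi> x *\<^sub>R h x \<partial>lborel) = 0"
  shows "AE x in lborel. h x = 0"
proof -
  have hi: "set_integrable lborel {a..b} h" for a b
    by (rule set_integrable_subset[OF h[of "max \<bar>a\<bar> \<bar>b\<bar>"]]) auto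
  have I0: "integral {a..b} h = 0" for a b
  proof (cases "a < b")
    case True
    have "(\<lambda>n. \<integral>x. bump (real n) a b x *\<^sub>R h x \<partial>lborel) \<longlonglongrightarrow> (\<integral>x. indicator {a<..<b} x *\<^sub>R h x \<partial>lborel)"
    proof (rule integral_dominated_convergence[where w = "\<lambda>x. norm (indicator {a..b} x *\<^sub>R h x)"])
      show "integrable lborel (\<lambda>x. norm (indicator {a..b} x *\<^sub>R h x))"
        using hi unfolding set_integrable_def by (rule integrable_norm)
      show "AE x in lborel. (\<lambda>n. bump (real n) a b x *\<^sub>R h x) \<longlonglongrightarrow> indicator {a<..<b} x *\<^sub>R h x"
        by (intro AE_I2 tendsto_intros bump_tendsto True)
      show "AE x in lborel. norm (bump (real n) a b x *\<^sub>R h x) \<le> norm (indicator {a..b} x *\<^sub>R h x)" for n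
      proof (rule AE_I2)
        fix x
        show "norm (bump (real n) a b x *\<^sub>R h x) \<le> norm (indicator {a..b} x *\<^sub>R h x)"
        proof (cases "x \<in> {a<..<b}")
          case True
          then show ?thesis using bump_bounds[of "real n" a b x] by (auto intro!: mult_left_le_one_le)
        next
          case False
          then show ?thesis using bump_outside[OF False True] by simp
        qed
      qed
      show "(\<lambda>x. indicat_real {a<..<b} x *\<^sub>R h x) \<in> borel_measurable lborel" using hm by measurable
      show "(\<lambda>x. bump (real n) a b x *\<^sub>R h x) \<in> borel_measurable lborel" for n
      proof -
        obtain "continuous_on UNIV (bump (real n) a b)"
          using test_functionE[OF bump_test_function[OF _ True, of "real n"]] by auto
        then show ?thesis using hm borel_measurable_continuous_onI[of "bump (real n) a b"] by simp
      qed
    qed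
    then have "(\<lambda>n. 0) \<longlonglongrightarrow> (\<integral>x. indicator {a<..<b} x *\<^sub>R h x \<partial>lborel)"
      using z[OF bump_test_function[OF _ True]] by simp
    then have "(\<integral>x. indicator {a<..<b} x *\<^sub>R h x \<partial>lborel) = 0"
      using LIMSEQ_const_iff by metis
    moreover have "(\<integral>x. indicator {a<..<b} x *\<^sub>R h x \<partial>lborel) = (\<integral>x. indicator {a..b} x *\<^sub>R h x \<partial>lborel)"
    proof (rule integral_cong_AE)
      show "AE x in lborel. indicator {a<..<b} x *\<^sub>R h x = indicator {a..b} x *\<^sub>R h x"
        using AE_lborel_singleton[of a] AE_lborel_singleton[of b]
        by eventually_elim (auto simp: indicator_def)
    qed (use hm in measurable)
    ultimately have "(LINT x:{a..b}|lborel. h x) = 0" by (simp add: set_lebesgue_integral_def)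
    then show ?thesis using set_borel_integral_eq_integral(2)[OF hi] by simp
  next
    case False
    then have "a = b \<or> b < a" by linarith
    then show ?thesis by auto
  qed
  obtain N where N: "negligible N"
    "\<And>x e. \<lbrakk>x \<notin> N; 0 < e\<rbrakk> \<Longrightarrow> \<exists>d>0. \<forall>t. 0 < t \<and> t < d \<longrightarrow>
                         norm (integral (cbox x (x + t *\<^sub>R One)) h /\<^sub>R t ^ DIM(real) - h x) < e"
    using integrable_ccontinuous_explicit[of h] set_borel_integral_eq_integral(1)[OF hi] by (metis cbox_interval)
  have "h x = 0" if xN: "x \<notin> N" for x
  proof (rule ccontr)
    assume "h x \<noteq> 0"
    then obtain d where "d > 0" and d: "\<And>t. 0 < t \<and> t < d \<Longrightarrow> norm (integral (cbox x (x + t *\<^sub>R One)) h /\<^sub>R t ^ DIM(real) - h x) < norm (h x)"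
      using N(2)[OF xN, of "norm (h x)"] by auto
    from d[of "d/2"] show False using \<open>d > 0\<close> I0 by simp
  qed
  then have "AE x in lebesgue. h x = 0"
    using N(1) by (auto simp: negligible_iff_null_sets intro: AE_I'[of N])
  then show ?thesis by (simp add: AE_completion_iff)
qed

text \<open>For a test function \<open>\<psi>\<close> and a fixed bump \<open>\<eta>\<close> of mass \<open>J\<close>, the primitive of \<open>\<psi> - (\<integral>\<psi> / J) \<eta>\<close> is again a
  test function.  Testing with it shows that \<open>h\<close> minus its \<open>\<eta>\<close>-average is orthogonal to every \<open>\<psi>\<close>.\<close>

lemma du_bois_reymond:
  fixes h :: "real \<Rightarrow> 'b::euclidean_space"
  assumes h: "\<And>R. set_integrable lborel {-R..R} h" and hm: "h \<in> borel_measurable lborel"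
    and z: "\<And>\<phi>. test_function \<phi> \<Longrightarrow> (\<integral>x. deriv \<phi> x *\<^sub>R h x \<partial>lborel) = 0"
  shows "\<exists>c. AE x in lborel. h x = c"
proof -
  define \<eta> where "\<eta> = bump 1 (-1) 1"
  have \<eta>t: "test_function \<eta>" unfolding \<eta>_def by (rule bump_test_function) auto
  have \<eta>c: "continuous_on UNIV \<eta>" using test_functionE[OF \<eta>t] by metis
  have \<eta>0: "\<eta> x = 0" if "1 \<le> \<bar>x\<bar>" for x
    unfolding \<eta>_def by (rule bump_outside) (use that in auto)
  have Ieq: "integral {-R..R} \<psi> = (\<integral>x. \<psi> x \<partial>lborel)" and Iint: "integrable lborel \<psi>"
    if "continuous_on UNIV \<psi>" "\<And>x. R \<le> \<bar>x\<bar> \<Longrightarrow> \<psi> x = 0" for \<psi> :: "real \<Rightarrow> real" and R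
  proof -
    have s: "set_integrable lborel {-R..R} \<psi>"
      by (rule borel_integrable_atLeastAtMost') (use that continuous_on_subset in blast)
    have e: "indicator {-R..R} x *\<^sub>R \<psi> x = \<psi> x" for x
      using that(2)[of x] by (cases "x \<in> {-R..R}") auto
    show "integral {-R..R} \<psi> = (\<integral>x. \<psi> x \<partial>lborel)"
      using set_borel_integral_eq_integral(2)[OF s] by (simp only: set_lebesgue_integral_def e)
    show "integrable lborel \<psi>" using s by (simp only: set_integrable_def e)
  qed
  define J where "J = (\<integral>x. \<eta> x \<partial>lborel)"
  have J: "J > 0"
  proof -
    have pos: "\<eta> x > 0" if "x \<in> {-1<..<1}" for x
    proof -
      have u: "(x + 1) * (1 - x) > 0" using that by simp
      define v where "v = (max 0 ((x - (-1)) * (1 - x)))\<^sup>2"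
      have "v > 0" using u unfolding v_def by (intro zero_less_power) (simp add: max_def)
      moreover have "\<eta> x = v / (1 + v)" by (simp add: \<eta>_def bump_def Let_def v_def)
      ultimately show ?thesis by simp
    qed
    have nn: "\<eta> x \<ge> 0" for x using bump_bounds(1) by (simp add: \<eta>_def)
    have "J \<noteq> 0"
    proof
      assume "J = 0"
      then have "AE x in lborel. \<eta> x = 0"
        unfolding J_def using integral_nonneg_eq_0_iff_AE[OF Iint[OF \<eta>c \<eta>0]] nn by simp
      then have "AE x in lborel. x \<notin> {-1<..<1::real}"
        by eventually_elim (use pos in force)
      moreover have "{x \<in> space lborel. \<not> x \<notin> {-1<..<1::real}} = {-1<..<1}" by auto
      ultimately have "emeasure lborel {-1<..<1::real} = 0"
        by (subst (asm) AE_iff_measurable[of "{-1<..<1}"]) auto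
      then show False by simp
    qed
    moreover have "J \<ge> 0" unfolding J_def by (rule Bochner_Integration.integral_nonneg) (rule nn)
    ultimately show ?thesis by simp
  qed
  define c where "c = (1 / J) *\<^sub>R (\<integral>x. \<eta> x *\<^sub>R h x \<partial>lborel)"
  have "AE x in lborel. h x - c = 0"
  proof (rule fundamental_lemma)
    show hc: "set_integrable lborel {- R..R} (\<lambda>x. h x - c)" for R
      by (intro set_integral_diff h borel_integrable_atLeastAtMost') simp
    show "(\<lambda>x. h x - c) \<in> borel_measurable lborel" using hm by measurable
    fix \<psi> assume \<psi>t: "test_function \<psi>"
    obtain R where R: "R > 0" "\<And>x. R \<le> \<bar>x\<bar> \<Longrightarrow> \<psi> x = 0" and \<psi>c: "continuous_on UNIV \<psi>"
      using test_functionE[OF \<psi>t] by metis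
    define S where "S = max R 1"
    define P where "P = (\<integral>x. \<psi> x \<partial>lborel)"
    define g where "g x = \<psi> x - (P / J) * \<eta> x" for x
    have gc: "continuous_on UNIV g" unfolding g_def by (intro continuous_intros \<psi>c \<eta>c)
    have g0: "g x = 0" if "S \<le> \<bar>x\<bar>" for x
      using that R(2) \<eta>0 by (auto simp: g_def S_def)
    have gint: "(\<integral>x. g x \<partial>lborel) = 0"
      unfolding g_def using J Iint[OF \<psi>c R(2)] Iint[OF \<eta>c \<eta>0]
      by (simp add: P_def J_def)
    define \<phi> where "\<phi> x = mass_integral g x - mass_integral g (- S)" for x
    have \<phi>d: "(\<phi> has_real_derivative g x) (at x)" for x
      unfolding \<phi>_def using mass_integral_deriv[OF gc] by (auto intro!: derivative_eq_intros)
    have FTC: "integral {-S..S} g = \<phi> S - \<phi> (- S)"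
      by (intro integral_unique fundamental_theorem_of_calculus)
        (use \<phi>d in \<open>auto simp: S_def simp flip: has_real_derivative_iff_has_vector_derivative intro: has_field_derivative_at_within\<close>)
    then have \<phi>S: "\<phi> S = 0" "\<phi> (- S) = 0" using Ieq[OF gc g0] gint by (auto simp: \<phi>_def)
    have "\<phi> x = 0" if "S < \<bar>x\<bar>" for x
    proof (cases "x > 0")
      case True
      have "\<phi> x = \<phi> S"
      proof (rule DERIV_isconst_end[of S x \<phi>])
        show "S < x" using that True by auto
        show "continuous_on {S..x} \<phi>" by (auto intro!: continuous_at_imp_continuous_on DERIV_isCont[OF \<phi>d])
        show "(\<phi> has_real_derivative 0) (at y)" if "S < y" "y < x" for y
          using \<phi>d[of y] g0[of y] that by (simp add: S_def)
      qed
      then show ?thesis using \<phi>S by simp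
    next
      case False
      have "\<phi> (-S) = \<phi> x"
      proof (rule DERIV_isconst_end[of x "-S" \<phi>])
        show "x < -S" using that False by auto
        show "continuous_on {x..- S} \<phi>" by (auto intro!: continuous_at_imp_continuous_on DERIV_isCont[OF \<phi>d])
        show "(\<phi> has_real_derivative 0) (at y)" if "x < y" "y < - S" for y
          using \<phi>d[of y] g0[of y] that by simp
      qed
      then show ?thesis using \<phi>S by simp
    qed
    then have t: "test_function \<phi>" "deriv \<phi> = g"
      using test_functionI[OF \<phi>d gc] by auto
    have i1: "integrable lborel (\<lambda>x. \<psi> x *\<^sub>R h x)" and i2: "integrable lborel (\<lambda>x. \<eta> x *\<^sub>R h x)"
      by (rule integrable_compact_support_mult[OF \<psi>c R(2) h hm], simp)
         (rule integrable_compact_support_mult[OF \<eta>c \<eta>0 h hm], simp)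
    have "0 = (\<integral>x. \<psi> x *\<^sub>R h x - (P / J) *\<^sub>R (\<eta> x *\<^sub>R h x) \<partial>lborel)"
      using z[OF t(1)] by (simp add: t(2) g_def scaleR_diff_left)
    also have "\<dots> = (\<integral>x. \<psi> x *\<^sub>R h x \<partial>lborel) - (P / J) *\<^sub>R (\<integral>x. \<eta> x *\<^sub>R h x \<partial>lborel)"
      using i1 i2 by (simp del: scaleR_scaleR)
    also have "\<dots> = (\<integral>x. \<psi> x *\<^sub>R h x \<partial>lborel) - (\<integral>x. \<psi> x *\<^sub>R c \<partial>lborel)"
      using Iint[OF \<psi>c R(2)] by (simp add: c_def P_def)
    also have "\<dots> = (\<integral>x. \<psi> x *\<^sub>R (h x - c) \<partial>lborel)"
      using i1 Iint[OF \<psi>c R(2)] by (simp add: scaleR_diff_right)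
    finally show "(\<integral>x. \<psi> x *\<^sub>R (h x - c) \<partial>lborel) = 0" by simp
  qed
  then show ?thesis by auto
qed

section \<open>Square-integrable functions\<close>

lemma inner_H_self: "inner_H f f = complex_of_real (\<integral>x. (norm (f x))\<^sup>2 \<partial>lborel)"
proof -
  have "(\<Sum>j\<in>UNIV. cnj (f x $ j) * f x $ j) = complex_of_real ((norm (f x))\<^sup>2)" for x
  proof -
    have "(norm (f x))\<^sup>2 = (\<Sum>j\<in>UNIV. (cmod (f x $ j))\<^sup>2)"
      unfolding norm_vec_def L2_set_def by (simp add: sum_nonneg)
    moreover have "cnj z * z = complex_of_real ((cmod z)\<^sup>2)" for z
      using complex_norm_square[of z] by (simp add: mult.commute)
    ultimately show ?thesis by simp
  qed
  then show ?thesis unfolding inner_H_def by (simp del: of_real_power)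
qed

lemma norm_H_square: "(norm_H f)\<^sup>2 = (\<integral>x. (norm (f x))\<^sup>2 \<partial>lborel)"
  unfolding norm_H_def inner_H_self by simp

lemma norm_H_nonneg: "norm_H f \<ge> 0"
  unfolding norm_H_def inner_H_self by simp

lemma norm_H_eqI: "(\<integral>x. (norm (f x))\<^sup>2 \<partial>lborel) = r\<^sup>2 \<Longrightarrow> r \<ge> 0 \<Longrightarrow> norm_H f = r"
  by (metis norm_H_square norm_H_nonneg power2_eq_imp_eq)

lemma L2_set_integrable:
  assumes "f \<in> L2_space"
  shows "set_integrable lborel {a..b} f"
  unfolding set_integrable_def
proof (rule Bochner_Integration.integrable_bound[where f = "\<lambda>x. indicator {a..b} x + (norm (f x))\<^sup>2"])
  show "integrable lborel (\<lambda>x. indicator {a..b} x + (norm (f x))\<^sup>2)"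
    using assms by (intro Bochner_Integration.integrable_add integrable_real_indicator)
      (auto simp: L2_space_def emeasure_lborel_Icc_eq)
  show "(\<lambda>x. indicat_real {a..b} x *\<^sub>R f x) \<in> borel_measurable lborel"
    using assms by (auto simp: L2_space_def)
  have "norm (indicat_real {a..b} x *\<^sub>R f x) \<le> indicator {a..b} x + (norm (f x))\<^sup>2" for x
  proof -
    have "2 * norm (f x) \<le> 1 + (norm (f x))\<^sup>2"
      using sum_squares_bound[of 1 "norm (f x)"] by simp
    then have "norm (f x) \<le> 1 + (norm (f x))\<^sup>2" using norm_ge_zero[of "f x"] by linarith
    then show ?thesis by (simp add: indicator_def)
  qed
  then show "AE x in lborel. norm (indicat_real {a..b} x *\<^sub>R f x) \<le> norm (indicat_real {a..b} x + (norm (f x))\<^sup>2)"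
    by (intro AE_I2) (simp add: order_trans[OF _ abs_ge_self])
qed

lemma L2_measurable: "f \<in> L2_space \<Longrightarrow> f \<in> borel_measurable lborel"
  by (simp add: L2_space_def)

text \<open>\<open>weak_deriv\<close> is defined by choice; by the fundamental lemma the choice is immaterial up to null sets.\<close>

lemma weak_deriv_AE:
  assumes f: "f \<in> L2_space" and g: "g \<in> L2_space" and w: "is_weak_deriv f g"
  shows "f \<in> H1_space" "AE x in lborel. weak_deriv f x = g x"
proof -
  show "f \<in> H1_space" using assms by (auto simp: H1_space_def)
  have d: "weak_deriv f \<in> L2_space" "is_weak_deriv f (weak_deriv f)"
    using someI[of "\<lambda>g. g \<in> L2_space \<and> is_weak_deriv f g" g] g w by (auto simp: weak_deriv_def)
  have "AE x in lborel. weak_deriv f x - g x = 0"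
  proof (rule fundamental_lemma)
    show "set_integrable lborel {- R..R} (\<lambda>x. weak_deriv f x - g x)" for R
      by (intro set_integral_diff L2_set_integrable d g)
    show "(\<lambda>x. weak_deriv f x - g x) \<in> borel_measurable lborel"
      using L2_measurable[OF d(1)] L2_measurable[OF g] by simp
    fix \<phi> assume t: "test_function \<phi>"
    obtain R where R: "\<And>x. R \<le> \<bar>x\<bar> \<Longrightarrow> \<phi> x = 0" "continuous_on UNIV \<phi>"
      using test_functionE[OF t] by metis
    have i: "integrable lborel (\<lambda>x. \<phi> x *\<^sub>R h x)" if "h \<in> L2_space" for h
      by (rule integrable_compact_support_mult[OF R(2,1) L2_set_integrable[OF that] L2_measurable[OF that]]) simp
    have "(\<integral>x. \<phi> x *\<^sub>R (weak_deriv f x - g x) \<partial>lborel) = (\<integral>x. \<phi> x *\<^sub>R weak_deriv f x \<partial>lborel) - (\<integral>x. \<phi> x *\<^sub>R g x \<partial>lborel)"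
      using i[OF d(1)] i[OF g] by (simp add: scaleR_diff_right)
    also have "\<dots> = 0"
      using d(2)[unfolded is_weak_deriv_def, rule_format, OF t] w[unfolded is_weak_deriv_def, rule_format, OF t]
      by simp
    finally show "(\<integral>x. \<phi> x *\<^sub>R (weak_deriv f x - g x) \<partial>lborel) = 0" .
  qed
  then show "AE x in lborel. weak_deriv f x = g x" by simp
qed

lemma classical_is_weak_deriv:
  fixes f g :: "real \<Rightarrow> complex ^ 2"
  assumes d: "\<And>x. (f has_vector_derivative g x) (at x)" and c: "continuous_on UNIV g"
  shows "is_weak_deriv f g"
  unfolding is_weak_deriv_def
proof (intro allI impI)
  fix \<phi> assume t: "test_function \<phi>"
  obtain R where R: "R > 0" "\<And>x. R \<le> \<bar>x\<bar> \<Longrightarrow> \<phi> x = 0" "\<And>x. R \<le> \<bar>x\<bar> \<Longrightarrow> deriv \<phi> x = 0"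
    "\<And>x. (\<phi> has_real_derivative deriv \<phi> x) (at x)" "continuous_on UNIV (deriv \<phi>)" "continuous_on UNIV \<phi>"
    using test_functionE[OF t] by metis
  have fc: "continuous_on UNIV f"
    using d by (meson continuous_at_imp_continuous_on has_vector_derivative_continuous)
  have si: "set_integrable lborel {-R..R} h" if "continuous_on UNIV h" for h :: "real \<Rightarrow> complex ^ 2" and R
    by (rule borel_integrable_atLeastAtMost') (use that continuous_on_subset in blast)
  have i1: "integrable lborel (\<lambda>x. deriv \<phi> x *\<^sub>R f x)"
    by (rule integrable_compact_support_mult[OF R(5,3) si[OF fc]])
      (use borel_measurable_continuous_onI[OF fc] in auto)
  have i2: "integrable lborel (\<lambda>x. \<phi> x *\<^sub>R g x)"
    by (rule integrable_compact_support_mult[OF R(6,2) si[OF c]])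
      (use borel_measurable_continuous_onI[OF c] in auto)
  have "(\<integral>x. indicator {-R..R} x *\<^sub>R (deriv \<phi> x *\<^sub>R f x + \<phi> x *\<^sub>R g x) \<partial>lborel) = \<phi> R *\<^sub>R f R - \<phi> (-R) *\<^sub>R f (-R)"
  proof (rule integral_FTC_atLeastAtMost)
    show "- R \<le> R" using R(1) by simp
    show "((\<lambda>x. \<phi> x *\<^sub>R f x) has_vector_derivative deriv \<phi> x *\<^sub>R f x + \<phi> x *\<^sub>R g x) (at x within {- R..R})" for x
      using has_vector_derivative_scaleR[OF R(4) d, of x] by (auto simp: add.commute intro: has_vector_derivative_at_within)
    show "continuous_on {- R..R} (\<lambda>x. deriv \<phi> x *\<^sub>R f x + \<phi> x *\<^sub>R g x)"
      by (rule continuous_on_subset[of UNIV]) (intro continuous_intros R fc c, simp)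
  qed
  also have "\<dots> = 0" using R by simp
  also have "(\<lambda>x. indicator {-R..R} x *\<^sub>R (deriv \<phi> x *\<^sub>R f x + \<phi> x *\<^sub>R g x)) = (\<lambda>x. deriv \<phi> x *\<^sub>R f x + \<phi> x *\<^sub>R g x)"
  proof
    fix x show "indicator {-R..R} x *\<^sub>R (deriv \<phi> x *\<^sub>R f x + \<phi> x *\<^sub>R g x) = deriv \<phi> x *\<^sub>R f x + \<phi> x *\<^sub>R g x"
      using R(2,3)[of x] by (cases "x \<in> {-R..R}") auto
  qed
  finally have "(\<integral>x. deriv \<phi> x *\<^sub>R f x \<partial>lborel) + (\<integral>x. \<phi> x *\<^sub>R g x \<partial>lborel) = 0"
    using i1 i2 by simp
  then show "(\<integral>x. deriv \<phi> x *\<^sub>R f x \<partial>lborel) = - (\<integral>x. \<phi> x *\<^sub>R g x \<partial>lborel)"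
    by (simp add: add_eq_0_iff2)
qed

section \<open>Exponential weights\<close>

lemma integrable_exp_half_line:
  assumes "w > 0"
  shows "integrable lborel (\<lambda>x::real. indicator {0..} x * exp (- w * x))"
    "(\<integral>x. indicator {0..} x * exp (- w * x) \<partial>lborel) = 1 / w"
proof -
  have nn: "set_integrable lebesgue {0..} (\<lambda>x::real. exp (- w * x))"
    by (intro nonnegative_absolutely_integrable_1 integrable_on_exp_minus_to_infinity assms) auto
  have m: "(\<lambda>x::real. indicator {0..} x * exp (- w * x)) \<in> borel_measurable lborel" by measurable
  show i: "integrable lborel (\<lambda>x::real. indicator {0..} x * exp (- w * x))"
    using nn integrable_completion[OF m] by (simp add: set_integrable_def)
  then have s: "set_integrable lborel {0..} (\<lambda>x::real. exp (- w * x))" by (simp add: set_integrable_def)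
  show "(\<integral>x. indicator {0..} x * exp (- w * x) \<partial>lborel) = 1 / w"
    using set_borel_integral_eq_integral(2)[OF s] integral_unique[OF has_integral_exp_minus_to_infinity[OF assms, of 0]]
    by (simp add: set_lebesgue_integral_def)
qed

lemma integrable_exp_abs:
  assumes w: "w > 0"
  shows "integrable lborel (\<lambda>x::real. exp (- w * \<bar>x - y\<bar>))"
    "(\<integral>x. exp (- w * \<bar>x - y\<bar>) \<partial>lborel) = 2 / w"
proof -
  let ?g = "\<lambda>x::real. indicator {0..} x * exp (- w * x)"
  have i1: "integrable lborel ?g" "(\<integral>x. ?g x \<partial>lborel) = 1 / w"
    by (rule integrable_exp_half_line[OF w])+
  have i2: "integrable lborel (\<lambda>x. ?g (0 + (-1) * x))"
    by (rule lborel_integrable_real_affine[OF i1(1)]) simp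
  have e2: "(\<integral>x. ?g (0 + (-1) * x) \<partial>lborel) = 1 / w"
    using lborel_integral_real_affine[of "-1" ?g 0] i1(2) by simp
  have ae: "AE x in lborel. exp (- w * \<bar>x\<bar>) = ?g x + ?g (0 + (-1) * x)"
    using AE_lborel_singleton[of 0] by eventually_elim (auto simp: indicator_def)
  have m: "(\<lambda>x::real. exp (- w * \<bar>x\<bar>)) \<in> borel_measurable lborel" by measurable
  have j: "integrable lborel (\<lambda>x::real. exp (- w * \<bar>x\<bar>))"
    using integrable_cong_AE[OF m _ ae] i1(1) i2 by simp
  have v: "(\<integral>x. exp (- w * \<bar>x\<bar>) \<partial>lborel) = 2 / w"
    using integral_cong_AE[OF m _ ae] i1 i2 e2 by simp
  show "integrable lborel (\<lambda>x::real. exp (- w * \<bar>x - y\<bar>))"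
    using lborel_integrable_real_affine[OF j, of 1 "- y"] by simp
  show "(\<integral>x. exp (- w * \<bar>x - y\<bar>) \<partial>lborel) = 2 / w"
    using lborel_integral_real_affine[of 1 "\<lambda>x. exp (- w * \<bar>x\<bar>)" "- y"] v by simp
qed

lemma continuous_exp_decay_square_integrable:
  fixes a :: "real \<Rightarrow> real"
  assumes "continuous_on UNIV a" "\<And>x. \<bar>a x\<bar> \<le> A * exp (- w * \<bar>x\<bar>)" "w > 0"
  shows "integrable lborel (\<lambda>x. (a x)\<^sup>2)"
proof (rule Bochner_Integration.integrable_bound[where f = "\<lambda>x. A\<^sup>2 * exp (- (2 * w) * \<bar>x - 0\<bar>)"])
  show "integrable lborel (\<lambda>x. A\<^sup>2 * exp (- (2 * w) * \<bar>x - 0\<bar>))"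
    by (intro integrable_mult_right integrable_exp_abs) (use assms in simp)
  show "(\<lambda>x. (a x)\<^sup>2) \<in> borel_measurable lborel"
    using borel_measurable_continuous_onI[OF assms(1)] by simp
  have "(a x)\<^sup>2 \<le> A\<^sup>2 * exp (- (2 * w) * \<bar>x\<bar>)" for x
  proof -
    have "\<bar>a x\<bar>\<^sup>2 \<le> (A * exp (- w * \<bar>x\<bar>))\<^sup>2" using assms(2)[of x] by (intro power_mono) auto
    also have "\<dots> = A\<^sup>2 * exp (- (2 * w) * \<bar>x\<bar>)" by (simp add: power_mult_distrib flip: exp_double)
    finally show ?thesis by simp
  qed
  then show "AE x in lborel. norm ((a x)\<^sup>2) \<le> norm (A\<^sup>2 * exp (- (2 * w) * \<bar>x - 0\<bar>))" by simp
qed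

section \<open>Spinor components\<close>

text \<open>The unitary coordinates \<open>a (1, \<i>) / \<surd>2 - \<i> c (1, -\<i>) / \<surd>2\<close>.  In them the Dirac operator has real
  coefficients, and the zero modes of a wall and of a reversed wall are multiples of \<open>(h, 0)\<close> and \<open>(0, h)\<close>.\<close>

definition spinor :: "complex \<Rightarrow> complex \<Rightarrow> complex ^ 2" where
  "spinor a c = vector [(a - \<i> * c) / of_real (sqrt 2), (\<i> * a - c) / of_real (sqrt 2)]"

definition compA :: "complex ^ 2 \<Rightarrow> complex" where
  "compA f = (f $ 1 - \<i> * f $ 2) / of_real (sqrt 2)"

definition compC :: "complex ^ 2 \<Rightarrow> complex" where
  "compC f = (\<i> * f $ 1 - f $ 2) / of_real (sqrt 2)"

lemma sqrt2_sq: "complex_of_real (sqrt 2) * complex_of_real (sqrt 2) = 2"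
  by (simp flip: of_real_mult)

lemma rotation_aux:
  "(x / complex_of_real (sqrt 2) - \<i> * (y / complex_of_real (sqrt 2))) / complex_of_real (sqrt 2) = (x - \<i> * y) / 2"
  "(\<i> * (x / complex_of_real (sqrt 2)) - y / complex_of_real (sqrt 2)) / complex_of_real (sqrt 2) = (\<i> * x - y) / 2"
  unfolding diff_divide_distrib times_divide_eq_right divide_divide_eq_left sqrt2_sq by (rule refl)+

lemma compA_spinor [simp]: "compA (spinor a c) = a"
  and compC_spinor [simp]: "compC (spinor a c) = c"
  unfolding compA_def compC_def spinor_def vector_2 rotation_aux by (simp_all add: algebra_simps)

lemma spinor_comp [simp]: "spinor (compA f) (compC f) = f"
  unfolding vec_eq_iff forall_2 compA_def compC_def spinor_def vector_2 rotation_aux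
  by (simp add: algebra_simps)

lemma spinor_eq_iff: "f = g \<longleftrightarrow> compA f = compA g \<and> compC f = compC g"
  by (metis spinor_comp)

lemma norm_spinor: "(norm f)\<^sup>2 = (cmod (compA f))\<^sup>2 + (cmod (compC f))\<^sup>2"
proof -
  have "(norm f)\<^sup>2 = (cmod (f $ 1))\<^sup>2 + (cmod (f $ 2))\<^sup>2"
    unfolding norm_vec_def L2_set_def by (simp add: sum_2)
  also have "\<dots> = (cmod (compA f))\<^sup>2 + (cmod (compC f))\<^sup>2"
    by (simp add: compA_def compC_def norm_divide power_divide cmod_power2)
       (simp add: field_simps power2_eq_square)
  finally show ?thesis .
qed

lemma bounded_linear_compA: "bounded_linear compA"
  unfolding compA_def
  by (intro bounded_linear_divide[THEN bounded_linear_compose] bounded_linear_sub bounded_linear_vec_nth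
      bounded_linear_mult_right[THEN bounded_linear_compose])

lemma bounded_linear_compC: "bounded_linear compC"
  unfolding compC_def
  by (intro bounded_linear_divide[THEN bounded_linear_compose] bounded_linear_sub bounded_linear_vec_nth
      bounded_linear_mult_right[THEN bounded_linear_compose])

lemma comp_measurable:
  assumes "f \<in> borel_measurable M"
  shows "(\<lambda>x. compA (f x)) \<in> borel_measurable M" "(\<lambda>x. compC (f x)) \<in> borel_measurable M"
  by (rule borel_measurable_continuous_on[OF linear_continuous_on[OF bounded_linear_compA] assms]
      borel_measurable_continuous_on[OF linear_continuous_on[OF bounded_linear_compC] assms])+

lemma comp_linear [simp]:
  "compA (f + g) = compA f + compA g" "compC (f + g) = compC f + compC g"
  "compA (f - g) = compA f - compA g" "compC (f - g) = compC f - compC g"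
  "compA (z *s f) = z * compA f" "compC (z *s f) = z * compC f"
  by (simp_all add: compA_def compC_def algebra_simps add_divide_distrib diff_divide_distrib)

text \<open>In these coordinates \<open>\<i> \<sigma>\<^sub>3\<close> maps \<open>(a, c)\<close> to \<open>(c, -a)\<close> and \<open>\<sigma>\<^sub>1\<close> maps it to \<open>(-c, -a)\<close>, so that the equation with
  eigenvalue \<open>E\<close> becomes \<open>a' = - m a - E c\<close>, \<open>c' = m c + E a\<close>.\<close>

lemma dirac_components:
  "compA (sigma3 *v f) = - \<i> * compC f" "compC (sigma3 *v f) = \<i> * compA f"
  "compA (sigma1 *v f) = - compC f" "compC (sigma1 *v f) = - compA f"
  by (simp_all add: compA_def compC_def sigma1_def sigma3_def matrix_vector_mult_def sum_2)
    (simp_all add: algebra_simps add_divide_distrib diff_divide_distrib)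

section \<open>Classical solutions and eigenfunctions\<close>

definition dirac_solution :: "(real \<Rightarrow> real) \<Rightarrow> real \<Rightarrow> (real \<Rightarrow> real) \<Rightarrow> (real \<Rightarrow> real) \<Rightarrow> bool" where
  "dirac_solution m E a c \<longleftrightarrow> (\<forall>x. (a has_real_derivative - m x * a x - E * c x) (at x) \<and>
     (c has_real_derivative m x * c x + E * a x) (at x))"

lemma dirac_solutionD:
  assumes "dirac_solution m E a c"
  shows "(a has_real_derivative - m x * a x - E * c x) (at x)"
    "(c has_real_derivative m x * c x + E * a x) (at x)"
    "continuous_on UNIV a" "continuous_on UNIV c"
  using assms unfolding dirac_solution_def
  by (blast, blast, (meson DERIV_isCont continuous_at_imp_continuous_on)+)

abbreviation rspinor :: "(real \<Rightarrow> real) \<Rightarrow> (real \<Rightarrow> real) \<Rightarrow> real \<Rightarrow> complex ^ 2" where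
  "rspinor a c \<equiv> \<lambda>x. spinor (of_real (a x)) (of_real (c x))"

lemma rspinor_scaleR: "rspinor a c x = a x *\<^sub>R spinor 1 0 + c x *\<^sub>R spinor 0 1"
proof -
  have "compA (r *\<^sub>R f) = r *\<^sub>R compA f" "compC (r *\<^sub>R f) = r *\<^sub>R compC f" for r f
    by (simp_all add: bounded_linear_compA bounded_linear_compC linear_simps(5))
  then show ?thesis by (simp add: spinor_eq_iff of_real_def)
qed

lemma continuous_rspinor:
  assumes "continuous_on UNIV a" "continuous_on UNIV c"
  shows "continuous_on UNIV (rspinor a c)"
  unfolding rspinor_scaleR by (intro continuous_intros assms)

lemma norm_rspinor: "(norm (rspinor a c x))\<^sup>2 = (a x)\<^sup>2 + (c x)\<^sup>2"
  by (simp add: norm_spinor)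

lemma rspinor_has_vector_derivative:
  assumes "(a has_real_derivative a') (at x)" "(c has_real_derivative c') (at x)"
  shows "(rspinor a c has_vector_derivative spinor (of_real a') (of_real c')) (at x)"
  unfolding rspinor_scaleR rspinor_scaleR[where a = "\<lambda>_. a'" and c = "\<lambda>_. c'"]
  using has_vector_derivative_add[OF has_vector_derivative_scaleR[OF assms(1) has_vector_derivative_const]
      has_vector_derivative_scaleR[OF assms(2) has_vector_derivative_const]] by simp

lemma rspinor_L2:
  assumes "continuous_on UNIV a" "continuous_on UNIV c"
    and "\<And>x. \<bar>a x\<bar> \<le> A * exp (- w * \<bar>x\<bar>)" "\<And>x. \<bar>c x\<bar> \<le> A * exp (- w * \<bar>x\<bar>)" "w > 0"
  shows "rspinor a c \<in> L2_space"
  using borel_measurable_continuous_onI[OF continuous_rspinor[OF assms(1,2)]]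
    continuous_exp_decay_square_integrable[OF assms(1,3,5)] continuous_exp_decay_square_integrable[OF assms(2,4,5)]
  by (simp add: L2_space_def norm_rspinor)

text \<open>The derivatives are bounded combinations of \<open>a\<close> and \<open>c\<close> and decay as well, so the spinor lies in \<open>H\<^sup>1\<close> with
  its classical derivative as weak derivative.\<close>

lemma eigenfunction_of_solution:
  assumes s: "dirac_solution m E a c" and m: "continuous_on UNIV m" and B: "\<And>x. \<bar>m x\<bar> \<le> B"
    and d: "\<And>x. \<bar>a x\<bar> \<le> A * exp (- w * \<bar>x\<bar>)" "\<And>x. \<bar>c x\<bar> \<le> A * exp (- w * \<bar>x\<bar>)" and w: "w > 0"
    and nz: "\<And>x. (a x)\<^sup>2 + (c x)\<^sup>2 \<noteq> 0"
  shows "eigenfunction m E (rspinor a c)"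
proof -
  note s = dirac_solutionD[OF s]
  define a' c' where "a' x = - m x * a x - E * c x" and "c' x = m x * c x + E * a x" for x
  have cc: "continuous_on UNIV a'" "continuous_on UNIV c'"
    unfolding a'_def c'_def by (intro continuous_intros m s)+
  have b: "\<bar>m x * u + E * v\<bar> \<le> (B + \<bar>E\<bar>) * A * exp (- w * \<bar>x\<bar>)"
    if "\<bar>u\<bar> \<le> A * exp (- w * \<bar>x\<bar>)" "\<bar>v\<bar> \<le> A * exp (- w * \<bar>x\<bar>)" for u v x
  proof -
    have "\<bar>m x * u + E * v\<bar> \<le> \<bar>m x\<bar> * \<bar>u\<bar> + \<bar>E\<bar> * \<bar>v\<bar>" by (metis abs_mult abs_triangle_ineq)
    also have "\<dots> \<le> B * (A * exp (- w * \<bar>x\<bar>)) + \<bar>E\<bar> * (A * exp (- w * \<bar>x\<bar>))"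
      using B[of x] that by (intro add_mono mult_mono) auto
    finally show ?thesis by (simp add: algebra_simps)
  qed
  have bb: "\<bar>a' x\<bar> \<le> (B + \<bar>E\<bar>) * A * exp (- w * \<bar>x\<bar>)" "\<bar>c' x\<bar> \<le> (B + \<bar>E\<bar>) * A * exp (- w * \<bar>x\<bar>)" for x
    using b[of "- a x" x "- c x"] b[of "c x" x "a x"] d[of x] by (auto simp: a'_def c'_def)
  have f: "rspinor a c \<in> L2_space" by (rule rspinor_L2[OF s(3,4) d w])
  have g: "rspinor a' c' \<in> L2_space" by (rule rspinor_L2[OF cc bb w])
  have wk: "is_weak_deriv (rspinor a c) (rspinor a' c')"
    by (intro classical_is_weak_deriv rspinor_has_vector_derivative continuous_rspinor cc)
      (use s in \<open>auto simp: a'_def c'_def\<close>)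
  have ae: "AE x in lborel. dirac m (rspinor a c) x = of_real E *s rspinor a c x"
    using weak_deriv_AE(2)[OF f g wk]
    by eventually_elim (simp add: dirac_def spinor_eq_iff dirac_components a'_def c'_def)
  have "norm_H (rspinor a c) \<noteq> 0"
  proof
    assume "norm_H (rspinor a c) = 0"
    then have "(\<integral>x. (norm (rspinor a c x))\<^sup>2 \<partial>lborel) = 0" by (metis norm_H_square zero_power2)
    then have "AE x in lborel. (norm (rspinor a c x))\<^sup>2 = 0"
      using f by (subst (asm) integral_nonneg_eq_0_iff_AE) (auto simp: L2_space_def)
    then have "AE x in lborel::real measure. False"
      by eventually_elim (use nz in \<open>simp only: norm_rspinor\<close>)
    then have "emeasure lborel (UNIV :: real set) = 0"
      by (subst (asm) AE_iff_measurable[of UNIV]) auto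
    then show False by simp
  qed
  then show ?thesis
    using weak_deriv_AE(1)[OF f g wk] ae by (simp add: eigenfunction_def)
qed

lemma eigenfunction_weak_system:
  assumes e: "eigenfunction m E f" and m: "continuous_on UNIV m" and t: "test_function \<phi>"
  shows "(\<integral>x. deriv \<phi> x *\<^sub>R compA (f x) \<partial>lborel) = (\<integral>x. \<phi> x *\<^sub>R (m x *\<^sub>R compA (f x) + E *\<^sub>R compC (f x)) \<partial>lborel)"
    "(\<integral>x. deriv \<phi> x *\<^sub>R compC (f x) \<partial>lborel) = - (\<integral>x. \<phi> x *\<^sub>R (m x *\<^sub>R compC (f x) + E *\<^sub>R compA (f x)) \<partial>lborel)"
proof -
  have fH: "f \<in> H1_space" and ae: "AE x in lborel. dirac m f x = of_real E *s f x"
    using e by (auto simp: eigenfunction_def)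
  then have f: "f \<in> L2_space" by (simp add: H1_space_def)
  define g where "g = weak_deriv f"
  have g: "g \<in> L2_space" "is_weak_deriv f g"
    using fH someI_ex[of "\<lambda>g. g \<in> L2_space \<and> is_weak_deriv f g"] by (auto simp: H1_space_def weak_deriv_def g_def)
  have aeA: "AE x in lborel. compA (g x) = - (m x *\<^sub>R compA (f x) + E *\<^sub>R compC (f x))"
    and aeC: "AE x in lborel. compC (g x) = m x *\<^sub>R compC (f x) + E *\<^sub>R compA (f x)"
  proof -
    have *: "compA v = - (of_real (m x) * compA (f x) + of_real E * compC (f x)) \<and> compC v = of_real (m x) * compC (f x) + of_real E * compA (f x)"
      if "\<i> *s (sigma3 *v v) + of_real (m x) *s (sigma1 *v f x) = of_real E *s f x" for v x
    proof -
      have "compC v - of_real (m x) * compC (f x) = of_real E * compA (f x)"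
        using arg_cong[OF that, of compA] by (simp add: dirac_components)
      moreover have "- compA v - of_real (m x) * compA (f x) = of_real E * compC (f x)"
        using arg_cong[OF that, of compC] by (simp add: dirac_components)
      then have "- compA v = of_real (m x) * compA (f x) + of_real E * compC (f x)"
        by (simp add: algebra_simps)
      then have "compA v = - (of_real (m x) * compA (f x) + of_real E * compC (f x))"
        by (metis minus_minus)
      ultimately show ?thesis by (simp add: algebra_simps)
    qed
    show "AE x in lborel. compA (g x) = - (m x *\<^sub>R compA (f x) + E *\<^sub>R compC (f x))"
      using ae by eventually_elim (use * in \<open>simp add: dirac_def g_def scaleR_conv_of_real\<close>)
    show "AE x in lborel. compC (g x) = m x *\<^sub>R compC (f x) + E *\<^sub>R compA (f x)"
      using ae by eventually_elim (use * in \<open>simp add: dirac_def g_def scaleR_conv_of_real\<close>)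
  qed
  obtain R where R: "R > 0" "\<And>x. R \<le> \<bar>x\<bar> \<Longrightarrow> \<phi> x = 0" "\<And>x. R \<le> \<bar>x\<bar> \<Longrightarrow> deriv \<phi> x = 0"
    "\<And>x. (\<phi> has_real_derivative deriv \<phi> x) (at x)" "continuous_on UNIV (deriv \<phi>)" "continuous_on UNIV \<phi>"
    using test_functionE[OF t] by metis
  have i1: "integrable lborel (\<lambda>x. deriv \<phi> x *\<^sub>R f x)"
    by (rule integrable_compact_support_mult[OF R(5,3) L2_set_integrable[OF f] L2_measurable[OF f]]) simp
  have i2: "integrable lborel (\<lambda>x. \<phi> x *\<^sub>R g x)"
    by (rule integrable_compact_support_mult[OF R(6,2) L2_set_integrable[OF g(1)] L2_measurable[OF g(1)]]) simp
  have w: "(\<integral>x. deriv \<phi> x *\<^sub>R f x \<partial>lborel) = - (\<integral>x. \<phi> x *\<^sub>R g x \<partial>lborel)"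
    using g(2) t by (simp add: is_weak_deriv_def)
  have lin: "(\<integral>x. deriv \<phi> x *\<^sub>R L (f x) \<partial>lborel) = - (\<integral>x. \<phi> x *\<^sub>R L (g x) \<partial>lborel)" if L: "bounded_linear L" for L :: "complex ^ 2 \<Rightarrow> complex"
  proof -
    interpret bounded_linear L by fact
    have "(\<integral>x. deriv \<phi> x *\<^sub>R L (f x) \<partial>lborel) = L (\<integral>x. deriv \<phi> x *\<^sub>R f x \<partial>lborel)"
      using integral_bounded_linear[OF L i1] by (simp add: scaleR)
    also have "\<dots> = - L (\<integral>x. \<phi> x *\<^sub>R g x \<partial>lborel)" by (simp add: w linear_neg[OF linear_axioms])
    also have "L (\<integral>x. \<phi> x *\<^sub>R g x \<partial>lborel) = (\<integral>x. \<phi> x *\<^sub>R L (g x) \<partial>lborel)"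
      using integral_bounded_linear[OF L i2] by (simp add: scaleR)
    finally show ?thesis .
  qed
  have mm: "m \<in> borel_measurable borel" "\<phi> \<in> borel_measurable borel"
    using borel_measurable_continuous_onI m R(6) by blast+
  have meas: "(\<lambda>x. compA (h x)) \<in> borel_measurable lborel" "(\<lambda>x. compC (h x)) \<in> borel_measurable lborel" if "h \<in> L2_space" for h
    by (rule comp_measurable[OF L2_measurable[OF that]])+
  have "(\<integral>x. \<phi> x *\<^sub>R compA (g x) \<partial>lborel) = (\<integral>x. \<phi> x *\<^sub>R (- (m x *\<^sub>R compA (f x) + E *\<^sub>R compC (f x))) \<partial>lborel)"
    by (rule integral_cong_AE) (use aeA meas[OF f] meas[OF g(1)] mm in auto)
  with lin[OF bounded_linear_compA]
  show "(\<integral>x. deriv \<phi> x *\<^sub>R compA (f x) \<partial>lborel) = (\<integral>x. \<phi> x *\<^sub>R (m x *\<^sub>R compA (f x) + E *\<^sub>R compC (f x)) \<partial>lborel)"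
    by (simp only: scaleR_minus_right integral_minus minus_minus)
  have "(\<integral>x. \<phi> x *\<^sub>R compC (g x) \<partial>lborel) = (\<integral>x. \<phi> x *\<^sub>R (m x *\<^sub>R compC (f x) + E *\<^sub>R compA (f x)) \<partial>lborel)"
    by (rule integral_cong_AE) (use aeC meas[OF f] meas[OF g(1)] mm in auto)
  with lin[OF bounded_linear_compC]
  show "(\<integral>x. deriv \<phi> x *\<^sub>R compC (f x) \<partial>lborel) = - (\<integral>x. \<phi> x *\<^sub>R (m x *\<^sub>R compC (f x) + E *\<^sub>R compA (f x)) \<partial>lborel)"
    by simp
qed

text \<open>This replaces a regularity theory for weak solutions.  Multiplying a test function by the components
  of a classical solution \<open>u\<close> gives test functions again, and the weak system tested with them says that the
  Wronskian of \<open>f\<close> and \<open>u\<close> has weak derivative zero.\<close>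

lemma eigenfunction_wronskian:
  assumes e: "eigenfunction m E f" and m: "continuous_on UNIV m" and u: "dirac_solution m E u1 u2"
  shows "\<exists>k. AE x in lborel. u2 x *\<^sub>R compA (f x) - u1 x *\<^sub>R compC (f x) = k"
proof -
  have f: "f \<in> L2_space" using e by (simp add: eigenfunction_def H1_space_def)
  define A C where "A x = compA (f x)" and "C x = compC (f x)" for x
  note u = dirac_solutionD[OF u]
  have li: "set_integrable lborel {-R..R} A" "set_integrable lborel {-R..R} C" for R
    using L2_set_integrable[OF f, of "-R" R] bounded_linear_compA bounded_linear_compC
    unfolding set_integrable_def A_def C_def
    by (auto dest: integrable_bounded_linear[OF bounded_linear_compA] integrable_bounded_linear[OF bounded_linear_compC]
        simp: linear_simps(5)[OF bounded_linear_compA] linear_simps(5)[OF bounded_linear_compC])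
  have me: "A \<in> borel_measurable lborel" "C \<in> borel_measurable lborel"
    unfolding A_def C_def by (rule comp_measurable[OF L2_measurable[OF f]])+
  have si: "set_integrable lborel {-R..R} (\<lambda>x. v x *\<^sub>R h x)"
    if v: "continuous_on UNIV v" and h: "\<And>R. set_integrable lborel {-R..R} h" "h \<in> borel_measurable lborel" for v :: "real \<Rightarrow> real" and h :: "real \<Rightarrow> complex" and R
  proof -
    have "bounded (v ` {-R..R})"
      by (intro compact_imp_bounded compact_continuous_image continuous_on_subset[OF v]) auto
    then obtain B where "\<forall>y \<in> v ` {-R..R}. norm y \<le> B"
      unfolding bounded_iff ..
    then have B: "\<And>x. x \<in> {-R..R} \<Longrightarrow> \<bar>v x\<bar> \<le> B" by simp
    have "integrable lborel (\<lambda>x. B *\<^sub>R (indicator {-R..R} x *\<^sub>R h x))"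
      using h(1)[of R] unfolding set_integrable_def by (rule integrable_scaleR_right)
    then show ?thesis
      unfolding set_integrable_def
    proof (rule Bochner_Integration.integrable_bound)
      show "(\<lambda>x. indicat_real {- R..R} x *\<^sub>R v x *\<^sub>R h x) \<in> borel_measurable lborel"
        using borel_measurable_continuous_onI[OF v] h(2) by simp
      have "norm (indicat_real {- R..R} x *\<^sub>R v x *\<^sub>R h x) \<le> norm (B *\<^sub>R indicat_real {- R..R} x *\<^sub>R h x)" for x
        using B[of x] by (cases "x \<in> {-R..R}") (auto intro!: mult_right_mono)
      then show "AE x in lborel. norm (indicat_real {- R..R} x *\<^sub>R v x *\<^sub>R h x) \<le> norm (B *\<^sub>R indicat_real {- R..R} x *\<^sub>R h x)"
        by simp
    qed
  qed
  have "\<exists>k. AE x in lborel. u2 x *\<^sub>R A x - u1 x *\<^sub>R C x = k"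
  proof (rule du_bois_reymond)
    show "set_integrable lborel {- R..R} (\<lambda>x. u2 x *\<^sub>R A x - u1 x *\<^sub>R C x)" for R
      by (intro set_integral_diff si u li me)
    show "(\<lambda>x. u2 x *\<^sub>R A x - u1 x *\<^sub>R C x) \<in> borel_measurable lborel"
      using me borel_measurable_continuous_onI[OF u(3)] borel_measurable_continuous_onI[OF u(4)] by simp
    fix \<phi> assume t: "test_function \<phi>"
    obtain R where R: "R > 0" "\<And>x. R \<le> \<bar>x\<bar> \<Longrightarrow> \<phi> x = 0" "\<And>x. R \<le> \<bar>x\<bar> \<Longrightarrow> deriv \<phi> x = 0"
      "\<And>x. (\<phi> has_real_derivative deriv \<phi> x) (at x)" "continuous_on UNIV (deriv \<phi>)" "continuous_on UNIV \<phi>"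
      using test_functionE[OF t] by metis
    have ii: "integrable lborel (\<lambda>x. v x *\<^sub>R h x)" if "h = A \<or> h = C" "continuous_on UNIV v" "\<And>x. R \<le> \<bar>x\<bar> \<Longrightarrow> v x = 0" for v h
      using integrable_compact_support_mult[OF that(2,3), where h = h] that(1) li me by blast
    define p1 p2 where "p1 x = \<phi> x * u1 x" and "p2 x = \<phi> x * u2 x" for x
    define p1' p2' where "p1' x = deriv \<phi> x * u1 x + (- m x * u1 x - E * u2 x) * \<phi> x"
      and "p2' x = deriv \<phi> x * u2 x + (m x * u2 x + E * u1 x) * \<phi> x" for x
    have c': "continuous_on UNIV p1'" "continuous_on UNIV p2'"
      unfolding p1'_def p2'_def by (intro continuous_intros R u m)+
    have z: "p1 x = 0" "p2 x = 0" if "R < \<bar>x\<bar>" for x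
      using R(2)[of x] that by (auto simp: p1_def p2_def)
    have pd: "(p1 has_real_derivative p1' x) (at x)" "(p2 has_real_derivative p2' x) (at x)" for x
      unfolding p1_def p2_def p1'_def p2'_def by (rule DERIV_mult R u)+
    note t1 = test_functionI[OF pd(1) c'(1) z(1)] and t2 = test_functionI[OF pd(2) c'(2) z(2)]
    have e2: "(\<integral>x. p2' x *\<^sub>R A x \<partial>lborel) = (\<integral>x. p2 x *\<^sub>R (m x *\<^sub>R A x + E *\<^sub>R C x) \<partial>lborel)"
      using eigenfunction_weak_system(1)[OF e m t2(1)] by (simp add: t2(2) A_def C_def)
    have e1: "(\<integral>x. p1' x *\<^sub>R C x \<partial>lborel) = - (\<integral>x. p1 x *\<^sub>R (m x *\<^sub>R C x + E *\<^sub>R A x) \<partial>lborel)"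
      using eigenfunction_weak_system(2)[OF e m t1(1)] by (simp add: t1(2) A_def C_def)
    have z': "p1' x = 0" "p2' x = 0" if "R \<le> \<bar>x\<bar>" for x
      using R(2,3)[of x] that by (auto simp: p1'_def p2'_def)
    have I1: "integrable lborel (\<lambda>x. p2' x *\<^sub>R A x)" "integrable lborel (\<lambda>x. p1' x *\<^sub>R C x)"
      by (intro ii c'; use z' in simp)+
    have cp: "continuous_on UNIV p1" "continuous_on UNIV p2"
      unfolding p1_def p2_def by (intro continuous_intros R u)+
    have I2: "integrable lborel (\<lambda>x. (p2 x * m x) *\<^sub>R A x)" "integrable lborel (\<lambda>x. (p2 x * E) *\<^sub>R C x)"
      "integrable lborel (\<lambda>x. (p1 x * m x) *\<^sub>R C x)" "integrable lborel (\<lambda>x. (p1 x * E) *\<^sub>R A x)"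
      by (intro ii continuous_intros cp m; use R(2) in \<open>simp add: p1_def p2_def\<close>)+
    have I3: "integrable lborel (\<lambda>x. p2 x *\<^sub>R (m x *\<^sub>R A x + E *\<^sub>R C x))" "integrable lborel (\<lambda>x. p1 x *\<^sub>R (m x *\<^sub>R C x + E *\<^sub>R A x))"
      using Bochner_Integration.integrable_add[OF I2(1,2)] Bochner_Integration.integrable_add[OF I2(3,4)]
      by (simp_all add: scaleR_add_right)
    have eq: "deriv \<phi> x *\<^sub>R (u2 x *\<^sub>R A x - u1 x *\<^sub>R C x) = (p2' x *\<^sub>R A x - p1' x *\<^sub>R C x)
      - (p2 x *\<^sub>R (m x *\<^sub>R A x + E *\<^sub>R C x) + p1 x *\<^sub>R (m x *\<^sub>R C x + E *\<^sub>R A x))" for x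
      unfolding p1_def p2_def p1'_def p2'_def scaleR_conv_of_real by (simp add: algebra_simps)
    have "(\<integral>x. deriv \<phi> x *\<^sub>R (u2 x *\<^sub>R A x - u1 x *\<^sub>R C x) \<partial>lborel) =
      ((\<integral>x. p2' x *\<^sub>R A x \<partial>lborel) - (\<integral>x. p1' x *\<^sub>R C x \<partial>lborel))
      - ((\<integral>x. p2 x *\<^sub>R (m x *\<^sub>R A x + E *\<^sub>R C x) \<partial>lborel) + (\<integral>x. p1 x *\<^sub>R (m x *\<^sub>R C x + E *\<^sub>R A x) \<partial>lborel))"
      unfolding eq using I1 I3 by (simp del: scaleR_add_right)
    then show "(\<integral>x. deriv \<phi> x *\<^sub>R (u2 x *\<^sub>R A x - u1 x *\<^sub>R C x) \<partial>lborel) = 0"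
      unfolding e1 e2 by simp
  qed
  then show ?thesis by (simp add: A_def C_def)
qed

text \<open>On the half-line \<open>s x \<ge> 0\<close> where \<open>u\<close> decays, the Wronskian is dominated by \<open>\<bar>f\<bar>\<^sup>2 + \<bar>u\<bar>\<^sup>2\<close>, which is integrable;
  an integrable constant on a half-line is zero.\<close>

lemma eigenfunction_wronskian_zero:
  assumes e: "eigenfunction m E f" and m: "continuous_on UNIV m" and u: "dirac_solution m E u1 u2"
    and d: "\<And>x. s * x \<ge> 0 \<Longrightarrow> \<bar>u1 x\<bar> \<le> A * exp (- w * \<bar>x\<bar>)" "\<And>x. s * x \<ge> 0 \<Longrightarrow> \<bar>u2 x\<bar> \<le> A * exp (- w * \<bar>x\<bar>)"
    and w: "w > 0" and s: "s = 1 \<or> s = -1"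
  shows "AE x in lborel. u2 x *\<^sub>R compA (f x) = u1 x *\<^sub>R compC (f x)"
proof -
  obtain k where k: "AE x in lborel. u2 x *\<^sub>R compA (f x) - u1 x *\<^sub>R compC (f x) = k"
    using eigenfunction_wronskian[OF e m u] by blast
  have f: "f \<in> L2_space" using e by (simp add: eigenfunction_def H1_space_def)
  define H where "H = {x::real. s * x \<ge> 0}"
  have Hm: "H \<in> sets lborel" unfolding H_def by measurable
  have "k = 0"
  proof (rule ccontr)
    assume k0: "k \<noteq> 0"
    have "integrable lborel (\<lambda>x. indicator H x *\<^sub>R cmod k)"
    proof (rule Bochner_Integration.integrable_bound[where f = "\<lambda>x. (norm (f x))\<^sup>2 + A\<^sup>2 * exp (- (2 * w) * \<bar>x - 0\<bar>)"])
      show "integrable lborel (\<lambda>x. (norm (f x))\<^sup>2 + A\<^sup>2 * exp (- (2 * w) * \<bar>x - 0\<bar>))"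
        by (intro Bochner_Integration.integrable_add integrable_mult_right integrable_exp_abs) (use w f in \<open>auto simp: L2_space_def\<close>)
      show "(\<lambda>x. indicat_real H x *\<^sub>R cmod k) \<in> borel_measurable lborel" using Hm by simp
      show "AE x in lborel. norm (indicat_real H x *\<^sub>R cmod k) \<le> norm ((norm (f x))\<^sup>2 + A\<^sup>2 * exp (- (2 * w) * \<bar>x - 0\<bar>))"
        using k
      proof eventually_elim
        case (elim x)
        have nn: "(norm (f x))\<^sup>2 + A\<^sup>2 * exp (- (2 * w) * \<bar>x - 0\<bar>) \<ge> 0" by simp
        show ?case
        proof (cases "x \<in> H")
          case True
          define t where "t = A * exp (- w * \<bar>x\<bar>)"
          have t2: "t\<^sup>2 = A\<^sup>2 * exp (- (2 * w) * \<bar>x - 0\<bar>)"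
            by (simp add: t_def power_mult_distrib flip: exp_double)
          have ut: "\<bar>u1 x\<bar> \<le> t" "\<bar>u2 x\<bar> \<le> t" using d[of x] True by (auto simp: H_def t_def)
          have "cmod k \<le> \<bar>u2 x\<bar> * cmod (compA (f x)) + \<bar>u1 x\<bar> * cmod (compC (f x))"
            unfolding elim[symmetric] by (rule order_trans[OF norm_triangle_ineq4]) simp
          also have "\<dots> \<le> t * cmod (compA (f x)) + t * cmod (compC (f x))"
            by (intro add_mono mult_right_mono ut) auto
          also have "\<dots> \<le> (norm (f x))\<^sup>2 + t\<^sup>2"
            using sum_squares_bound[of t "cmod (compA (f x))"] sum_squares_bound[of t "cmod (compC (f x))"]
              sum_squares_bound[of "cmod (compA (f x))" t]
              zero_le_power2[of "cmod (compA (f x))"] zero_le_power2[of "cmod (compC (f x))"]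
            unfolding norm_spinor by linarith
          finally show ?thesis using True nn by (simp add: t2)
        next
          case False
          then show ?thesis using nn by simp
        qed
      qed
    qed
    then have "integrable lborel (\<lambda>x. indicator H x *\<^sub>R cmod k * (1 / cmod k))"
      by (rule integrable_mult_left)
    then have "integrable lborel (indicator H :: real \<Rightarrow> real)" using k0 by simp
    then have fin: "emeasure lborel H < \<infinity>"
      using Hm by (subst (asm) integrable_indicator_iff) auto
    have big: "ennreal n \<le> emeasure lborel H" if "n \<ge> 0" for n
    proof -
      have "emeasure lborel (if s = 1 then {0..n} else {-n..0}) \<le> emeasure lborel H"
        by (rule emeasure_mono) (use s Hm in \<open>auto simp: H_def split: if_splits\<close>)
      then show ?thesis using that by (auto split: if_splits)
    qed
    obtain r where "0 \<le> r" "emeasure lborel H = ennreal r"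
      using fin by (cases "emeasure lborel H") auto
    then show False using big[of "r + 1"] by simp
  qed
  from k show ?thesis by eventually_elim (simp add: \<open>k = 0\<close>)
qed

section \<open>Comparison of angles\<close>

text \<open>The lower energy has the larger angle to the left: its integrating factor times the difference of the
  angles is monotone, and the integrating factor is positive.\<close>

lemma prufer_backward:
  fixes m :: "real \<Rightarrow> real"
  assumes m: "continuous_on UNIV m" and B: "\<And>x. \<bar>m x\<bar> \<le> B"
    and c: "continuous_on UNIV \<theta>1" "continuous_on UNIV \<theta>2"
    and lu: "l \<le> u" and p: "\<And>x. l \<le> x \<Longrightarrow> x \<le> u \<Longrightarrow> prufer_at m E1 \<theta>1 x"
    "\<And>x. l \<le> x \<Longrightarrow> x \<le> u \<Longrightarrow> prufer_at m E2 \<theta>2 x" and E: "E1 \<le> E2"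
  shows "\<theta>2 u \<le> \<theta>1 u \<Longrightarrow> \<theta>2 l \<le> \<theta>1 l"
    "\<theta>2 u < \<theta>1 u \<Longrightarrow> \<theta>2 l < \<theta>1 l"
    "\<theta>2 u \<le> \<theta>1 u \<Longrightarrow> E1 < E2 \<Longrightarrow> l < u \<Longrightarrow> \<theta>2 l < \<theta>1 l"
proof -
  obtain \<mu> where \<mu>: "\<And>x. \<mu> x > (0::real)"
    "\<And>x. prufer_at m E1 \<theta>1 x \<Longrightarrow> prufer_at m E2 \<theta>2 x \<Longrightarrow>
       ((\<lambda>x. \<mu> x * (\<theta>1 x - \<theta>2 x)) has_real_derivative \<mu> x * (E1 - E2)) (at x)"
    using prufer_difference[OF m B c] by metis
  define D where "D x = - (\<mu> x * (\<theta>1 x - \<theta>2 x))" for x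
  have Dd: "(D has_real_derivative \<mu> x * (E2 - E1)) (at x)" if "l \<le> x" "x \<le> u" for x
    unfolding D_def using DERIV_minus[OF \<mu>(2)[OF p(1)[OF that] p(2)[OF that]]] by (simp add: algebra_simps)
  have nn: "0 \<le> \<mu> x * (E2 - E1)" for x
    using \<mu>(1)[of x] E by (intro mult_nonneg_nonneg) auto
  have le: "D l \<le> D u"
    using DERIV_nonneg_imp_nondecreasing[OF lu, of D] Dd nn by blast
  have less: "D l < D u" if "E1 < E2" "l < u"
  proof -
    have "0 < \<mu> x * (E2 - E1)" for x
      using \<mu>(1)[of x] that(1) by (intro mult_pos_pos) auto
    then show ?thesis using DERIV_pos_imp_increasing[OF that(2), of D] Dd by blast
  qed
  have s1: "D x \<le> 0 \<longleftrightarrow> \<theta>2 x \<le> \<theta>1 x" "D x < 0 \<longleftrightarrow> \<theta>2 x < \<theta>1 x" for x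
    using \<mu>(1)[of x] by (auto simp: D_def zero_le_mult_iff zero_less_mult_iff)
  show "\<theta>2 u \<le> \<theta>1 u \<Longrightarrow> \<theta>2 l \<le> \<theta>1 l"
    "\<theta>2 u < \<theta>1 u \<Longrightarrow> \<theta>2 l < \<theta>1 l"
    "\<theta>2 u \<le> \<theta>1 u \<Longrightarrow> E1 < E2 \<Longrightarrow> l < u \<Longrightarrow> \<theta>2 l < \<theta>1 l"
    unfolding s1[symmetric] using le less by linarith+
qed

lemma prufer_unique:
  fixes m :: "real \<Rightarrow> real"
  assumes m: "continuous_on UNIV m" and B: "\<And>x. \<bar>m x\<bar> \<le> B"
    and c: "continuous_on UNIV \<theta>1" "continuous_on UNIV \<theta>2"
    and p: "\<And>x. l \<le> x \<Longrightarrow> x \<le> u \<Longrightarrow> prufer_at m E \<theta>1 x"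
    "\<And>x. l \<le> x \<Longrightarrow> x \<le> u \<Longrightarrow> prufer_at m E \<theta>2 x"
    and x0: "l \<le> x0" "x0 \<le> u" "\<theta>1 x0 = \<theta>2 x0" and x: "l \<le> x" "x \<le> u"
  shows "\<theta>1 x = \<theta>2 x"
proof (cases "x \<le> x0")
  case True
  have "\<theta>2 x \<le> \<theta>1 x"
    by (rule prufer_backward(1)[OF m B c True, where ?E1.0 = E and ?E2.0 = E]) (use p x0 x in auto)
  moreover have "\<theta>1 x \<le> \<theta>2 x"
    by (rule prufer_backward(1)[OF m B c(2,1) True, where ?E1.0 = E and ?E2.0 = E]) (use p x0 x in auto)
  ultimately show ?thesis by simp
next
  case False
  then have le: "x0 \<le> x" by simp
  have "\<not> \<theta>2 x < \<theta>1 x"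
  proof
    assume "\<theta>2 x < \<theta>1 x"
    then have "\<theta>2 x0 < \<theta>1 x0"
      by (intro prufer_backward(2)[OF m B c le, where ?E1.0 = E and ?E2.0 = E]) (use p x0 x in auto)
    then show False using x0 by simp
  qed
  moreover have "\<not> \<theta>1 x < \<theta>2 x"
  proof
    assume "\<theta>1 x < \<theta>2 x"
    then have "\<theta>1 x0 < \<theta>2 x0"
      by (intro prufer_backward(2)[OF m B c(2,1) le, where ?E1.0 = E and ?E2.0 = E]) (use p x0 x in auto)
    then show False using x0 by simp
  qed
  ultimately show ?thesis by simp
qed

lemma prufer_continuous:
  assumes "\<And>x. prufer_at m E \<theta> x"
  shows "continuous_on UNIV \<theta>"
  using assms unfolding prufer_at_def by (meson DERIV_isCont continuous_at_imp_continuous_on)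

lemma sin_add_multiple: "sin (2 * t) = 0 \<Longrightarrow> sin (x + 4 * t) = sin (x::real)"
  and cos_add_multiple: "sin (2 * t) = 0 \<Longrightarrow> cos (x + 4 * t) = cos (x::real)"
proof -
  assume z: "sin (2 * t) = 0"
  have 4: "sin (4 * t) = 0" "cos (4 * t) = 1"
    using z sin_double[of "2 * t"] cos_double_sin[of "2 * t"] by auto
  show "sin (x + 4 * t) = sin x" "cos (x + 4 * t) = cos x"
    by (simp_all add: sin_add cos_add 4)
qed

section \<open>From angles to solutions\<close>

text \<open>The radius is determined by the angle through \<open>r' = - m r cos 2\<theta>\<close>, normalized to \<open>1\<close> at the origin.\<close>

definition prufer_radius :: "(real \<Rightarrow> real) \<Rightarrow> (real \<Rightarrow> real) \<Rightarrow> real \<Rightarrow> real" where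
  "prufer_radius m \<theta> x = exp (- mass_integral (\<lambda>x. m x * cos (2 * \<theta> x)) x)"

lemma prufer_radius_pos: "prufer_radius m \<theta> x > 0"
  by (simp add: prufer_radius_def)

lemma prufer_radius_0 [simp]: "prufer_radius m \<theta> 0 = 1"
  by (simp add: prufer_radius_def)

lemma prufer_radius_deriv:
  assumes "continuous_on UNIV m" "continuous_on UNIV \<theta>"
  shows "(prufer_radius m \<theta> has_real_derivative - (m x * cos (2 * \<theta> x)) * prufer_radius m \<theta> x) (at x)"
proof -
  have "continuous_on UNIV (\<lambda>x. m x * cos (2 * \<theta> x))" by (intro continuous_intros assms)
  from mass_integral_deriv[OF this, of x] show ?thesis
    unfolding prufer_radius_def by (auto intro!: derivative_eq_intros)
qed

lemma prufer_solution:
  assumes m: "continuous_on UNIV m" and p: "\<And>x. prufer_at m E \<theta> x"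
  shows "dirac_solution m E (\<lambda>x. prufer_radius m \<theta> x * cos (\<theta> x)) (\<lambda>x. prufer_radius m \<theta> x * sin (\<theta> x))"
  unfolding dirac_solution_def
proof (intro allI conjI)
  fix x
  let ?r = "prufer_radius m \<theta> x" and ?t = "\<theta> x"
  note rd = prufer_radius_deriv[OF m prufer_continuous[OF p], of x]
  note td = p[of x, unfolded prufer_at_def]
  have 1: "cos (2 * ?t) * cos ?t + sin (2 * ?t) * sin ?t = cos ?t"
    using cos_diff[of "2 * ?t" ?t] by simp
  have 2: "sin (2 * ?t) * cos ?t - cos (2 * ?t) * sin ?t = sin ?t"
    using sin_diff[of "2 * ?t" ?t] by simp
  have "((\<lambda>x. prufer_radius m \<theta> x * cos (\<theta> x)) has_real_derivative
    - (m x * cos (2 * ?t)) * ?r * cos ?t + ?r * (- sin ?t * (E + m x * sin (2 * ?t)))) (at x)"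
    by (auto intro!: derivative_eq_intros rd td)
  also have "- (m x * cos (2 * ?t)) * ?r * cos ?t + ?r * (- sin ?t * (E + m x * sin (2 * ?t)))
    = - m x * ?r * (cos (2 * ?t) * cos ?t + sin (2 * ?t) * sin ?t) - E * (?r * sin ?t)"
    by (simp add: algebra_simps)
  finally show "((\<lambda>x. prufer_radius m \<theta> x * cos (\<theta> x)) has_real_derivative - m x * (?r * cos ?t) - E * (?r * sin ?t)) (at x)"
    unfolding 1 by (simp add: algebra_simps)
  have "((\<lambda>x. prufer_radius m \<theta> x * sin (\<theta> x)) has_real_derivative
    - (m x * cos (2 * ?t)) * ?r * sin ?t + ?r * (cos ?t * (E + m x * sin (2 * ?t)))) (at x)"
    by (auto intro!: derivative_eq_intros rd td)
  also have "- (m x * cos (2 * ?t)) * ?r * sin ?t + ?r * (cos ?t * (E + m x * sin (2 * ?t)))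
    = m x * ?r * (sin (2 * ?t) * cos ?t - cos (2 * ?t) * sin ?t) + E * (?r * cos ?t)"
    by (simp add: algebra_simps)
  finally show "((\<lambda>x. prufer_radius m \<theta> x * sin (\<theta> x)) has_real_derivative m x * (?r * sin ?t) + E * (?r * cos ?t)) (at x)"
    unfolding 2 by (simp add: algebra_simps)
qed

lemma wronskian_constant:
  assumes "dirac_solution m E u1 u2" "dirac_solution m E v1 v2"
  shows "u1 x * v2 x - u2 x * v1 x = u1 0 * v2 0 - u2 0 * v1 0"
proof -
  note u = dirac_solutionD(1,2)[OF assms(1)] and v = dirac_solutionD(1,2)[OF assms(2)]
  have "((\<lambda>x. u1 x * v2 x - u2 x * v1 x) has_real_derivative 0) (at x)" for x
    using DERIV_diff[OF DERIV_mult[OF u(1) v(2)] DERIV_mult[OF u(2) v(1)], of x] by (simp add: algebra_simps)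
  then show ?thesis using DERIV_isconst_all by blast
qed

text \<open>For an odd mass the reflection \<open>x \<mapsto> -x\<close> with a sign change of \<open>c\<close> preserves the system.\<close>

lemma dirac_solution_reflect:
  assumes "dirac_solution m E a c" "\<And>x. m (- x) = - m x"
  shows "dirac_solution m E (\<lambda>x. a (- x)) (\<lambda>x. - c (- x))"
proof -
  note d = dirac_solutionD(1,2)[OF assms(1)]
  have "((\<lambda>x. a (- x)) has_real_derivative - (- m (- x) * a (- x) - E * c (- x))) (at x)" for x
    using DERIV_mirror[of a _ x] d(1)[of "- x"] by blast
  moreover have "((\<lambda>x. c (- x)) has_real_derivative - (m (- x) * c (- x) + E * a (- x))) (at x)" for x
    using DERIV_mirror[of c _ x] d(2)[of "- x"] by blast
  from DERIV_minus[OF this]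
  have "((\<lambda>x. - c (- x)) has_real_derivative - (- (m (- x) * c (- x) + E * a (- x)))) (at x)" for x .
  ultimately show ?thesis unfolding dirac_solution_def assms(2) by (simp add: algebra_simps)
qed

lemma mass_integral_even:
  assumes "continuous_on UNIV f" "\<And>x. f (- x) = - f x"
  shows "mass_integral f (- x) = mass_integral f x"
proof -
  have "((\<lambda>x. mass_integral f (- x)) has_real_derivative f x) (at x)" for x
    using DERIV_mirror[of "mass_integral f" "f (- x)" x] mass_integral_deriv[OF assms(1), of "- x"] assms(2) by simp
  from mass_integral_unique[OF this assms(1)] show ?thesis by simp
qed

section \<open>The angle of the decaying solution\<close>

text \<open>Where \<open>m = k\<close>, the constant angles \<open>\<theta>\<close> with \<open>k sin 2\<theta> = - E\<close> are equilibria; the one nearest to \<open>0\<close>, which is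
  minus the value defined here, belongs to the decaying exponential.\<close>

definition decay_angle :: "real \<Rightarrow> real \<Rightarrow> real" where
  "decay_angle k E = arcsin (E / k) / 2"

lemma decay_angle:
  assumes "\<bar>E\<bar> < k"
  shows "- (pi / 4) < decay_angle k E" "decay_angle k E < pi / 4"
    "k * sin (2 * decay_angle k E) = E" "cos (2 * decay_angle k E) = sqrt (1 - (E / k)\<^sup>2)"
    "cos (2 * decay_angle k E) > 0"
proof -
  have k: "k > 0" using assms by linarith
  have b: "-1 < E / k" "E / k < 1" using assms k by (auto simp: field_simps abs_less_iff)
  show lt: "- (pi / 4) < decay_angle k E" "decay_angle k E < pi / 4"
    using arcsin_lt_bounded[OF b] by (auto simp: decay_angle_def)
  show "k * sin (2 * decay_angle k E) = E" using b k by (simp add: decay_angle_def)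
  show "cos (2 * decay_angle k E) = sqrt (1 - (E / k)\<^sup>2)" using b by (simp add: decay_angle_def cos_arcsin)
  show "cos (2 * decay_angle k E) > 0" by (rule cos_gt_zero_pi) (use lt in auto)
qed

lemma decay_angle_less:
  assumes "\<bar>E\<bar> < k" "\<bar>E'\<bar> < k" "E < E'"
  shows "decay_angle k E < decay_angle k E'"
proof -
  have k: "k > 0" using assms by linarith
  have "E / k < E' / k" using assms k by (simp add: divide_strict_right_mono)
  moreover have "\<bar>E / k\<bar> \<le> 1" "\<bar>E' / k\<bar> \<le> 1" using assms k by (auto simp: field_simps)
  ultimately show ?thesis by (simp add: decay_angle_def arcsin_less_mono)
qed

lemma decay_angle_0 [simp]: "decay_angle k 0 = 0"
  by (simp add: decay_angle_def)

lemma decay_angle_minus: "\<bar>E\<bar> < k \<Longrightarrow> decay_angle k (- E) = - decay_angle k E"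
  by (simp add: decay_angle_def arcsin_minus abs_le_iff field_simps)

lemma decay_angle_cont: "\<bar>E\<bar> < k \<Longrightarrow> isCont (decay_angle k) E"
proof -
  assume a: "\<bar>E\<bar> < k"
  then have b: "-1 < E / k" "E / k < 1" by (auto simp: field_simps abs_less_iff)
  have "isCont (\<lambda>E. arcsin (E / k)) E"
    by (rule isCont_o2[of E "\<lambda>E. E / k" arcsin]) (use a b in \<open>auto intro!: continuous_intros isCont_arcsin\<close>)
  then show ?thesis unfolding decay_angle_def[abs_def] by (intro continuous_intros) auto
qed

text \<open>The situation common to one and to three walls: an odd mass that is constant and positive to the
  right of \<open>X\<close>.\<close>

locale odd_wall =
  fixes m :: "real \<Rightarrow> real" and k X :: real
  assumes m_cont: "continuous_on UNIV m" and m_odd: "\<And>x. m (- x) = - m x"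
    and m_plateau: "\<And>x. X \<le> x \<Longrightarrow> m x = k" and k_pos: "k > 0" and X_pos: "X > 0"
begin

definition mB :: real where "mB = (SOME B. \<forall>x. \<bar>m x\<bar> \<le> B)"

lemma m_bound: "\<bar>m x\<bar> \<le> mB"
proof -
  have "compact (m ` {-X..X})" by (intro compact_continuous_image continuous_on_subset[OF m_cont]) auto
  then have "bounded (m ` {-X..X})" by (rule compact_imp_bounded)
  then obtain B where "\<forall>y \<in> m ` {-X..X}. norm y \<le> B"
    unfolding bounded_iff ..
  then have B: "\<And>x. x \<in> {-X..X} \<Longrightarrow> \<bar>m x\<bar> \<le> B" by simp
  have "\<bar>m y\<bar> \<le> max B k" for y
  proof -
    consider "y \<in> {-X..X}" | "X \<le> y" | "X \<le> - y" by fastforce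
    then show ?thesis
    proof cases
      case 3
      then have "m y = - k" using m_odd[of "- y"] m_plateau[of "- y"] by simp
      then show ?thesis using k_pos by simp
    qed (use B[of y] m_plateau[of y] k_pos in auto)
  qed
  then have "\<exists>B. \<forall>x. \<bar>m x\<bar> \<le> B" by blast
  from someI_ex[OF this] show ?thesis unfolding mB_def by blast
qed

text \<open>The angle of the solution that decays at \<open>+\<infinity>\<close>.\<close>

definition angle :: "real \<Rightarrow> real \<Rightarrow> real" where
  "angle E = (SOME \<theta>. \<theta> X = - decay_angle k E \<and> (\<forall>x. prufer_at m E \<theta> x))"

lemma angle_X: "angle E X = - decay_angle k E" and angle_prufer: "prufer_at m E (angle E) x"
proof -
  obtain \<theta> where "\<theta> X = - decay_angle k E" "\<And>x. prufer_at m E \<theta> x"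
    using prufer_exists[OF m_cont m_bound] by metis
  then have "\<exists>\<theta>. \<theta> X = - decay_angle k E \<and> (\<forall>x. prufer_at m E \<theta> x)" by blast
  from someI_ex[OF this] show "angle E X = - decay_angle k E" "prufer_at m E (angle E) x"
    unfolding angle_def by blast+
qed

lemma angle_continuous: "continuous_on UNIV (angle E)"
  by (rule prufer_continuous[OF angle_prufer])

lemma angle_eqI:
  assumes "\<And>x. prufer_at m E \<theta> x" "\<theta> y = angle E y"
  shows "\<theta> x = angle E x"
  by (rule prufer_unique[OF m_cont m_bound prufer_continuous[OF assms(1)] angle_continuous assms(1) angle_prufer,
      where l = "min x y" and u = "max x y" and ?x0.0 = y]) (use assms(2) in auto)

lemma angle_plateau:
  assumes E: "\<bar>E\<bar> < k" and x: "X \<le> x"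
  shows "angle E x = - decay_angle k E"
proof (rule prufer_unique[OF m_cont m_bound angle_continuous continuous_on_const angle_prufer, where l = X and u = x and ?x0.0 = X])
  show "prufer_at m E (\<lambda>_. - decay_angle k E) y" if "X \<le> y" for y
    using decay_angle(3)[OF E] m_plateau[OF that] by (simp add: prufer_at_def)
qed (use x angle_X in auto)

definition rad :: "real \<Rightarrow> real \<Rightarrow> real" where "rad E = prufer_radius m (angle E)"
definition solA :: "real \<Rightarrow> real \<Rightarrow> real" where "solA E x = rad E x * cos (angle E x)"
definition solC :: "real \<Rightarrow> real \<Rightarrow> real" where "solC E x = rad E x * sin (angle E x)"

lemma sol: "dirac_solution m E (solA E) (solC E)"
  unfolding solA_def[abs_def] solC_def[abs_def] rad_def by (rule prufer_solution[OF m_cont angle_prufer])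

lemma rad_pos: "rad E x > 0" and rad_0 [simp]: "rad E 0 = 1"
  by (simp_all add: rad_def prufer_radius_pos)

lemma sol_square: "(solA E x)\<^sup>2 + (solC E x)\<^sup>2 = (rad E x)\<^sup>2"
  by (simp add: solA_def solC_def power_mult_distrib flip: distrib_left)

lemma sol_le_rad: "\<bar>solA E x\<bar> \<le> rad E x" "\<bar>solC E x\<bar> \<le> rad E x"
  using rad_pos[of E x] by (auto simp: solA_def solC_def abs_mult intro!: mult_left_le)

definition rate :: "real \<Rightarrow> real" where "rate E = sqrt (k\<^sup>2 - E\<^sup>2)"

lemma rate: assumes "\<bar>E\<bar> < k" shows "rate E > 0" "rate E = k * cos (2 * decay_angle k E)"
proof -
  have "E\<^sup>2 < k\<^sup>2" using assms by (metis abs_ge_zero power2_abs power_strict_mono zero_less_numeral)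
  then show "rate E > 0" by (simp add: rate_def)
  have "rate E = sqrt (k\<^sup>2 * (1 - (E / k)\<^sup>2))" using k_pos by (simp add: rate_def field_simps)
  also have "\<dots> = k * sqrt (1 - (E / k)\<^sup>2)" using k_pos by (simp add: real_sqrt_mult)
  finally show "rate E = k * cos (2 * decay_angle k E)" using decay_angle(4)[OF assms] by simp
qed

lemma rad_plateau:
  assumes E: "\<bar>E\<bar> < k" and x: "X \<le> x"
  shows "rad E x = rad E X * exp (- rate E * (x - X))"
proof -
  define f where "f x = m x * cos (2 * angle E x)" for x
  have fc: "continuous_on UNIV f" unfolding f_def by (intro continuous_intros m_cont angle_continuous)
  have f: "f y = rate E" if "X \<le> y" for y
    using that angle_plateau[OF E that] m_plateau[OF that] rate(2)[OF E] by (simp add: f_def)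
  have d: "((\<lambda>x. rate E * x) has_real_derivative rate E) (at y)" for y
    by (auto intro!: derivative_eq_intros)
  have "mass_integral f x - mass_integral f X \<le> rate E * x - rate E * X"
    by (rule deriv_le_imp_le[OF x mass_integral_deriv[OF fc] d]) (use f in auto)
  moreover have "rate E * x - rate E * X \<le> mass_integral f x - mass_integral f X"
    by (rule deriv_le_imp_le[OF x d mass_integral_deriv[OF fc]]) (use f in auto)
  ultimately have "- mass_integral f x = - mass_integral f X + - rate E * (x - X)"
    by (simp add: algebra_simps)
  then show ?thesis
    unfolding rad_def prufer_radius_def f_def[symmetric] exp_add[symmetric] by (rule arg_cong)
qed

lemma rad_decay:
  assumes E: "\<bar>E\<bar> < k"
  shows "\<exists>A. \<forall>x\<ge>0. rad E x \<le> A * exp (- rate E * \<bar>x\<bar>)"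
proof -
  define g where "g x = rad E x * exp (rate E * x)" for x
  have "continuous_on UNIV (rad E)"
    unfolding rad_def using prufer_radius_deriv[OF m_cont angle_continuous] by (meson DERIV_isCont continuous_at_imp_continuous_on)
  then have gc: "continuous_on UNIV g" unfolding g_def by (intro continuous_intros)
  have "compact (g ` {0..X})" by (intro compact_continuous_image continuous_on_subset[OF gc]) auto
  then have "bounded (g ` {0..X})" by (rule compact_imp_bounded)
  then obtain A where "\<forall>y \<in> g ` {0..X}. norm y \<le> A" unfolding bounded_iff ..
  then have A: "g x \<le> A" if "0 \<le> x" "x \<le> X" for x
    using that imageI[of x "{0..X}" g] abs_le_D1[of "g x" A] by simp
  have "g x \<le> A" if "0 \<le> x" for x
  proof (cases "x \<le> X")
    case False
    then have "g x = rad E X * (exp (- rate E * (x - X)) * exp (rate E * x))"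
      using rad_plateau[OF E, of x] by (simp add: g_def)
    also have "\<dots> = g X" unfolding g_def exp_add[symmetric] by (simp add: algebra_simps)
    finally show ?thesis using A[of X] X_pos by simp
  qed (use A that in auto)
  then have "rad E x \<le> A * exp (- rate E * \<bar>x\<bar>)" if "0 \<le> x" for x
    using that by (simp add: g_def exp_minus field_simps)
  then show ?thesis by blast
qed

text \<open>The shooting function: its values decide whether the solution decaying on the right matches its
  own reflection, which decays on the left.\<close>

definition Theta :: "real \<Rightarrow> real" where "Theta E = angle E 0"

text \<open>If \<open>2\<Theta>\<close> is a multiple of \<open>\<pi>\<close>, then \<open>2\<Theta> - \<theta>(-x)\<close> solves the same equation as \<open>\<theta>\<close> and has the same value at \<open>0\<close>.\<close>

lemma angle_reflect:
  assumes z: "sin (2 * Theta E) = 0"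
  shows "angle E (- x) = 2 * Theta E - angle E x"
proof -
  have "prufer_at m E (\<lambda>x. 2 * Theta E - angle E (- x)) y" for y
  proof -
    have "((\<lambda>x. angle E (- x)) has_real_derivative - (E + m (- y) * sin (2 * angle E (- y)))) (at y)"
      using angle_prufer[of E "- y"] DERIV_mirror[of "angle E" _ y] by (simp add: prufer_at_def)
    then have "((\<lambda>x. 2 * Theta E - angle E (- x)) has_real_derivative 0 - - (E + m (- y) * sin (2 * angle E (- y)))) (at y)"
      by (intro derivative_intros)
    moreover have "sin (2 * (2 * Theta E - angle E (- y))) = - sin (2 * angle E (- y))"
      using sin_add_multiple[OF z, of "- (2 * angle E (- y))"] by (simp add: algebra_simps)
    ultimately show ?thesis by (simp add: prufer_at_def m_odd)
  qed
  from angle_eqI[OF this, of 0 "- x"] show ?thesis by (simp add: Theta_def)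
qed

lemma rad_even:
  assumes z: "sin (2 * Theta E) = 0"
  shows "rad E (- x) = rad E x"
proof -
  have "mass_integral (\<lambda>x. m x * cos (2 * angle E x)) (- x) = mass_integral (\<lambda>x. m x * cos (2 * angle E x)) x"
  proof (rule mass_integral_even)
    show "continuous_on UNIV (\<lambda>x. m x * cos (2 * angle E x))"
      by (intro continuous_intros m_cont angle_continuous)
    show "m (- x) * cos (2 * angle E (- x)) = - (m x * cos (2 * angle E x))" for x
      using cos_add_multiple[OF z, of "- (2 * angle E x)"]
      by (simp add: angle_reflect[OF z] m_odd algebra_simps)
  qed
  then show ?thesis by (simp add: rad_def prufer_radius_def)
qed

lemma sol_decay:
  assumes E: "\<bar>E\<bar> < k" and z: "sin (2 * Theta E) = 0"
  obtains A where "\<And>x. \<bar>solA E x\<bar> \<le> A * exp (- rate E * \<bar>x\<bar>)" "\<And>x. \<bar>solC E x\<bar> \<le> A * exp (- rate E * \<bar>x\<bar>)"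
proof -
  obtain A where A: "\<And>x. x \<ge> 0 \<Longrightarrow> rad E x \<le> A * exp (- rate E * \<bar>x\<bar>)" using rad_decay[OF E] by blast
  have "rad E x \<le> A * exp (- rate E * \<bar>x\<bar>)" for x
    using A[of x] A[of "- x"] rad_even[OF z, of x] by (cases "x \<ge> 0") auto
  then show ?thesis using sol_le_rad[of E] by (meson that order_trans)
qed

lemma sol_eigenfunction:
  assumes E: "\<bar>E\<bar> < k" and z: "sin (2 * Theta E) = 0"
  shows "eigenfunction m E (rspinor (solA E) (solC E))"
proof -
  obtain A where "\<And>x. \<bar>solA E x\<bar> \<le> A * exp (- rate E * \<bar>x\<bar>)" "\<And>x. \<bar>solC E x\<bar> \<le> A * exp (- rate E * \<bar>x\<bar>)"
    using sol_decay[OF E z] by metis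
  from eigenfunction_of_solution[OF sol m_cont m_bound this rate(1)[OF E]] show ?thesis
    using rad_pos[of E] by (simp add: sol_square less_imp_neq[symmetric])
qed

text \<open>The Wronskians of \<open>f\<close> with the solution \<open>u\<close> decaying on the right and with its reflection both vanish.
  If these two solutions were independent, \<open>f\<close> would be zero; their Wronskian is \<open>- sin 2\<Theta>\<close>.  Otherwise
  \<open>f\<close> is pointwise parallel to \<open>u\<close>, and its constant Wronskian with an independent solution shows that the
  factor is constant.\<close>

lemma eigenfunction_classification:
  assumes E: "\<bar>E\<bar> < k" and e: "eigenfunction m E f"
  shows "sin (2 * Theta E) = 0" "\<exists>z. AE x in lborel. f x = z *s rspinor (solA E) (solC E) x"
proof -
  obtain A where A: "\<And>x. x \<ge> 0 \<Longrightarrow> rad E x \<le> A * exp (- rate E * \<bar>x\<bar>)" using rad_decay[OF E] by blast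
  have A1: "\<bar>solA E x\<bar> \<le> A * exp (- rate E * \<bar>x\<bar>)" "\<bar>solC E x\<bar> \<le> A * exp (- rate E * \<bar>x\<bar>)" if "x \<ge> 0" for x
    using A[OF that] sol_le_rad[of E x] by auto
  have w1: "AE x in lborel. solC E x *\<^sub>R compA (f x) = solA E x *\<^sub>R compC (f x)"
    by (rule eigenfunction_wronskian_zero[OF e m_cont sol, of 1 A "rate E"]) (use A1 rate(1)[OF E] in auto)
  show z: "sin (2 * Theta E) = 0"
  proof (rule ccontr)
    assume nz: "sin (2 * Theta E) \<noteq> 0"
    note r = dirac_solution_reflect[OF sol m_odd, of E]
    have w2: "AE x in lborel. - solC E (- x) *\<^sub>R compA (f x) = solA E (- x) *\<^sub>R compC (f x)"
      by (rule eigenfunction_wronskian_zero[OF e m_cont r, of "-1" A "rate E"])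
        (use A1[of "- _"] rate(1)[OF E] in auto)
    have W: "solA E x * (- solC E (- x)) - solC E x * solA E (- x) = - sin (2 * Theta E)" for x
      using wronskian_constant[OF sol r, of x] by (simp add: solA_def solC_def Theta_def sin_double)
    have "AE x in lborel. f x = 0"
      using w1 w2
    proof eventually_elim
      case (elim x)
      define P Q a c a' c' where "P = compA (f x)" and "Q = compC (f x)" and "a = complex_of_real (solA E x)"
        and "c = complex_of_real (solC E x)" and "a' = complex_of_real (solA E (- x))" and "c' = complex_of_real (- solC E (- x))"
      have e: "c * P = a * Q" "c' * P = a' * Q"
        using elim by (simp_all add: P_def Q_def a_def c_def a'_def c'_def scaleR_conv_of_real)
      have D: "a * c' - c * a' \<noteq> 0"
      proof -
        have "a * c' - c * a' = of_real (solA E x * (- solC E (- x)) - solC E x * solA E (- x))"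
          by (simp add: a_def c_def a'_def c'_def)
        also have "\<dots> = of_real (- sin (2 * Theta E))" by (simp only: W)
        finally show ?thesis using nz by simp
      qed
      have "(a * c' - c * a') * P = 0" "(a * c' - c * a') * Q = 0"
        using e by algebra+
      then have "P = 0" "Q = 0" using D by auto
      then show ?case by (simp add: spinor_eq_iff P_def Q_def) (simp add: compA_def compC_def)
    qed
    then have "(\<integral>x. (norm (f x))\<^sup>2 \<partial>lborel) = 0"
      by (intro integral_eq_zero_AE) (auto elim: eventually_mono)
    then have "norm_H f = 0" by (metis norm_H_square power_eq_0_iff)
    then show False using e by (simp add: eigenfunction_def)
  qed
  \<comment> \<open>a solution orthogonal at the origin, so that its Wronskian with the decaying one is \<open>1\<close>\<close>
  obtain \<theta> where \<theta>: "\<theta> 0 = Theta E + pi / 2" "\<And>x. prufer_at m E \<theta> x"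
    using prufer_exists[OF m_cont m_bound] by metis
  define v1 v2 where "v1 x = prufer_radius m \<theta> x * cos (\<theta> x)" and "v2 x = prufer_radius m \<theta> x * sin (\<theta> x)" for x
  have v: "dirac_solution m E v1 v2"
    unfolding v1_def[abs_def] v2_def[abs_def] by (rule prufer_solution[OF m_cont \<theta>(2)])
  have W: "solA E x * v2 x - solC E x * v1 x = 1" for x
  proof -
    have "solA E x * v2 x - solC E x * v1 x = cos (Theta E) * sin (Theta E + pi / 2) - sin (Theta E) * cos (Theta E + pi / 2)"
      using wronskian_constant[OF sol v, of x] by (simp add: solA_def solC_def v1_def v2_def \<theta> Theta_def)
    also have "\<dots> = sin ((Theta E + pi / 2) - Theta E)" by (subst sin_diff) (simp add: algebra_simps)
    finally show ?thesis by simp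
  qed
  obtain z where z: "AE x in lborel. v2 x *\<^sub>R compA (f x) - v1 x *\<^sub>R compC (f x) = z"
    using eigenfunction_wronskian[OF e m_cont v] by blast
  have "AE x in lborel. f x = z *s rspinor (solA E) (solC E) x"
    using w1 z
  proof eventually_elim
    case (elim x)
    define P Q a c b d where "P = compA (f x)" and "Q = compC (f x)" and "a = complex_of_real (solA E x)"
      and "c = complex_of_real (solC E x)" and "b = complex_of_real (v1 x)" and "d = complex_of_real (v2 x)"
    have e: "c * P = a * Q" "d * P - b * Q = z"
      using elim by (simp_all add: P_def Q_def a_def c_def b_def d_def scaleR_conv_of_real)
    have D: "a * d - c * b = 1"
    proof -
      have "a * d - c * b = of_real (solA E x * v2 x - solC E x * v1 x)"
        by (simp add: a_def c_def b_def d_def)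
      then show ?thesis by (simp only: W of_real_1)
    qed
    have "P = z * a" "Q = z * c" using e D by algebra+
    then show ?case by (simp add: spinor_eq_iff P_def Q_def a_def c_def)
  qed
  then show "\<exists>z. AE x in lborel. f x = z *s rspinor (solA E) (solC E) x" by blast
qed

lemma eigenvalue_iff:
  assumes "\<bar>E\<bar> < k"
  shows "eigenvalue m E \<longleftrightarrow> sin (2 * Theta E) = 0"
  unfolding eigenvalue_def using sol_eigenfunction[OF assms] eigenfunction_classification(1)[OF assms] by blast

text \<open>Both effects of a larger energy push in the same direction: the terminal angle \<open>- arcsin (E / k) / 2\<close> is
  smaller, and so is the angle obtained by integrating backwards from a given terminal value.\<close>

lemma Theta_less:
  assumes "\<bar>E\<bar> < k" "\<bar>E'\<bar> < k" "E < E'"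
  shows "Theta E' < Theta E"
  unfolding Theta_def
  by (rule prufer_backward(2)[OF m_cont m_bound angle_continuous angle_continuous, of 0 X])
    (use X_pos angle_prufer assms angle_X decay_angle_less[OF assms] in auto)

lemma angle_minus:
  assumes "\<bar>E\<bar> < k" shows "angle (- E) x = - angle E x"
proof -
  have "prufer_at m (- E) (\<lambda>x. - angle E x) y" for y
    using DERIV_minus[OF angle_prufer[of E y, unfolded prufer_at_def]] by (simp add: prufer_at_def)
  from angle_eqI[OF this, of X x] show ?thesis
    by (simp add: angle_X decay_angle_minus[OF assms])
qed

lemma sol_minus:
  assumes "\<bar>E\<bar> < k" shows "solA (- E) x = solA E x" "solC (- E) x = - solC E x"
  by (simp_all add: solA_def solC_def angle_minus[OF assms] rad_def prufer_radius_def)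

lemma Theta_minus: "\<bar>E\<bar> < k \<Longrightarrow> Theta (- E) = - Theta E"
  by (simp add: Theta_def angle_minus)

lemma Theta_0: "Theta 0 = 0"
  using Theta_minus[of 0] k_pos by simp

lemma Theta_continuous: assumes E: "\<bar>E\<bar> < k" shows "isCont Theta E"
proof -
  have mB0: "mB \<ge> 0" using m_bound[of 0] by linarith
  define L where "L = exp (2 * mB * X)"
  have bound: "\<bar>Theta E' - Theta E\<bar> \<le> L * (\<bar>decay_angle k E' - decay_angle k E\<bar> + L * \<bar>E' - E\<bar> * X)" for E'
  proof -
    obtain \<mu> where \<mu>: "\<And>x. \<mu> x > (0::real)" "\<mu> X = 1" "\<And>x. \<mu> x \<le> exp (2 * mB * \<bar>x - X\<bar>)"
      "\<And>x. exp (- (2 * mB * \<bar>x - X\<bar>)) \<le> \<mu> x"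
      "\<And>x. prufer_at m E' (angle E') x \<Longrightarrow> prufer_at m E (angle E) x \<Longrightarrow>
         ((\<lambda>x. \<mu> x * (angle E' x - angle E x)) has_real_derivative \<mu> x * (E' - E)) (at x)"
      by (rule prufer_difference[OF m_cont m_bound angle_continuous[of E'] angle_continuous[of E],
            where ?x0.0 = X and ?E1.0 = E' and ?E2.0 = E], rule that) assumption+
    define D where "D x = \<mu> x * (angle E' x - angle E x)" for x
    have "norm (D 0 - D X) \<le> L * \<bar>E' - E\<bar> * norm (0 - X)"
    proof (rule field_differentiable_bound[of "{0..X}" D "\<lambda>x. \<mu> x * (E' - E)"])
      show "(D has_field_derivative \<mu> x * (E' - E)) (at x within {0..X})" for x
        unfolding D_def by (rule has_field_derivative_at_within[OF \<mu>(5)[OF angle_prufer angle_prufer]])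
      show "norm (\<mu> x * (E' - E)) \<le> L * \<bar>E' - E\<bar>" if x: "x \<in> {0..X}" for x
      proof -
        have "\<mu> x \<le> L" unfolding L_def
          by (rule order_trans[OF \<mu>(3)]) (use x mB0 in \<open>auto intro!: mult_left_mono\<close>)
        then show ?thesis using \<mu>(1)[of x] by (simp add: abs_mult mult_right_mono)
      qed
    qed (use X_pos in auto)
    then have "\<bar>D 0 - D X\<bar> \<le> L * \<bar>E' - E\<bar> * X" using X_pos by simp
    then have "\<bar>D 0\<bar> \<le> \<bar>D X\<bar> + L * \<bar>E' - E\<bar> * X" by linarith
    moreover have "\<bar>D X\<bar> = \<bar>decay_angle k E' - decay_angle k E\<bar>"
      by (simp add: D_def \<mu>(2) angle_X)
    moreover have "\<bar>Theta E' - Theta E\<bar> \<le> L * \<bar>D 0\<bar>"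
    proof -
      have "1 \<le> L * \<mu> 0"
      proof -
        have "L * exp (- (2 * mB * X)) \<le> L * \<mu> 0"
          using \<mu>(4)[of 0] X_pos by (intro mult_left_mono) (auto simp: L_def)
        then show ?thesis by (simp add: L_def flip: exp_add)
      qed
      then have "1 * \<bar>Theta E' - Theta E\<bar> \<le> L * \<mu> 0 * \<bar>Theta E' - Theta E\<bar>"
        by (rule mult_right_mono) simp
      then show ?thesis using \<mu>(1)[of 0] by (simp add: D_def Theta_def abs_mult mult.assoc)
    qed
    ultimately have "\<bar>D 0\<bar> \<le> \<bar>decay_angle k E' - decay_angle k E\<bar> + L * \<bar>E' - E\<bar> * X" by simp
    then have "L * \<bar>D 0\<bar> \<le> L * (\<bar>decay_angle k E' - decay_angle k E\<bar> + L * \<bar>E' - E\<bar> * X)"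
      by (intro mult_left_mono) (auto simp: L_def)
    with \<open>\<bar>Theta E' - Theta E\<bar> \<le> L * \<bar>D 0\<bar>\<close> show ?thesis by linarith
  qed
  have "(\<lambda>E'. Theta E' - Theta E) \<midarrow>E\<rightarrow> 0"
  proof (rule Lim_null_comparison)
    show "\<forall>\<^sub>F E' in at E. norm (Theta E' - Theta E) \<le> L * (\<bar>decay_angle k E' - decay_angle k E\<bar> + L * \<bar>E' - E\<bar> * X)"
      using bound by simp
    have "isCont (\<lambda>E'. L * (\<bar>decay_angle k E' - decay_angle k E\<bar> + L * \<bar>E' - E\<bar> * X)) E"
      by (intro continuous_intros decay_angle_cont E)
    then show "(\<lambda>E'. L * (\<bar>decay_angle k E' - decay_angle k E\<bar> + L * \<bar>E' - E\<bar> * X)) \<midarrow>E\<rightarrow> 0"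
      by (simp add: isCont_def)
  qed
  then show ?thesis unfolding isCont_def by (simp add: LIM_zero_cancel)
qed

lemma sol_parity:
  assumes t: "Theta E = - (pi / 2)"
  shows "solA E (- x) = - solA E x" "solC E (- x) = solC E x"
proof -
  have z: "sin (2 * Theta E) = 0" by (simp add: t)
  have "angle E (- x) = - (pi + angle E x)" using angle_reflect[OF z, of x] by (simp add: t)
  then show "solA E (- x) = - solA E x" "solC E (- x) = solC E x"
    by (simp_all add: solA_def solC_def rad_even[OF z] del: minus_add_distrib)
qed

end

section \<open>One domain wall\<close>

lemma sum_cnj_spinor:
  "(\<Sum>j\<in>UNIV. cnj (spinor p q $ j) * spinor a c $ j) = cnj p * a + cnj q * c"
proof -
  have "(\<Sum>j\<in>UNIV. cnj (spinor p q $ j) * spinor a c $ j)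
    = (cnj (p - \<i> * q) * (a - \<i> * c) + cnj (\<i> * p - q) * (\<i> * a - c)) / 2"
    by (simp add: spinor_def sum_2 sqrt2_sq flip: add_divide_distrib)
  also have "\<dots> = cnj p * a + cnj q * c" by (simp add: algebra_simps)
  finally show ?thesis .
qed

lemma zero_mode_rspinor: "zero_mode m = rspinor (\<lambda>x. sqrt 2 * gamma_const m * exp (- mass_integral m x)) (\<lambda>_. 0)"
proof
  fix x
  have "sqrt 2 / complex_of_real (sqrt 2) = 1" by simp
  then show "zero_mode m x = rspinor (\<lambda>x. sqrt 2 * gamma_const m * exp (- mass_integral m x)) (\<lambda>_. 0) x"
    unfolding zero_mode_def spinor_def vec_eq_iff forall_2 by (simp add: mult_ac)
qed

lemma integral_odd_function:
  fixes g :: "real \<Rightarrow> complex"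
  assumes "\<And>x. g (- x) = - g x"
  shows "(\<integral>x. g x \<partial>lborel) = 0"
proof -
  have "(\<integral>x. g x \<partial>lborel) = (\<integral>x. g (0 + (-1) * x) \<partial>lborel)"
    using lborel_integral_real_affine[of "-1" g 0] by simp
  also have "\<dots> = - (\<integral>x. g x \<partial>lborel)" by (simp add: assms)
  finally have "2 * (\<integral>x. g x \<partial>lborel) = 0" by simp
  then show ?thesis by simp
qed

lemma norm_dirac_eigenfunction:
  assumes e: "eigenfunction m E f" and m: "continuous_on UNIV m"
  shows "norm_H (dirac m f) = \<bar>E\<bar> * norm_H f"
proof (rule norm_H_eqI)
  have fH: "f \<in> H1_space" and ae: "AE x in lborel. dirac m f x = of_real E *s f x"
    using e by (auto simp: eigenfunction_def)
  then have f: "f \<in> borel_measurable lborel" by (simp add: H1_space_def L2_space_def)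
  have g: "weak_deriv f \<in> borel_measurable lborel"
    using fH someI_ex[of "\<lambda>g. g \<in> L2_space \<and> is_weak_deriv f g"] L2_measurable by (auto simp: H1_space_def weak_deriv_def)
  have mm: "m \<in> borel_measurable borel" using borel_measurable_continuous_onI[OF m] .
  have 1: "(norm (dirac m f x))\<^sup>2 = (cmod (compC (weak_deriv f x) - of_real (m x) * compC (f x)))\<^sup>2
      + (cmod (- compA (weak_deriv f x) - of_real (m x) * compA (f x)))\<^sup>2" for x
    unfolding norm_spinor dirac_def by (simp add: dirac_components)
  have meas: "(\<lambda>x. (norm (dirac m f x))\<^sup>2) \<in> borel_measurable lborel"
    unfolding 1 using comp_measurable[OF f] comp_measurable[OF g] mm by simp
  have meas2: "(\<lambda>x. E\<^sup>2 * (norm (f x))\<^sup>2) \<in> borel_measurable lborel" using f by simp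
  have "(\<integral>x. (norm (dirac m f x))\<^sup>2 \<partial>lborel) = (\<integral>x. E\<^sup>2 * (norm (f x))\<^sup>2 \<partial>lborel)"
  proof (rule integral_cong_AE[OF meas meas2])
    show "AE x in lborel. (norm (dirac m f x))\<^sup>2 = E\<^sup>2 * (norm (f x))\<^sup>2"
      using ae by eventually_elim (simp add: norm_spinor norm_mult power_mult_distrib algebra_simps)
  qed
  then show "(\<integral>x. (norm (dirac m f x))\<^sup>2 \<partial>lborel) = (\<bar>E\<bar> * norm_H f)\<^sup>2"
    by (simp add: power_mult_distrib norm_H_square)
  show "\<bar>E\<bar> * norm_H f \<ge> 0" using norm_H_nonneg by simp
qed

lemma sin_above:
  assumes "0 \<le> a" "a < pi / 2" "a < y" "y < pi - a"
  shows "sin a < sin (y :: real)"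
proof (cases "y \<le> pi / 2")
  case True
  then show ?thesis using assms by (intro sin_monotone_2pi) auto
next
  case False
  have "sin a < sin (pi - y)" using assms False by (intro sin_monotone_2pi) auto
  then show ?thesis by simp
qed

lemma sin_ge_min:
  assumes "0 \<le> a" "a \<le> y" "y \<le> b" "b \<le> pi"
  shows "min (sin a) (sin b) \<le> sin (y :: real)"
proof (cases "y \<le> pi / 2")
  case True
  then have "sin a \<le> sin y" using assms by (intro sin_monotone_2pi_le) auto
  then show ?thesis by simp
next
  case False
  have "sin (pi - b) \<le> sin (pi - y)" using assms False by (intro sin_monotone_2pi_le) auto
  then show ?thesis by simp
qed

locale domain_wall =
  fixes \<kappa> :: "real \<Rightarrow> real" and k :: real
  assumes wall: "one_domain_wall k \<kappa>"
begin

lemma k0: "k > 0" and odd: "\<kappa> (- x) = - \<kappa> x" and left: "x \<le> -1 \<Longrightarrow> \<kappa> x = - k"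
  and right: "1 \<le> x \<Longrightarrow> \<kappa> x = k" and cont: "continuous_on UNIV \<kappa>"
  using wall by (auto simp: one_domain_wall_def intro: C1_differentiable_imp_continuous_on)

sublocale one: odd_wall \<kappa> k 1
  by unfold_locales (use k0 odd right cont in auto)

lemma prufer_reflect:
  assumes "\<And>x. prufer_at \<kappa> E \<theta> x" shows "prufer_at \<kappa> E (\<lambda>x. - \<theta> (- x)) x"
proof -
  have "((\<lambda>x. \<theta> (- x)) has_real_derivative - (E + \<kappa> (- x) * sin (2 * \<theta> (- x)))) (at x)"
    using assms[of "- x", unfolded prufer_at_def] DERIV_mirror[of \<theta> _ x] by blast
  from DERIV_minus[OF this] show ?thesis by (simp add: prufer_at_def odd)
qed

text \<open>By continuity, a violation yields an energy below \<open>k\<close> with angle \<open>- \<pi>/2\<close> at the origin, hence an eigenfunction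
  with \<open>a\<close> odd.  The zero mode has an even first component and vanishing second one, so it is orthogonal
  to this eigenfunction, which contradicts the gap.\<close>

lemma Theta_gt:
  assumes gap: "spectral_gap k \<kappa>" and E: "0 \<le> E" "E < k"
  shows "- (pi / 2) < one.Theta E"
proof (rule ccontr)
  assume "\<not> ?thesis"
  then have le: "one.Theta E \<le> - (pi / 2)" by simp
  have "\<exists>x\<ge>0. x \<le> E \<and> one.Theta x = - (pi / 2)"
    by (rule IVT2) (use le E one.Theta_0 one.Theta_continuous in auto)
  then obtain E0 where E0: "0 \<le> E0" "E0 \<le> E" "one.Theta E0 = - (pi / 2)" by blast
  have aE: "\<bar>E0\<bar> < k" using E0 E by simp
  have z: "sin (2 * one.Theta E0) = 0" by (simp add: E0)
  define f where "f = rspinor (one.solA E0) (one.solC E0)"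
  have e: "eigenfunction \<kappa> E0 f" unfolding f_def by (rule one.sol_eigenfunction[OF aE z])
  have "inner_H (zero_mode \<kappa>) f = 0"
    unfolding inner_H_def
  proof (rule integral_odd_function)
    fix x
    have ev: "mass_integral \<kappa> (- x) = mass_integral \<kappa> x" by (rule mass_integral_even[OF cont odd])
    show "(\<Sum>j\<in>UNIV. cnj (zero_mode \<kappa> (- x) $ j) * f (- x) $ j) = - (\<Sum>j\<in>UNIV. cnj (zero_mode \<kappa> x $ j) * f x $ j)"
      unfolding zero_mode_rspinor f_def sum_cnj_spinor by (simp add: ev one.sol_parity(1)[OF E0(3)])
  qed
  then have "k * norm_H f \<le> norm_H (dirac \<kappa> f)"
    using gap e unfolding spectral_gap_def eigenfunction_def by blast
  also have "\<dots> = E0 * norm_H f" using norm_dirac_eigenfunction[OF e cont] E0 by simp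
  finally have "(k - E0) * norm_H f \<le> 0" by (simp add: algebra_simps)
  moreover have "norm_H f > 0" using e norm_H_nonneg[of f] by (auto simp: eigenfunction_def)
  ultimately show False using aE E0 by (simp add: mult_le_0_iff)
qed

text \<open>The reflected angle \<open>-\<theta>(-x)\<close> solves the same equation.  At the origin it lies between \<open>\<theta>\<close> and \<open>\<theta> + \<pi>\<close>, hence
  also at \<open>1\<close>.  The bounds are the two repelling equilibria of the left plateau that surround
  the attracting one at \<open>- \<pi>/2 - arcsin (K / k) / 2\<close>, where repelling and attracting refer to decreasing \<open>x\<close>.\<close>

lemma angle_minus_1:
  assumes K: "0 < K" "K < k" and t: "- (pi / 2) < one.Theta K"
  shows "one.angle K (- 1) < decay_angle k K" "decay_angle k K - pi < one.angle K (- 1)"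
proof -
  have t0: "one.Theta K < 0" using one.Theta_less[of 0 K] K by (simp add: one.Theta_0)
  let ?\<rho> = "\<lambda>x. - one.angle K (- x)"
  have p: "prufer_at \<kappa> K ?\<rho> x" for x by (rule prufer_reflect[OF one.angle_prufer])
  note c = one.angle_continuous[of K] prufer_continuous[OF p]
  have "\<not> ?\<rho> 1 \<le> one.angle K 1"
  proof
    assume "?\<rho> 1 \<le> one.angle K 1"
    then have "?\<rho> 0 \<le> one.angle K 0"
      by (intro prufer_backward(1)[OF cont one.m_bound c, of 0 1 K K]) (use p one.angle_prufer in auto)
    then show False using t0 by (simp add: one.Theta_def)
  qed
  then show "one.angle K (- 1) < decay_angle k K" by (simp add: one.angle_X)
  have c2: "continuous_on UNIV (\<lambda>x. one.angle K x + pi)" by (intro continuous_intros c)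
  have p2: "prufer_at \<kappa> K (\<lambda>x. one.angle K x + pi) x" for x
    using one.angle_prufer[of K x] sin_periodic[of "2 * one.angle K x"]
    unfolding prufer_at_def by (auto intro!: derivative_eq_intros simp: distrib_left)
  have "\<not> one.angle K 1 + pi \<le> ?\<rho> 1"
  proof
    assume "one.angle K 1 + pi \<le> ?\<rho> 1"
    then have "one.angle K 0 + pi \<le> ?\<rho> 0"
      by (intro prufer_backward(1)[OF cont one.m_bound c(2) c2, of 0 1 K K]) (use p p2 in auto)
    then show False using t by (simp add: one.Theta_def)
  qed
  then show "decay_angle k K - pi < one.angle K (- 1)" by (simp add: one.angle_X)
qed

lemma prufer_const_left: "x \<le> -1 \<Longrightarrow> prufer_at \<kappa> (k * sin (2 * t)) (\<lambda>_. t) x"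
  by (simp add: prufer_at_def left)

text \<open>To the left of \<open>-1\<close>, as long as the angle lies in \<open>[- \<pi>/2, \<phi>1]\<close> with \<open>\<phi>1\<close> below the repelling equilibrium, its
  derivative is at least \<open>\<rho> > 0\<close>; so it falls below \<open>- \<pi>/2\<close> after a bounded distance and then stays there.\<close>

lemma angle_left_upper:
  assumes K: "0 < K" "K < k" and t: "- (pi / 2) < one.Theta K"
  shows "\<exists>T0\<ge>1. \<forall>T\<ge>T0. one.angle K (- T) \<le> - (pi / 2)"
proof -
  define \<psi> where "\<psi> = one.angle K"
  have \<psi>p: "prufer_at \<kappa> K \<psi> x" for x unfolding \<psi>_def by (rule one.angle_prufer)
  have \<psi>c: "continuous_on UNIV \<psi>" unfolding \<psi>_def by (rule one.angle_continuous)
  define \<phi> where "\<phi> = decay_angle k K"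
  have aK: "\<bar>K\<bar> < k" using K by simp
  have \<phi>: "0 < \<phi>" "\<phi> < pi / 4" "k * sin (2 * \<phi>) = K"
    using decay_angle[OF aK] decay_angle_less[of 0 k K] K by (auto simp: \<phi>_def)
  \<comment> \<open>the constant angle \<open>\<phi>1\<close> solves the plateau equation at a lower energy and confines \<open>\<psi>\<close> from above\<close>
  define \<phi>1 where "\<phi>1 = max (\<psi> (-1)) 0"
  have \<phi>1: "0 \<le> \<phi>1" "\<phi>1 < \<phi>" "\<psi> (-1) \<le> \<phi>1"
    using angle_minus_1(1)[OF K t] \<phi> by (auto simp: \<phi>1_def \<psi>_def \<phi>_def)
  have "sin (2 * \<phi>1) < sin (2 * \<phi>)" using \<phi> \<phi>1 by (intro sin_monotone_2pi) auto
  then have lt: "k * sin (2 * \<phi>1) < K" using \<phi>(3) k0 by (metis mult_strict_left_mono)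
  define \<rho> where "\<rho> = K - k * sin (2 * \<phi>1)"
  have \<rho>: "\<rho> > 0" using lt by (simp add: \<rho>_def)
  define T0 where "T0 = 1 + (\<phi>1 + pi / 2) / \<rho>"
  have "T0 \<ge> 1" using \<rho> \<phi>1 by (simp add: T0_def)
  moreover have "\<psi> (- T) \<le> - (pi / 2)" if T: "T0 \<le> T" for T
  proof (rule ccontr)
    assume n: "\<not> \<psi> (- T) \<le> - (pi / 2)"
    have T1: "1 \<le> T" using T \<open>T0 \<ge> 1\<close> by simp
    have lo: "- (pi / 2) < \<psi> x" if x: "- T \<le> x" "x \<le> -1" for x
    proof (rule ccontr)
      assume "\<not> - (pi / 2) < \<psi> x"
      then have "\<psi> (- T) \<le> - (pi / 2)"
        by (intro prufer_backward(1)[OF cont one.m_bound continuous_on_const \<psi>c x(1), of "k * sin (2 * (- (pi / 2)))" "- (pi / 2)" K])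
          (use x \<psi>p K prufer_const_left[of _ "- (pi / 2)"] in auto)
      then show False using n by simp
    qed
    have hi: "\<psi> x \<le> \<phi>1" if x: "- T \<le> x" "x \<le> -1" for x
      by (rule prufer_backward(1)[OF cont one.m_bound continuous_on_const \<psi>c x(2), of "k * sin (2 * \<phi>1)" \<phi>1 K])
        (use x \<psi>p lt \<phi>1 prufer_const_left[of _ \<phi>1] in auto)
    have "\<rho> * (-1) - \<rho> * (- T) \<le> \<psi> (-1) - \<psi> (- T)"
    proof (rule deriv_le_imp_le)
      show "- T \<le> -1" using T1 by simp
      show "((*) \<rho> has_real_derivative \<rho>) (at x)" for x by (auto intro!: derivative_eq_intros)
      show "(\<psi> has_real_derivative K + \<kappa> x * sin (2 * \<psi> x)) (at x)" for x
        using \<psi>p[of x] by (simp add: prufer_at_def)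
      fix x assume x: "- T \<le> x" "x \<le> -1"
      have "sin (2 * \<psi> x) \<le> sin (2 * \<phi>1)"
      proof (cases "\<psi> x \<le> 0")
        case True
        have "0 \<le> sin (2 * \<phi>1)" using \<phi> \<phi>1 by (intro sin_ge_zero) auto
        moreover have "0 \<le> sin (- (2 * \<psi> x))" using lo[OF x] True by (intro sin_ge_zero) auto
        ultimately show ?thesis by simp
      next
        case False
        then show ?thesis using hi[OF x] \<phi> \<phi>1 by (intro sin_monotone_2pi_le) auto
      qed
      then have "k * sin (2 * \<psi> x) \<le> k * sin (2 * \<phi>1)" using k0 by (intro mult_left_mono) auto
      then show "\<rho> \<le> K + \<kappa> x * sin (2 * \<psi> x)" using x by (simp add: \<rho>_def left)
    qed
    then have "\<rho> * (T - 1) < \<phi>1 + pi / 2" using n \<phi>1 by (simp add: algebra_simps)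
    then have "T - 1 < (\<phi>1 + pi / 2) / \<rho>" using \<rho> by (simp add: field_simps)
    then show False using T by (simp add: T0_def)
  qed
  ultimately show ?thesis unfolding \<psi>_def by blast
qed

text \<open>The same argument from the other side: between the barrier \<open>- \<pi>/2 - \<phi>'\<close> and a confining angle above the
  lower repelling equilibrium the derivative is at most \<open>- \<rho> < 0\<close>.\<close>

lemma angle_left_lower:
  assumes K: "0 < K" "K < k" and t: "- (pi / 2) < one.Theta K" and \<phi>': "decay_angle k K < \<phi>'" "\<phi>' < pi / 4"
  shows "\<exists>T0\<ge>1. \<forall>T\<ge>T0. - (pi / 2) - \<phi>' < one.angle K (- T)"
proof -
  define \<psi> where "\<psi> = one.angle K"
  have \<psi>p: "prufer_at \<kappa> K \<psi> x" for x unfolding \<psi>_def by (rule one.angle_prufer)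
  have \<psi>c: "continuous_on UNIV \<psi>" unfolding \<psi>_def by (rule one.angle_continuous)
  define \<phi> where "\<phi> = decay_angle k K"
  have aK: "\<bar>K\<bar> < k" using K by simp
  have \<phi>: "0 < \<phi>" "\<phi> < pi / 4" "k * sin (2 * \<phi>) = K"
    using decay_angle[OF aK] decay_angle_less[of 0 k K] K by (auto simp: \<phi>_def)
  define b where "b = - (pi / 2) - \<phi>'"
  \<comment> \<open>the constant angle \<open>- \<pi>/2 - ch\<close> solves the plateau equation at a higher energy and confines \<open>\<psi>\<close> from below\<close>
  define ch where "ch = max \<phi>' (- (pi / 2) - \<psi> (-1))"
  have ch: "\<phi>' \<le> ch" "ch < pi / 2 - \<phi>" "- (pi / 2) - ch \<le> \<psi> (-1)"
    using angle_minus_1(2)[OF K t] \<phi> \<phi>' by (auto simp: ch_def \<psi>_def \<phi>_def)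
  have f: "\<phi> < \<phi>'" using \<phi>' by (simp add: \<phi>_def)
  have "sin (2 * \<phi>) < sin (2 * \<phi>')" "sin (2 * \<phi>) < sin (2 * ch)"
    using \<phi> \<phi>' f ch by (auto intro!: sin_above)
  then have lt: "K < k * sin (2 * \<phi>')" "K < k * sin (2 * ch)"
    using k0 unfolding \<phi>(3)[symmetric] by auto
  have sb: "sin (2 * (- (pi / 2) - y)) = sin (2 * y)" for y
  proof -
    have "2 * (- (pi / 2) - y) = - (2 * y + pi)" by (simp add: algebra_simps)
    then show ?thesis by (simp only: sin_minus sin_periodic_pi minus_minus)
  qed
  define \<rho> where "\<rho> = min (k * sin (2 * \<phi>')) (k * sin (2 * ch)) - K"
  have \<rho>: "\<rho> > 0" using lt by (simp add: \<rho>_def)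
  define T0 where "T0 = 1 + (ch - \<phi>' + 1) / \<rho>"
  have "T0 \<ge> 1" using \<rho> ch by (simp add: T0_def)
  moreover have "b < \<psi> (- T)" if T: "T0 \<le> T" for T
  proof (rule ccontr)
    assume n: "\<not> b < \<psi> (- T)"
    have T1: "1 \<le> T" using T \<open>T0 \<ge> 1\<close> by simp
    have hi: "\<psi> x \<le> b" if x: "- T \<le> x" "x \<le> -1" for x
    proof (rule ccontr)
      assume "\<not> \<psi> x \<le> b"
      then have "b < \<psi> (- T)"
        by (intro prufer_backward(2)[OF cont one.m_bound \<psi>c continuous_on_const x(1), of K "k * sin (2 * b)" b])
          (use x \<psi>p lt prufer_const_left[of _ b] sb[of \<phi>'] in \<open>auto simp: b_def\<close>)
      then show False using n by simp
    qed
    have lo: "- (pi / 2) - ch \<le> \<psi> x" if x: "- T \<le> x" "x \<le> -1" for x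
      by (rule prufer_backward(1)[OF cont one.m_bound \<psi>c continuous_on_const x(2), of K "k * sin (2 * (- (pi / 2) - ch))"])
        (use x \<psi>p lt ch prufer_const_left[of _ "- (pi / 2) - ch"] sb[of ch] in auto)
    have "\<psi> (-1) - \<psi> (- T) \<le> (- \<rho>) * (-1) - (- \<rho>) * (- T)"
    proof (rule deriv_le_imp_le)
      show "- T \<le> -1" using T1 by simp
      show "((*) (- \<rho>) has_real_derivative (- \<rho>)) (at x)" for x by (auto intro!: derivative_eq_intros)
      show "(\<psi> has_real_derivative K + \<kappa> x * sin (2 * \<psi> x)) (at x)" for x
        using \<psi>p[of x] by (simp add: prufer_at_def)
      fix x assume x: "- T \<le> x" "x \<le> -1"
      have "min (sin (2 * \<phi>')) (sin (2 * ch)) \<le> sin (2 * (- (pi / 2) - \<psi> x))"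
        by (rule sin_ge_min) (use lo[OF x] hi[OF x] \<phi> f ch in \<open>auto simp: b_def\<close>)
      then have "min (sin (2 * \<phi>')) (sin (2 * ch)) \<le> sin (2 * \<psi> x)" by (simp only: sb)
      then have "k * min (sin (2 * \<phi>')) (sin (2 * ch)) \<le> k * sin (2 * \<psi> x)" using k0 by (intro mult_left_mono) auto
      then have "min (k * sin (2 * \<phi>')) (k * sin (2 * ch)) \<le> k * sin (2 * \<psi> x)"
        using k0 by (simp add: min_def split: if_splits)
      then show "K + \<kappa> x * sin (2 * \<psi> x) \<le> - \<rho>" using x by (simp add: \<rho>_def left)
    qed
    then have "\<rho> * (T - 1) \<le> ch - \<phi>'" using n ch by (simp add: b_def algebra_simps)
    then have "T - 1 \<le> (ch - \<phi>') / \<rho>" using \<rho> by (simp add: field_simps)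
    moreover have "(ch - \<phi>') / \<rho> < (ch - \<phi>' + 1) / \<rho>" using \<rho> by (simp add: divide_strict_right_mono)
    ultimately show False using T by (simp add: T0_def)
  qed
  ultimately show ?thesis unfolding \<psi>_def b_def by blast
qed

section \<open>Three domain walls: counting eigenvalues\<close>

abbreviation \<kappa>3 :: "real \<Rightarrow> real \<Rightarrow> real" where "\<kappa>3 \<equiv> three_domain_wall \<kappa>"

text \<open>A single expression for the three pieces, from which continuity and oddness can be read off: at
  every point two of the three shifted walls are on plateaus of opposite contribution.\<close>

lemma three_formula:
  assumes "\<delta> > 1"
  shows "\<kappa>3 \<delta> x = \<kappa> (x + 2 * \<delta>) - \<kappa> x + \<kappa> (x - 2 * \<delta>)"
proof -
  consider "x \<le> - \<delta>" | "- \<delta> < x" "x \<le> \<delta>" | "\<delta> < x" by linarith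
  then show ?thesis
    by cases (use assms in \<open>auto simp: three_domain_wall_def left right\<close>)
qed

lemma three_odd_wall:
  assumes "\<delta> > 1"
  shows "odd_wall (\<kappa>3 \<delta>) k (2 * \<delta> + 1)"
proof
  have f: "\<kappa>3 \<delta> = (\<lambda>x. \<kappa> (x + 2 * \<delta>) - \<kappa> x + \<kappa> (x - 2 * \<delta>))" using three_formula[OF assms] by blast
  show "continuous_on UNIV (\<kappa>3 \<delta>)"
    unfolding f by (intro continuous_intros cont continuous_on_compose2[OF cont]) auto
  show "\<kappa>3 \<delta> (- x) = - \<kappa>3 \<delta> x" for x
    unfolding f using odd[of x] odd[of "x - 2 * \<delta>"] odd[of "x + 2 * \<delta>"] by (simp add: algebra_simps)
  show "\<kappa>3 \<delta> x = k" if "2 * \<delta> + 1 \<le> x" for x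
    unfolding f using that assms by (simp add: right)
qed (use k0 assms in auto)

lemma three_right: "\<delta> > 1 \<Longrightarrow> 1 \<le> x \<Longrightarrow> \<kappa>3 \<delta> x = \<kappa> (x - 2 * \<delta>)"
  by (simp add: three_formula right)

lemma three_middle: "\<delta> > 1 \<Longrightarrow> 0 \<le> x \<Longrightarrow> x \<le> 2 * \<delta> - 1 \<Longrightarrow> \<kappa>3 \<delta> x = - \<kappa> x"
  by (simp add: three_formula right left)

text \<open>On \<open>[1, 2\<delta> + 1]\<close> the mass is a translate of \<open>\<kappa>\<close>, so the angle there is the one-wall angle; by the plateau
  lemmas it satisfies \<open>- \<pi>/2 - \<phi>(E') < \<theta>(1) \<le> - \<pi>/2\<close>, where \<open>\<phi> = decay_angle k\<close> and \<open>E'\<close> is an energy between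
  \<open>K\<close> and \<open>k\<close>.  On \<open>[0, 1]\<close> the mass is \<open>-\<kappa>\<close>, and \<open>\<theta> + \<pi>/2\<close> solves the one-wall equation.  Comparing it
  with the decaying angle at the larger energy \<open>E'\<close> transports the strict lower bound to the origin
  without any estimate of the rate of convergence.\<close>

lemma three_Theta:
  assumes gap: "spectral_gap k \<kappa>" and K: "0 < K" "K < k"
  shows "\<exists>\<delta>0\<ge>2. \<forall>\<delta>>\<delta>0. - pi < odd_wall.Theta (\<kappa>3 \<delta>) k (2 * \<delta> + 1) K \<and> odd_wall.Theta (\<kappa>3 \<delta>) k (2 * \<delta> + 1) K < - (pi / 2)"
proof -
  \<comment> \<open>any energy strictly between \<open>K\<close> and the gap edge serves as a barrier\<close>
  define E' where "E' = (K + k) / 2"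
  have E': "K < E'" "E' < k" using K by (auto simp: E'_def)
  note t = Theta_gt[OF gap less_imp_le[OF K(1)] K(2)]
  have f: "decay_angle k K < decay_angle k E'" "decay_angle k E' < pi / 4"
    using decay_angle_less[of K k E'] decay_angle(2)[of E' k] K E' by auto
  obtain T1 where T1: "T1 \<ge> 1" "\<And>T. T1 \<le> T \<Longrightarrow> one.angle K (- T) \<le> - (pi / 2)"
    using angle_left_upper[OF K t] by blast
  obtain T2 where T2: "T2 \<ge> 1" "\<And>T. T2 \<le> T \<Longrightarrow> - (pi / 2) - decay_angle k E' < one.angle K (- T)"
    using angle_left_lower[OF K t f] by blast
  define \<delta>0 where "\<delta>0 = T1 + T2"
  have "- pi < odd_wall.Theta (\<kappa>3 \<delta>) k (2 * \<delta> + 1) K \<and> odd_wall.Theta (\<kappa>3 \<delta>) k (2 * \<delta> + 1) K < - (pi / 2)"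
    if \<delta>: "\<delta> > \<delta>0" for \<delta>
  proof -
    have d: "\<delta> > 1" "T1 \<le> 2 * \<delta> - 1" "T2 \<le> 2 * \<delta> - 1" using \<delta> T1(1) T2(1) by (auto simp: \<delta>0_def)
    interpret three: odd_wall "\<kappa>3 \<delta>" k "2 * \<delta> + 1" by (rule three_odd_wall[OF d(1)])
    define \<theta> where "\<theta> = three.angle K"
    have \<theta>p: "prufer_at (\<kappa>3 \<delta>) K \<theta> x" for x unfolding \<theta>_def by (rule three.angle_prufer)
    have \<theta>c: "continuous_on UNIV \<theta>" unfolding \<theta>_def by (rule three.angle_continuous)
    have "\<theta> 1 = one.angle K (1 - 2 * \<delta>)"
    proof (rule prufer_unique[OF three.m_cont three.m_bound \<theta>c _ \<theta>p, where ?\<theta>2.0 = "\<lambda>x. one.angle K (x - 2 * \<delta>)" and l = 1 and u = "2 * \<delta> + 1" and ?x0.0 = "2 * \<delta> + 1"])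
      show "continuous_on UNIV (\<lambda>x. one.angle K (x - 2 * \<delta>))"
        by (intro continuous_on_compose2[OF one.angle_continuous] continuous_intros) auto
      show "prufer_at (\<kappa>3 \<delta>) K (\<lambda>x. one.angle K (x - 2 * \<delta>)) x" if "1 \<le> x" for x
        using one.angle_prufer[of K "x - 2 * \<delta>"] three_right[OF d(1) that]
          DERIV_shift[of "\<lambda>x. one.angle K (x - 2 * \<delta>)" _ "x - 2 * \<delta>" "2 * \<delta>"]
        by (simp add: prufer_at_def)
      show "\<theta> (2 * \<delta> + 1) = one.angle K (2 * \<delta> + 1 - 2 * \<delta>)"
        by (simp add: \<theta>_def three.angle_X one.angle_X)
    qed (use d in auto)
    then have \<theta>1: "\<theta> 1 \<le> - (pi / 2)" "- (pi / 2) - decay_angle k E' < \<theta> 1"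
      using T1(2)[OF d(2)] T2(2)[OF d(3)] by auto
    have "\<theta> 0 < - (pi / 2)"
      by (rule prufer_backward(3)[OF three.m_cont three.m_bound continuous_on_const \<theta>c, of 0 1 0 _ K])
        (use \<theta>p \<theta>1 K in \<open>auto simp: prufer_at_def\<close>)
    moreover have "one.angle E' 0 < \<theta> 0 + pi / 2"
    proof (rule prufer_backward(2)[OF cont one.m_bound _ one.angle_continuous, of "\<lambda>x. \<theta> x + pi / 2" 0 1 K E'])
      show "continuous_on UNIV (\<lambda>x. \<theta> x + pi / 2)" by (intro continuous_intros \<theta>c)
      show "prufer_at \<kappa> K (\<lambda>x. \<theta> x + pi / 2) x" if "0 \<le> x" "x \<le> 1" for x
        using \<theta>p[of x] three_middle[OF d(1), of x] that d
        unfolding prufer_at_def by (auto intro!: derivative_eq_intros simp: distrib_left)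
      show "one.angle E' 1 < \<theta> 1 + pi / 2" using \<theta>1(2) by (simp add: one.angle_X)
    qed (use E' one.angle_prufer in auto)
    ultimately show ?thesis
      using Theta_gt[OF gap, of E'] E' K by (simp add: three.Theta_def one.Theta_def \<theta>_def)
  qed
  moreover have "\<delta>0 \<ge> 2" using T1 T2 by (simp add: \<delta>0_def)
  ultimately show ?thesis by blast
qed

end

context odd_wall
begin

text \<open>On \<open>[0, K]\<close> the function \<open>\<Theta>\<close> decreases from \<open>0\<close> to a value in \<open>(- \<pi>, - \<pi>/2)\<close>, and the only multiples of
  \<open>\<pi>/2\<close> that it meets are \<open>0\<close> and \<open>- \<pi>/2\<close>, each once.  Negative energies follow since \<open>\<Theta>\<close> is odd.\<close>

lemma eigenvalues_in_window:
  assumes K: "0 < K" "K < k" and t: "- pi < Theta K" "Theta K < - (pi / 2)"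
  shows "\<exists>E. 0 < E \<and> E < K \<and> Theta E = - (pi / 2) \<and> {E' \<in> {-K..K}. eigenvalue m E'} = {0, E, - E}"
proof -
  have "\<exists>x\<ge>0. x \<le> K \<and> Theta x = - (pi / 2)"
    by (rule IVT2) (use t K Theta_0 Theta_continuous in auto)
  then obtain E where E: "0 \<le> E" "E \<le> K" "Theta E = - (pi / 2)" by blast
  have E2: "0 < E" "E < K" using E Theta_0 t by (auto simp: order_less_le)
  have pos: "E' = 0 \<or> E' = E" if E': "0 \<le> E'" "E' \<le> K" "sin (2 * Theta E') = 0" for E'
  proof -
    have "Theta E' \<le> 0" using Theta_less[of 0 E'] E' K by (cases "E' = 0") (auto simp: Theta_0)
    moreover have "Theta E' > - pi" using Theta_less[of E' K] E' K t by (cases "E' = K") auto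
    moreover obtain i :: int where i: "2 * Theta E' = of_int i * pi"
      using E'(3) sin_zero_iff_int2 by blast
    ultimately have "of_int i * pi \<le> 0 * pi" "(- 2) * pi < of_int i * pi" by linarith+
    then have "i \<le> 0" "- 2 < i"
      by (simp_all only: mult_le_cancel_right mult_less_cancel_right, simp_all add: not_less flip: of_int_less_iff)
    then have "i = 0 \<or> i = -1" by linarith
    then have "Theta E' = 0 \<or> Theta E' = - (pi / 2)" using i by auto
    then show ?thesis
    proof
      assume "Theta E' = 0"
      then show ?thesis using Theta_less[of 0 E'] E' K by (cases "E' = 0") (auto simp: Theta_0)
    next
      assume "Theta E' = - (pi / 2)"
      then show ?thesis
        using Theta_less[of E E'] Theta_less[of E' E] E E' K by (cases E E' rule: linorder_cases) auto
    qed
  qed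
  have "eigenvalue m E' \<longleftrightarrow> E' \<in> {0, E, - E}" if E': "E' \<in> {-K..K}" for E'
  proof -
    have ak: "\<bar>E'\<bar> < k" using E' K by auto
    have zE: "sin (2 * Theta E) = 0" "sin (2 * Theta (- E)) = 0" "sin (2 * Theta 0) = 0"
      using E K Theta_0 by (auto simp: Theta_minus)
    show ?thesis
      unfolding eigenvalue_iff[OF ak]
    proof
      assume z: "sin (2 * Theta E') = 0"
      show "E' \<in> {0, E, - E}"
      proof (cases "0 \<le> E'")
        case True
        then show ?thesis using pos[of E'] E' z by auto
      next
        case False
        then show ?thesis using pos[of "- E'"] E' z Theta_minus[OF ak] by auto
      qed
    qed (use zE in auto)
  qed
  then have "{E' \<in> {-K..K}. eigenvalue m E'} = {0, E, - E}" using E E2 K by auto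
  then show ?thesis using E E2 by blast
qed

end

lemma deriv_nonneg_le:
  fixes F :: "real \<Rightarrow> real"
  assumes "a \<le> b" "\<And>x. a \<le> x \<Longrightarrow> x \<le> b \<Longrightarrow> (F has_real_derivative F' x) (at x)"
    "\<And>x. a \<le> x \<Longrightarrow> x \<le> b \<Longrightarrow> 0 \<le> F' x"
  shows "F a \<le> F b"
  using DERIV_nonneg_imp_nondecreasing[OF assms(1), of F] assms(2,3) by blast

section \<open>The profile of the one-wall zero mode\<close>

context domain_wall
begin

text \<open>The profile of the one-wall zero mode, the primitive \<open>G\<close> of its square, the total integral \<open>N\<close> of its
  square, and a constant \<open>M\<close> with \<open>exp (- k \<bar>x\<bar>) / M \<le> h x \<le> M exp (- k \<bar>x\<bar>)\<close>.  The formula for \<open>N\<close> uses that \<open>h\<close> is an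
  exact exponential beyond \<open>1\<close>.\<close>

definition h :: "real \<Rightarrow> real" where "h x = exp (- mass_integral \<kappa> x)"
definition G :: "real \<Rightarrow> real" where "G = mass_integral (\<lambda>x. (h x)\<^sup>2)"
definition N :: real where "N = 2 * G 1 + (h 1)\<^sup>2 / k"
definition M :: real where "M = exp (one.mB + k)"

lemma h_pos: "h x > 0" by (simp add: h_def)
lemma h_even: "h (- x) = h x" by (simp add: h_def mass_integral_even[OF cont odd])
lemma h_deriv: "(h has_real_derivative - \<kappa> x * h x) (at x)"
  unfolding h_def using mass_integral_deriv[OF cont, of x] by (auto intro!: derivative_eq_intros)
lemma h_cont: "continuous_on UNIV h"
  unfolding h_def by (intro continuous_intros mass_integral_continuous cont)

lemma mass_integral_right:
  assumes "1 \<le> x" shows "mass_integral \<kappa> x = mass_integral \<kappa> 1 + k * (x - 1)"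
proof -
  have d: "((*) k has_real_derivative k) (at y)" for y by (auto intro!: derivative_eq_intros)
  have "mass_integral \<kappa> x - mass_integral \<kappa> 1 \<le> k * x - k * 1"
    by (rule deriv_le_imp_le[OF assms mass_integral_deriv[OF cont] d]) (simp add: right)
  moreover have "k * x - k * 1 \<le> mass_integral \<kappa> x - mass_integral \<kappa> 1"
    by (rule deriv_le_imp_le[OF assms d mass_integral_deriv[OF cont]]) (simp add: right)
  ultimately show ?thesis by (simp add: algebra_simps)
qed

lemma h_right: "1 \<le> x \<Longrightarrow> h x = h 1 * exp (- k * (x - 1))"
  using mass_integral_right[of x] by (simp add: h_def flip: exp_add)

lemma M_ge_1: "M \<ge> 1"
  using one.m_bound[of 0] k0 by (simp add: M_def)

lemma mass_integral_near: "\<bar>mass_integral \<kappa> x - k * \<bar>x\<bar>\<bar> \<le> one.mB + k"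
proof -
  have B0: "one.mB + k \<ge> 0" using one.m_bound[of 0] k0 by simp
  have 01: "\<bar>mass_integral \<kappa> y - k * y\<bar> \<le> one.mB + k" if y: "0 \<le> y" "y \<le> 1" for y
  proof -
    have "norm ((mass_integral \<kappa> y - k * y) - (mass_integral \<kappa> 0 - k * 0)) \<le> (one.mB + k) * norm (y - 0)"
    proof (rule field_differentiable_bound[of UNIV _ "\<lambda>x. \<kappa> x - k"])
      show "((\<lambda>y. mass_integral \<kappa> y - k * y) has_field_derivative \<kappa> z - k) (at z within UNIV)" for z
        using mass_integral_deriv[OF cont, of z] by (auto intro!: derivative_eq_intros)
      show "norm (\<kappa> z - k) \<le> one.mB + k" for z
        using one.m_bound[of z] k0 by (simp add: abs_le_iff)
    qed auto
    also have "\<dots> \<le> (one.mB + k) * 1" using y B0 by (intro mult_left_mono) auto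
    finally show ?thesis by simp
  qed
  have pos: "\<bar>mass_integral \<kappa> y - k * y\<bar> \<le> one.mB + k" if "0 \<le> y" for y
  proof (cases "y \<le> 1")
    case False
    then show ?thesis using mass_integral_right[of y] 01[of 1] by (simp add: algebra_simps)
  qed (use 01 that in auto)
  show ?thesis
    using pos[of x] pos[of "- x"] mass_integral_even[OF cont odd, of x] by (cases "0 \<le> x") auto
qed

lemma h_le: "h x \<le> M * exp (- k * \<bar>x\<bar>)" and exp_le_h: "exp (- k * \<bar>x\<bar>) \<le> M * h x"
  using mass_integral_near[of x] by (auto simp: h_def M_def simp flip: exp_add)

lemma inverse_h_le: "1 / h x \<le> M * exp (k * \<bar>x\<bar>)"
  using exp_le_h[of x] h_pos[of x] by (simp add: field_simps exp_minus)

lemma G_deriv: "(G has_real_derivative (h x)\<^sup>2) (at x)"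
  unfolding G_def by (rule mass_integral_deriv) (intro continuous_intros h_cont)

lemma G_0 [simp]: "G 0 = 0" by (simp add: G_def)

lemma G_odd: "G (- x) = - G x"
proof -
  have "((\<lambda>x. - G (- x)) has_real_derivative (h x)\<^sup>2) (at x)" for x
    using DERIV_minus[of "\<lambda>x. G (- x)" "- (h x)\<^sup>2" x] G_deriv[of "- x"] DERIV_mirror[of G "(h x)\<^sup>2" x] by (simp add: h_even)
  from real_derivative_unique[OF this G_deriv, of 0 x] show ?thesis by simp
qed

lemma G_mono: "x \<le> y \<Longrightarrow> G x \<le> G y"
  by (rule deriv_nonneg_le[of x y G "\<lambda>x. (h x)\<^sup>2"]) (auto intro: G_deriv)

lemma G_right: assumes "1 \<le> x" shows "G x = N / 2 - (h x)\<^sup>2 / (2 * k)"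
proof -
  have d: "((\<lambda>x. - ((h x)\<^sup>2 / (2 * k))) has_real_derivative \<kappa> x * (h x)\<^sup>2 / k) (at x)" for x
    using k0 by (auto intro!: derivative_eq_intros h_deriv simp: power2_eq_square)
  have "G x - G 1 \<le> - ((h x)\<^sup>2 / (2 * k)) - - ((h 1)\<^sup>2 / (2 * k))"
    by (rule deriv_le_imp_le[OF assms G_deriv d]) (use k0 in \<open>simp add: right\<close>)
  moreover have "- ((h x)\<^sup>2 / (2 * k)) - - ((h 1)\<^sup>2 / (2 * k)) \<le> G x - G 1"
    by (rule deriv_le_imp_le[OF assms d G_deriv]) (use k0 in \<open>simp add: right\<close>)
  ultimately show ?thesis using k0 by (simp add: N_def field_simps)
qed

lemma G_le: "G x \<le> N / 2"
proof -
  have "G x \<le> G (max 1 x)" by (rule G_mono) simp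
  also have "\<dots> \<le> N / 2" using G_right[of "max 1 x"] k0 by simp
  finally show ?thesis .
qed

lemma G_pos: "x > 0 \<Longrightarrow> G x > 0"
  using DERIV_pos_imp_increasing[of 0 x G] G_deriv h_pos by (metis G_0 zero_less_power)

lemma N_pos: "N > 0" using G_pos[of 1] G_le[of 1] by simp

lemma h_square_integral:
  "integrable lborel (\<lambda>x. (h x)\<^sup>2)" "(\<integral>x. (h x)\<^sup>2 \<partial>lborel) = N"
proof -
  have h0: "((\<lambda>x. (h x)\<^sup>2 / (2 * k)) \<longlongrightarrow> 0) at_top"
  proof (rule Lim_null_comparison)
    show "\<forall>\<^sub>F x in at_top. norm ((h x)\<^sup>2 / (2 * k)) \<le> (M\<^sup>2 / (2 * k)) * exp (- (2 * k) * x)"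
      using eventually_ge_at_top[of 0]
    proof eventually_elim
      case (elim x)
      have "(h x)\<^sup>2 \<le> (M * exp (- k * \<bar>x\<bar>))\<^sup>2" using h_le[of x] h_pos[of x] by (intro power_mono) auto
      also have "\<dots> = M\<^sup>2 * exp (- (2 * k) * x)" using elim by (simp add: power_mult_distrib flip: exp_double)
      finally show ?case using k0 by (simp add: divide_right_mono)
    qed
    have "((\<lambda>x. (M\<^sup>2 / (2 * k)) * exp (- (2 * k) * x)) \<longlongrightarrow> (M\<^sup>2 / (2 * k)) * 0) at_top"
    proof (intro tendsto_intros filterlim_compose[OF exp_at_bot])
      show "LIM x at_top. - (2 * k) * x :> at_bot"
        using k0 by (intro filterlim_tendsto_neg_mult_at_bot[OF tendsto_const] filterlim_ident) auto
    qed
    then show "((\<lambda>x. (M\<^sup>2 / (2 * k)) * exp (- (2 * k) * x)) \<longlongrightarrow> 0) at_top" by simp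
  qed
  have Gt: "(G \<longlongrightarrow> N / 2) at_top"
  proof (rule Lim_transform_eventually)
    show "((\<lambda>x. N / 2 - (h x)\<^sup>2 / (2 * k)) \<longlongrightarrow> N / 2) at_top"
      using tendsto_diff[OF tendsto_const h0, of "N / 2"] by simp
    show "\<forall>\<^sub>F x in at_top. N / 2 - (h x)\<^sup>2 / (2 * k) = G x"
      using eventually_ge_at_top[of 1] by eventually_elim (simp add: G_right)
  qed
  have Gb: "(G \<longlongrightarrow> - (N / 2)) at_bot"
  proof -
    have "((\<lambda>x. - G (- x)) \<longlongrightarrow> - (N / 2)) at_bot"
      by (intro tendsto_minus filterlim_compose[OF Gt] filterlim_uminus_at_top_at_bot)
    then show ?thesis by (simp add: G_odd)
  qed
  have u: "einterval (- \<infinity>) \<infinity> = UNIV" by (auto simp: einterval_def)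
  have ct: "isCont (\<lambda>x. (h x)\<^sup>2) x" for x
    using h_cont by (auto intro!: continuous_intros simp: continuous_on_eq_continuous_at)
  note F = interval_integral_FTC_nonneg[of "- \<infinity>" "\<infinity>" G "\<lambda>x. (h x)\<^sup>2" "- (N / 2)" "N / 2"]
  have "set_integrable lborel (einterval (- \<infinity>) \<infinity>) (\<lambda>x. (h x)\<^sup>2)"
    by (rule F(1)) (use G_deriv ct Gt Gb in \<open>auto simp: ereal_tendsto_simps\<close>)
  then show "integrable lborel (\<lambda>x. (h x)\<^sup>2)" by (simp add: u set_integrable_def)
  have "(LBINT x=- \<infinity>..\<infinity>. (h x)\<^sup>2) = N / 2 - - (N / 2)"
    by (rule F(2)) (use G_deriv ct Gt Gb in \<open>auto simp: ereal_tendsto_simps\<close>)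
  then show "(\<integral>x. (h x)\<^sup>2 \<partial>lborel) = N"
    by (simp add: interval_lebesgue_integral_le_eq u set_lebesgue_integral_def)
qed

lemma gamma: "gamma_const \<kappa> > 0" "(gamma_const \<kappa>)\<^sup>2 = 1 / (2 * N)"
  using N_pos h_square_integral(2)
  by (simp_all add: gamma_const_def L2_norm_real_def h_def[symmetric] power_mult_distrib power_divide)

section \<open>The three-wall profile in terms of the one-wall profile\<close>

lemma three_cont: "\<delta> > 1 \<Longrightarrow> continuous_on UNIV (\<kappa>3 \<delta>)"
  using three_odd_wall odd_wall.m_cont by blast

text \<open>The exponential of the three-wall primitive is \<open>h\<close> up to the edge of the right wall, and its inverse is
  a multiple of the translate of \<open>h\<close> from the edge of the middle wall on.  The two descriptions overlap on
  the plateau between the walls.\<close>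

lemma exp_three_left:
  assumes d: "\<delta> > 1" and x: "0 \<le> x" "x \<le> 2 * \<delta> - 1"
  shows "exp (mass_integral (\<kappa>3 \<delta>) x) = h x"
proof -
  note m = mass_integral_deriv[OF three_cont[OF d]] and n = DERIV_minus[OF mass_integral_deriv[OF cont]]
  have "mass_integral (\<kappa>3 \<delta>) x - mass_integral (\<kappa>3 \<delta>) 0 \<le> - mass_integral \<kappa> x - - mass_integral \<kappa> 0"
    by (rule deriv_le_imp_le[OF x(1) m n]) (use three_middle[OF d] x in auto)
  moreover have "- mass_integral \<kappa> x - - mass_integral \<kappa> 0 \<le> mass_integral (\<kappa>3 \<delta>) x - mass_integral (\<kappa>3 \<delta>) 0"
    by (rule deriv_le_imp_le[OF x(1) n m]) (use three_middle[OF d] x in auto)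
  ultimately show ?thesis by (simp add: h_def)
qed

lemma exp_three_right:
  assumes d: "\<delta> > 1" and x: "1 \<le> x"
  shows "exp (- mass_integral (\<kappa>3 \<delta>) x) = h (x - 2 * \<delta>) / (h \<delta>)\<^sup>2"
proof -
  note m = mass_integral_deriv[OF three_cont[OF d]]
  have n: "((\<lambda>x. mass_integral \<kappa> (x - 2 * \<delta>)) has_real_derivative \<kappa> (x - 2 * \<delta>)) (at x)" for x
    using DERIV_shift[of "\<lambda>x. mass_integral \<kappa> (x - 2 * \<delta>)" _ "x - 2 * \<delta>" "2 * \<delta>"] mass_integral_deriv[OF cont, of "x - 2 * \<delta>"] by simp
  have "mass_integral (\<kappa>3 \<delta>) x - mass_integral (\<kappa>3 \<delta>) 1 \<le> mass_integral \<kappa> (x - 2 * \<delta>) - mass_integral \<kappa> (1 - 2 * \<delta>)"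
    by (rule deriv_le_imp_le[OF x m n]) (use three_right[OF d] in auto)
  moreover have "mass_integral \<kappa> (x - 2 * \<delta>) - mass_integral \<kappa> (1 - 2 * \<delta>) \<le> mass_integral (\<kappa>3 \<delta>) x - mass_integral (\<kappa>3 \<delta>) 1"
    by (rule deriv_le_imp_le[OF x n m]) (use three_right[OF d] in auto)
  ultimately have e: "- mass_integral (\<kappa>3 \<delta>) x = - mass_integral \<kappa> (x - 2 * \<delta>) + mass_integral \<kappa> (1 - 2 * \<delta>) - mass_integral (\<kappa>3 \<delta>) 1"
    by simp
  have e1: "- mass_integral (\<kappa>3 \<delta>) 1 = mass_integral \<kappa> 1"
    using exp_three_left[OF d, of 1] d by (simp add: h_def)
  have e2: "mass_integral \<kappa> (1 - 2 * \<delta>) = mass_integral \<kappa> (2 * \<delta> - 1)"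
    using mass_integral_even[OF cont odd, of "2 * \<delta> - 1"] by simp
  have "mass_integral \<kappa> (2 * \<delta> - 1) + mass_integral \<kappa> 1 = 2 * mass_integral \<kappa> \<delta>"
    using mass_integral_right[of "2 * \<delta> - 1"] mass_integral_right[of \<delta>] d by (simp add: algebra_simps)
  then have "- mass_integral (\<kappa>3 \<delta>) x = - mass_integral \<kappa> (x - 2 * \<delta>) + 2 * mass_integral \<kappa> \<delta>"
    using e e1 e2 by linarith
  moreover have "(h \<delta>)\<^sup>2 = exp (- (2 * mass_integral \<kappa> \<delta>))"
    by (simp add: h_def flip: exp_double)
  ultimately show ?thesis
    by (simp add: h_def exp_diff exp_minus divide_inverse)
qed

end

section \<open>Asymptotics of the first positive eigenvalue\<close>

context domain_wall
begin

text \<open>Explicit constants that depend on the wall alone, so that every estimate below is uniform in \<open>\<delta>\<close>.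
  Here \<open>x0\<close> is so small that \<open>C \<ge> 1 / 2\<close> on \<open>[0, x0]\<close> for every energy in the gap, and \<open>c2\<close>
  bounds \<open>E / h(\<delta>)\<^sup>2\<close> a priori.\<close>

definition x0 :: real where "x0 = min 1 (ln (1 + 2 / (k * N * M\<^sup>2)) / (2 * k))"
definition c1 :: real where "c1 = N * M\<^sup>2 / (4 * k)"
definition c2 :: real where "c2 = 2 / sqrt (N * G x0)"
definition c3 :: real where "c3 = 2 * M\<^sup>2 * exp (2 * k)"
definition c4 :: real where
  "c4 = c2\<^sup>2 * M\<^sup>2 * (c1 * exp (2 * k) + c3 * N + (N / 2 + c3 * M ^ 4) * (c2\<^sup>2 / k\<^sup>2) * N)"
definition c6 :: real where "c6 = 1 / (2 * k) + c2\<^sup>2 * c1 * M ^ 4 / (2 * k)"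
definition c7 :: real where "c7 = c2\<^sup>2 * (N * c6 + N / (4 * k))"
definition c9 :: real where "c9 = 2 * (c4 + c7) / (N\<^sup>2 * (sqrt 2 / N))"

lemma x0: "0 < x0" "x0 \<le> 1" "k\<^sup>2 * (c1 * (exp (2 * k * x0) - 1)) \<le> 1 / 2"
proof -
  have pos: "0 < 2 / (k * N * M\<^sup>2)" using k0 N_pos M_ge_1 by simp
  have "0 < ln (1 + 2 / (k * N * M\<^sup>2)) / (2 * k)"
    using pos k0 by (intro divide_pos_pos ln_gt_zero) auto
  then show "0 < x0" by (simp add: x0_def)
  show "x0 \<le> 1" by (simp add: x0_def)
  have "2 * k * x0 \<le> ln (1 + 2 / (k * N * M\<^sup>2))"
    using k0 mult_left_mono[of x0 "ln (1 + 2 / (k * N * M\<^sup>2)) / (2 * k)" "2 * k"] by (simp add: x0_def)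
  then have "exp (2 * k * x0) \<le> exp (ln (1 + 2 / (k * N * M\<^sup>2)))" by (simp only: exp_le_cancel_iff)
  also have "\<dots> = 1 + 2 / (k * N * M\<^sup>2)" by (rule exp_ln) (use pos in linarith)
  finally have "exp (2 * k * x0) - 1 \<le> 2 / (k * N * M\<^sup>2)" by simp
  moreover have "k\<^sup>2 * c1 \<ge> 0" using k0 N_pos by (simp add: c1_def)
  ultimately have "(k\<^sup>2 * c1) * (exp (2 * k * x0) - 1) \<le> (k\<^sup>2 * c1) * (2 / (k * N * M\<^sup>2))" by (rule mult_left_mono)
  also have "\<dots> = 1 / 2" using k0 N_pos M_ge_1 by (simp add: c1_def field_simps power2_eq_square)
  finally show "k\<^sup>2 * (c1 * (exp (2 * k * x0) - 1)) \<le> 1 / 2" by (simp add: mult.assoc)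
qed

lemma consts_pos: "c1 > 0" "c2 > 0" "c3 > 0" "c4 > 0" "c6 > 0" "c7 > 0"
proof -
  have M: "M > 0" using M_ge_1 by simp
  show c1: "c1 > 0" using N_pos k0 M by (simp add: c1_def)
  show c2: "c2 > 0" using N_pos G_pos[OF x0(1)] by (simp add: c2_def)
  show c3: "c3 > 0" using M by (simp add: c3_def)
  show "c4 > 0" unfolding c4_def using c1 c2 c3 M k0 N_pos by (intro mult_pos_pos add_pos_pos) auto
  show c6: "c6 > 0" unfolding c6_def using c1 c2 M k0 by (intro mult_pos_pos divide_pos_pos add_pos_pos) auto
  show "c7 > 0" unfolding c7_def using c2 c6 k0 N_pos by (intro mult_pos_pos divide_pos_pos add_pos_pos) auto
qed

end

text \<open>What is used of the eigenfunction at the first positive eigenvalue: \<open>p\<close> is its first component and \<open>c\<close> is minus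
  the second one, both nonnegative on the right half-line, scaled so that \<open>c 0 = 1\<close>.  The assumptions from
  \<open>c_X\<close> on describe the exponential tail, in which \<open>\<tau>\<close> is the tangent of the decay angle.\<close>

locale three_wall_profile = domain_wall +
  fixes K \<delta> E \<tau> :: real and p c :: "real \<Rightarrow> real"
  assumes K: "0 < K" "K < k" and \<delta>2: "2 \<le> \<delta>" and E: "0 < E" "E \<le> K"
    and p_deriv: "\<And>x. (p has_real_derivative - \<kappa>3 \<delta> x * p x + E * c x) (at x)"
    and c_deriv: "\<And>x. (c has_real_derivative \<kappa>3 \<delta> x * c x - E * p x) (at x)"
    and p_0: "p 0 = 0" and c_0: "c 0 = 1"
    and p_nonneg: "\<And>x. 0 \<le> x \<Longrightarrow> 0 \<le> p x" and c_nonneg: "\<And>x. 0 \<le> x \<Longrightarrow> 0 \<le> c x"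
    and c_X: "c (2 * \<delta> + 1) = \<tau> * p (2 * \<delta> + 1)"
    and \<tau>: "E / (2 * k) \<le> \<tau>" "\<tau> \<le> E / (2 * k) * (1 + E\<^sup>2 / k\<^sup>2)"
    and p_tail: "\<And>x. 2 * \<delta> + 1 \<le> x \<Longrightarrow> p x = p (2 * \<delta> + 1) * exp (- sqrt (k\<^sup>2 - E\<^sup>2) * (x - (2 * \<delta> + 1)))"
    and c_tail: "\<And>x. 2 * \<delta> + 1 \<le> x \<Longrightarrow> c x = c (2 * \<delta> + 1) * exp (- sqrt (k\<^sup>2 - E\<^sup>2) * (x - (2 * \<delta> + 1)))"
begin

text \<open>\<open>g\<close> and \<open>eps\<close> are comparable; \<open>g\<close> is the natural size of the eigenvalue and \<open>eps\<close> the one in which the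
  result is stated.  The functions \<open>Q\<close> and \<open>C\<close> are the components with the zero-energy growth factored out.\<close>

definition g :: real where "g = (h \<delta>)\<^sup>2"
definition eps :: real where "eps = exp (- 2 * k * \<delta>)"
definition e :: "real \<Rightarrow> real" where "e x = exp (mass_integral (\<kappa>3 \<delta>) x)"
definition Q :: "real \<Rightarrow> real" where "Q x = e x * p x"
definition C :: "real \<Rightarrow> real" where "C x = c x / e x"

lemma d1: "\<delta> > 1" using \<delta>2 by simp

lemma g_pos: "g > 0" using h_pos[of \<delta>] by (simp add: g_def)

lemma g_eps: "g \<le> M\<^sup>2 * eps" "eps \<le> M\<^sup>2 * g"
proof -
  have e2: "(exp (- k * \<bar>\<delta>\<bar>))\<^sup>2 = eps" using d1 by (simp add: eps_def flip: exp_double)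
  have "g \<le> (M * exp (- k * \<bar>\<delta>\<bar>))\<^sup>2" unfolding g_def using h_le h_pos[of \<delta>] by (intro power_mono) auto
  then show "g \<le> M\<^sup>2 * eps" unfolding power_mult_distrib e2 .
  have "(exp (- k * \<bar>\<delta>\<bar>))\<^sup>2 \<le> (M * h \<delta>)\<^sup>2" by (intro power_mono exp_le_h) simp
  then show "eps \<le> M\<^sup>2 * g" unfolding power_mult_distrib e2 g_def .
qed

lemma eps: "0 < eps" "eps \<le> 1" using k0 d1 by (auto simp: eps_def)

lemma g_le: "g \<le> M\<^sup>2"
  using g_eps(1) eps mult_left_mono[of eps 1 "M\<^sup>2"] by simp

lemma g_delta: "g * \<delta> \<le> M\<^sup>2 / (2 * k)"
proof -
  have "2 * k * \<delta> \<le> exp (2 * k * \<delta>)" using exp_ge_add_one_self[of "2 * k * \<delta>"] by linarith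
  then have "eps * (2 * k * \<delta>) \<le> eps * exp (2 * k * \<delta>)" using eps by (intro mult_left_mono) auto
  also have "\<dots> = 1" by (simp add: eps_def flip: exp_add)
  finally have 1: "eps * \<delta> \<le> 1 / (2 * k)" using k0 by (simp add: field_simps)
  have "g * \<delta> \<le> M\<^sup>2 * eps * \<delta>" using g_eps d1 by (intro mult_right_mono) auto
  also have "\<dots> \<le> M\<^sup>2 * (1 / (2 * k))" using mult_left_mono[OF 1, of "M\<^sup>2"] by (simp add: mult.assoc)
  finally show ?thesis by simp
qed

lemma e_pos: "e x > 0" by (simp add: e_def)
lemma e_0: "e 0 = 1" by (simp add: e_def)
lemma e_left: "0 \<le> x \<Longrightarrow> x \<le> 2 * \<delta> - 1 \<Longrightarrow> e x = h x"
  unfolding e_def by (rule exp_three_left[OF d1])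
lemma e_right: "1 \<le> x \<Longrightarrow> e x = g / h (x - 2 * \<delta>)"
  using exp_three_right[OF d1, of x] h_pos[of "x - 2 * \<delta>"] g_pos
  by (simp add: e_def g_def exp_minus field_simps)

lemma e_deriv: "(e has_real_derivative \<kappa>3 \<delta> x * e x) (at x)"
  unfolding e_def using mass_integral_deriv[OF three_cont[OF d1], of x] by (auto intro!: derivative_eq_intros)

lemma Q_deriv: "(Q has_real_derivative E * (e x)\<^sup>2 * C x) (at x)"
proof -
  have "(Q has_real_derivative \<kappa>3 \<delta> x * e x * p x + (- \<kappa>3 \<delta> x * p x + E * c x) * e x) (at x)"
    unfolding Q_def by (rule DERIV_mult[OF e_deriv p_deriv])
  moreover have "\<kappa>3 \<delta> x * e x * p x + (- \<kappa>3 \<delta> x * p x + E * c x) * e x = E * (e x)\<^sup>2 * C x"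
    using e_pos[of x] by (simp add: C_def power2_eq_square algebra_simps)
  ultimately show ?thesis by simp
qed

lemma C_deriv: "(C has_real_derivative - (E / (e x)\<^sup>2 * Q x)) (at x)"
proof -
  have "(C has_real_derivative ((\<kappa>3 \<delta> x * c x - E * p x) * e x - c x * (\<kappa>3 \<delta> x * e x)) / (e x * e x)) (at x)"
    unfolding C_def using e_pos[of x] by (intro DERIV_divide c_deriv e_deriv) auto
  moreover have "((\<kappa>3 \<delta> x * c x - E * p x) * e x - c x * (\<kappa>3 \<delta> x * e x)) / (e x * e x) = - (E / (e x)\<^sup>2 * Q x)"
    using e_pos[of x] by (simp add: Q_def power2_eq_square field_simps)
  ultimately show ?thesis by simp
qed

lemma Q_nonneg: "0 \<le> x \<Longrightarrow> 0 \<le> Q x" and C_nonneg: "0 \<le> x \<Longrightarrow> 0 \<le> C x"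
  using p_nonneg[of x] c_nonneg[of x] e_pos[of x] by (auto simp: Q_def C_def)

lemma Q_mono: "0 \<le> x \<Longrightarrow> x \<le> y \<Longrightarrow> Q x \<le> Q y"
  by (rule deriv_nonneg_le[OF _ Q_deriv]) (use E C_nonneg in auto)

lemma C_anti: "0 \<le> x \<Longrightarrow> x \<le> y \<Longrightarrow> C y \<le> C x"
  using deriv_nonneg_le[of x y "\<lambda>x. - C x", OF _ DERIV_minus[OF C_deriv]] E Q_nonneg by auto

lemma Q_0: "Q 0 = 0" and C_0: "C 0 = 1" by (simp_all add: Q_def C_def p_0 c_0 e_0)
lemma C_le_1: "0 \<le> x \<Longrightarrow> C x \<le> 1" using C_anti[of 0 x] by (simp add: C_0)

lemma Q_le_G: assumes x: "0 \<le> x" "x \<le> 2 * \<delta> - 1" shows "Q x \<le> E * G x"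
proof -
  have "Q x - Q 0 \<le> E * G x - E * G 0"
  proof (rule deriv_le_imp_le[OF x(1) Q_deriv DERIV_cmult[OF G_deriv]])
    fix y assume y: "0 \<le> y" "y \<le> x"
    have "E * (h y)\<^sup>2 * C y \<le> E * (h y)\<^sup>2 * 1" using E C_le_1[OF y(1)] by (intro mult_left_mono) auto
    then show "E * (e y)\<^sup>2 * C y \<le> E * (h y)\<^sup>2" using e_left[of y] x y by simp
  qed
  then show ?thesis by (simp add: Q_0)
qed

lemma Q_le: "0 \<le> x \<Longrightarrow> x \<le> 2 * \<delta> - 1 \<Longrightarrow> Q x \<le> E * (N / 2)"
  using Q_le_G[of x] mult_left_mono[OF G_le[of x], of E] E by linarith

text \<open>The loss of \<open>C\<close> is at most of order \<open>E\<^sup>2 exp (2 k x)\<close>, hence still negligible half way to the right wall.\<close>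

lemma C_ge: assumes x: "0 \<le> x" "x \<le> 2 * \<delta> - 1" shows "1 - C x \<le> E\<^sup>2 * (c1 * (exp (2 * k * x) - 1))"
proof -
  have d: "((\<lambda>x. E\<^sup>2 * c1 * exp (2 * k * x)) has_real_derivative E\<^sup>2 * (N / 2) * (M\<^sup>2 * exp (2 * k * x))) (at x)" for x
    using k0 by (auto intro!: derivative_eq_intros simp: c1_def)
  have "(- C x) - (- C 0) \<le> E\<^sup>2 * c1 * exp (2 * k * x) - E\<^sup>2 * c1 * exp (2 * k * 0)"
  proof (rule deriv_le_imp_le[OF x(1) DERIV_minus[OF C_deriv] d])
    fix y assume y: "0 \<le> y" "y \<le> x"
    have "E / (e y)\<^sup>2 * Q y = E * Q y * (1 / h y)\<^sup>2" using e_left[of y] x y by (simp add: power_divide)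
    also have "\<dots> \<le> E * (E * (N / 2)) * (M * exp (k * \<bar>y\<bar>))\<^sup>2"
      using E Q_le[of y] Q_nonneg[of y] x y inverse_h_le[of y] h_pos[of y] N_pos
      by (intro mult_mono power_mono mult_left_mono mult_nonneg_nonneg) auto
    also have "\<dots> = E\<^sup>2 * (N / 2) * (M\<^sup>2 * exp (2 * k * y))"
      using y by (simp add: power_mult_distrib power2_eq_square mult.assoc flip: exp_add)
    finally show "- (- (E / (e y)\<^sup>2 * Q y)) \<le> E\<^sup>2 * (N / 2) * (M\<^sup>2 * exp (2 * k * y))" by simp
  qed
  then show ?thesis by (simp add: C_0 algebra_simps)
qed

lemma C_ge': assumes x: "0 \<le> x" "x \<le> 2 * \<delta> - 1" shows "1 - C x \<le> E\<^sup>2 * c1 * exp (2 * k * x)"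
proof -
  have "E\<^sup>2 * (c1 * (exp (2 * k * x) - 1)) = E\<^sup>2 * c1 * exp (2 * k * x) - E\<^sup>2 * c1"
    by (simp add: algebra_simps)
  moreover have "0 \<le> E\<^sup>2 * c1" using consts_pos(1) by simp
  ultimately show ?thesis using C_ge[OF x] by linarith
qed

lemma Q_x0: "E * G x0 / 2 \<le> Q x0"
proof -
  have "E / 2 * G x0 - E / 2 * G 0 \<le> Q x0 - Q 0"
  proof (rule deriv_le_imp_le[OF less_imp_le[OF x0(1)] DERIV_cmult[OF G_deriv] Q_deriv])
    fix y assume y: "0 \<le> y" "y \<le> x0"
    have yD: "y \<le> 2 * \<delta> - 1" using y x0 d1 by simp
    have "E\<^sup>2 * (c1 * (exp (2 * k * y) - 1)) \<le> k\<^sup>2 * (c1 * (exp (2 * k * x0) - 1))"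
      using E K k0 y consts_pos(1) by (intro mult_mono power_mono) auto
    then have "1 / 2 \<le> C y" using C_ge[OF y(1) yD] x0(3) by simp
    then have "E * (h y)\<^sup>2 * (1 / 2) \<le> E * (h y)\<^sup>2 * C y" using E by (intro mult_left_mono) auto
    then show "E / 2 * (h y)\<^sup>2 \<le> E * (e y)\<^sup>2 * C y" using e_left[OF y(1) yD] by simp
  qed
  then show ?thesis by (simp add: Q_0)
qed

lemma C_X: "C (2 * \<delta> + 1) = \<tau> * (h 1)\<^sup>2 / g\<^sup>2 * Q (2 * \<delta> + 1)"
proof -
  have eX: "e (2 * \<delta> + 1) = g / h 1" using e_right[of "2 * \<delta> + 1"] d1 by simp
  show ?thesis
    unfolding C_def Q_def c_X eX using h_pos[of 1] g_pos by (simp add: power2_eq_square)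
qed

lemma GR_deriv: "((\<lambda>x. a * G (x - 2 * \<delta>)) has_real_derivative a * (h (x - 2 * \<delta>))\<^sup>2) (at x)"
proof -
  have "((\<lambda>x. G (x - 2 * \<delta>)) has_real_derivative (h (x - 2 * \<delta>))\<^sup>2) (at x)"
    using DERIV_shift[of "\<lambda>x. G (x - 2 * \<delta>)" _ "x - 2 * \<delta>" "2 * \<delta>"] G_deriv[of "x - 2 * \<delta>"] by simp
  then show ?thesis by (rule DERIV_cmult)
qed

lemma G_1: "N / 2 - G 1 = (h 1)\<^sup>2 / (2 * k)" using G_right[of 1] by simp

text \<open>\<open>C' = - E (h (x - 2\<delta>) / g)\<^sup>2 Q\<close> is integrated up to \<open>2\<delta> + 1\<close>, with the monotone \<open>Q\<close> bounded below by \<open>Q y\<close> here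
  and above by \<open>Q (2\<delta> + 1)\<close> in \<open>C_upper\<close>.  The end value \<open>C (2\<delta> + 1)\<close> accounts for the integral of
  \<open>(h (x - 2\<delta>))\<^sup>2\<close> beyond \<open>2\<delta> + 1\<close>, up to the factor \<open>1 + E\<^sup>2 / k\<^sup>2\<close> in the upper bound.\<close>

lemma C_lower:
  assumes y: "1 \<le> y" "y \<le> 2 * \<delta> + 1"
  shows "E * Q y / g\<^sup>2 * (N / 2 - G (y - 2 * \<delta>)) \<le> C y"
proof -
  define a where "a = E * Q y / g\<^sup>2"
  have Qy: "0 \<le> Q y" using Q_nonneg y by simp
  have a0: "a \<ge> 0" using E Qy by (simp add: a_def)
  have "a * G (2 * \<delta> + 1 - 2 * \<delta>) - a * G (y - 2 * \<delta>) \<le> - C (2 * \<delta> + 1) - - C y"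
  proof (rule deriv_le_imp_le[OF y(2) GR_deriv DERIV_minus[OF C_deriv]])
    fix z assume z: "y \<le> z" "z \<le> 2 * \<delta> + 1"
    have "a * (h (z - 2 * \<delta>))\<^sup>2 = E * (h (z - 2 * \<delta>))\<^sup>2 / g\<^sup>2 * Q y" by (simp add: a_def)
    also have "\<dots> \<le> E * (h (z - 2 * \<delta>))\<^sup>2 / g\<^sup>2 * Q z"
      using E Q_mono[of y z] y z by (intro mult_left_mono) auto
    also have "\<dots> = E / (e z)\<^sup>2 * Q z" using e_right[of z] y z by (simp add: power_divide)
    finally show "a * (h (z - 2 * \<delta>))\<^sup>2 \<le> - (- (E / (e z)\<^sup>2 * Q z))" by simp
  qed
  moreover have "a * (N / 2 - G 1) \<le> C (2 * \<delta> + 1)"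
  proof -
    have "a * (N / 2 - G 1) = E / (2 * k) * ((h 1)\<^sup>2 / g\<^sup>2) * Q y" unfolding G_1 by (simp add: a_def mult_ac)
    also have "\<dots> \<le> \<tau> * ((h 1)\<^sup>2 / g\<^sup>2) * Q (2 * \<delta> + 1)"
      using \<tau>(1) E k0 Qy Q_mono[of y "2 * \<delta> + 1"] y by (intro mult_mono mult_nonneg_nonneg) (auto intro: order_trans[of _ "E / (2 * k)"])
    finally show ?thesis by (simp add: C_X)
  qed
  ultimately have "a * (N / 2 - G (y - 2 * \<delta>)) \<le> C y" by (simp add: algebra_simps)
  then show ?thesis by (simp add: a_def)
qed

lemma C_upper:
  assumes y: "1 \<le> y" "y \<le> 2 * \<delta> + 1"
  shows "C y \<le> E * Q (2 * \<delta> + 1) / g\<^sup>2 * (1 + E\<^sup>2 / k\<^sup>2) * (N / 2 - G (y - 2 * \<delta>))"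
proof -
  define b where "b = E * Q (2 * \<delta> + 1) / g\<^sup>2"
  define a where "a = b * (1 + E\<^sup>2 / k\<^sup>2)"
  have QX: "0 \<le> Q (2 * \<delta> + 1)" using Q_nonneg d1 by simp
  have b0: "b \<ge> 0" using E QX by (simp add: b_def)
  then have ba: "b \<le> a" using mult_left_mono[of 1 "1 + E\<^sup>2 / k\<^sup>2" b] by (simp add: a_def)
  have "- C (2 * \<delta> + 1) - - C y \<le> a * G (2 * \<delta> + 1 - 2 * \<delta>) - a * G (y - 2 * \<delta>)"
  proof (rule deriv_le_imp_le[OF y(2) DERIV_minus[OF C_deriv] GR_deriv])
    fix z assume z: "y \<le> z" "z \<le> 2 * \<delta> + 1"
    have "E / (e z)\<^sup>2 * Q z = E * (h (z - 2 * \<delta>))\<^sup>2 / g\<^sup>2 * Q z" using e_right[of z] y z by (simp add: power_divide)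
    also have "\<dots> \<le> E * (h (z - 2 * \<delta>))\<^sup>2 / g\<^sup>2 * Q (2 * \<delta> + 1)"
      using E Q_mono[of z "2 * \<delta> + 1"] y z by (intro mult_left_mono) auto
    also have "\<dots> = b * (h (z - 2 * \<delta>))\<^sup>2" by (simp add: b_def)
    also have "\<dots> \<le> a * (h (z - 2 * \<delta>))\<^sup>2" using ba by (intro mult_right_mono) auto
    finally show "- (- (E / (e z)\<^sup>2 * Q z)) \<le> a * (h (z - 2 * \<delta>))\<^sup>2" by simp
  qed
  moreover have "C (2 * \<delta> + 1) \<le> a * (N / 2 - G 1)"
  proof -
    have "C (2 * \<delta> + 1) \<le> E / (2 * k) * (1 + E\<^sup>2 / k\<^sup>2) * ((h 1)\<^sup>2 / g\<^sup>2) * Q (2 * \<delta> + 1)"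
      unfolding C_X times_divide_eq_right[symmetric] using \<tau>(2) QX by (intro mult_right_mono) auto
    also have "\<dots> = a * (N / 2 - G 1)" unfolding G_1 a_def b_def by (simp add: mult_ac)
    finally show ?thesis .
  qed
  ultimately have "C y \<le> a * (N / 2 - G (y - 2 * \<delta>))" by (simp add: algebra_simps)
  then show ?thesis by (simp add: a_def b_def)
qed

text \<open>A priori bound: \<open>Q\<close> has already size \<open>E\<close> at \<open>x0\<close>, and the drop of \<open>C\<close> across the right wall, of
  size \<open>E Q / g\<^sup>2\<close>, cannot exceed \<open>1\<close>.\<close>

lemma E_le: "E \<le> c2 * g"
proof -
  have "E * G x0 / 2 \<le> Q (2 * \<delta>)" using Q_x0 Q_mono[of x0 "2 * \<delta>"] x0 d1 by simp
  then have "E * (E * G x0 / 2) / g\<^sup>2 * (N / 2) \<le> E * Q (2 * \<delta>) / g\<^sup>2 * (N / 2)"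
    using E N_pos by (intro mult_right_mono divide_right_mono mult_left_mono) auto
  also have "\<dots> \<le> C (2 * \<delta>)" using C_lower[of "2 * \<delta>"] d1 by simp
  also have "\<dots> \<le> 1" using C_le_1 d1 by simp
  finally have 1: "E\<^sup>2 * (G x0 * N) \<le> 4 * g\<^sup>2" using g_pos by (simp add: field_simps power2_eq_square)
  have GN: "G x0 * N > 0" using G_pos[OF x0(1)] N_pos by simp
  have "E\<^sup>2 \<le> (c2 * g)\<^sup>2"
    using 1 GN by (simp add: c2_def power_mult_distrib power_divide field_simps)
  then show ?thesis by (rule power2_le_imp_le) (use consts_pos g_pos in simp)
qed

lemma E2_le: "E\<^sup>2 \<le> c2\<^sup>2 * g\<^sup>2"
  using power_mono[OF E_le, of 2] E by (simp add: power_mult_distrib)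

lemma Q_upper: assumes x: "0 \<le> x" "x \<le> 2 * \<delta> + 1" shows "Q x \<le> E * (N / 2 + c3 * g\<^sup>2)"
proof (cases "x \<le> 2 * \<delta> - 1")
  case True
  have "0 \<le> E * (c3 * g\<^sup>2)" using E consts_pos by (intro mult_nonneg_nonneg) auto
  then show ?thesis using Q_le[OF x(1) True] by (simp add: distrib_left)
next
  case False
  then have le: "2 * \<delta> - 1 \<le> x" by simp
  define a where "a = E * g\<^sup>2 * (M * exp k)\<^sup>2"
  have a0: "a \<ge> 0" using E by (simp add: a_def)
  have "Q x - Q (2 * \<delta> - 1) \<le> a * x - a * (2 * \<delta> - 1)"
  proof (rule deriv_le_imp_le[OF le Q_deriv])
    show "((*) a has_real_derivative a) (at y)" for y by (auto intro!: derivative_eq_intros)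
    fix y assume y: "2 * \<delta> - 1 \<le> y" "y \<le> x"
    have "E * (e y)\<^sup>2 * C y = E * g\<^sup>2 * (1 / h (y - 2 * \<delta>))\<^sup>2 * C y"
      using e_right[of y] y d1 by (simp add: power_divide)
    also have "\<dots> \<le> E * g\<^sup>2 * (M * exp k)\<^sup>2 * 1"
    proof (intro mult_mono power_mono)
      have "1 / h (y - 2 * \<delta>) \<le> M * exp (k * \<bar>y - 2 * \<delta>\<bar>)" by (rule inverse_h_le)
      also have "\<dots> \<le> M * exp k"
        using k0 M_ge_1 y x mult_left_mono[of "\<bar>y - 2 * \<delta>\<bar>" 1 k] by (intro mult_left_mono) auto
      finally show "1 / h (y - 2 * \<delta>) \<le> M * exp k" .
    qed (use E g_pos C_le_1[of y] C_nonneg[of y] y d1 h_pos[of "y - 2 * \<delta>"] in auto)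
    finally show "E * (e y)\<^sup>2 * C y \<le> a" by (simp add: a_def)
  qed
  also have "a * x - a * (2 * \<delta> - 1) = a * (x - (2 * \<delta> - 1))" by (simp add: algebra_simps)
  also have "\<dots> \<le> a * 2" using a0 x by (intro mult_left_mono) auto
  also have "a * 2 = E * (c3 * g\<^sup>2)" by (simp add: a_def c3_def power_mult_distrib flip: exp_double)
  finally show ?thesis using Q_le[of "2 * \<delta> - 1"] d1 by (simp add: distrib_left)
qed

lemma Q_lower: assumes x: "0 \<le> x" "x \<le> 2 * \<delta> - 1" shows "E * (G x - E\<^sup>2 * c1 * M\<^sup>2 * x) \<le> Q x"
proof -
  define a where "a = E * (E\<^sup>2 * c1 * M\<^sup>2)"
  have "(E * G x - a * x) - (E * G 0 - a * 0) \<le> Q x - Q 0"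
  proof (rule deriv_le_imp_le[OF x(1) _ Q_deriv])
    show "((\<lambda>x. E * G x - a * x) has_real_derivative E * (h y)\<^sup>2 - a) (at y)" for y
      by (auto intro!: derivative_eq_intros G_deriv)
    fix y assume y: "0 \<le> y" "y \<le> x"
    then have yD: "y \<le> 2 * \<delta> - 1" using x by simp
    have "(h y)\<^sup>2 \<le> (M * exp (- k * \<bar>y\<bar>))\<^sup>2" using h_le[of y] h_pos[of y] by (intro power_mono) auto
    also have "\<dots> = M\<^sup>2 * exp (- (2 * k * y))" using y by (simp add: power_mult_distrib flip: exp_double)
    finally have h2: "(h y)\<^sup>2 * exp (2 * k * y) \<le> M\<^sup>2" by (simp add: exp_minus field_simps)
    have "E * (h y)\<^sup>2 * (1 - C y) \<le> E * (h y)\<^sup>2 * (E\<^sup>2 * c1 * exp (2 * k * y))"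
      using C_ge'[OF y(1) yD] E by (intro mult_left_mono) auto
    also have "\<dots> = E * (E\<^sup>2 * c1 * ((h y)\<^sup>2 * exp (2 * k * y)))" by simp
    also have "\<dots> \<le> a" unfolding a_def using h2 E consts_pos(1) by (intro mult_left_mono) auto
    finally show "E * (h y)\<^sup>2 - a \<le> E * (e y)\<^sup>2 * C y" using e_left[OF y(1) yD] by (simp add: algebra_simps)
  qed
  then show ?thesis by (simp add: Q_0 a_def algebra_simps)
qed

text \<open>The rescaled eigenvalue, which tends to \<open>\<surd>2 / N\<close>.\<close>

definition y :: real where "y = E / g"

lemma y: "0 < y" "y \<le> c2" "E = y * g"
  using E_le g_pos E by (auto simp: y_def field_simps)

text \<open>The total drop of \<open>C\<close> equals \<open>1\<close>.  The part on \<open>[0, 1]\<close> is of order \<open>E\<^sup>2\<close>, and the rest is at most the upper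
  bound for \<open>C 1\<close>.\<close>

lemma y_lower: "1 \<le> y\<^sup>2 * (N\<^sup>2 / 2) + c4 * g"
proof -
  have M: "M > 0" using M_ge_1 by simp
  have GN: "N / 2 - G (1 - 2 * \<delta>) \<le> N" using G_odd[of "2 * \<delta> - 1"] G_le[of "2 * \<delta> - 1"] by simp
  have "1 = (1 - C 1) + C 1" by simp
  also have "\<dots> \<le> E\<^sup>2 * c1 * exp (2 * k) + E * Q (2 * \<delta> + 1) / g\<^sup>2 * (1 + E\<^sup>2 / k\<^sup>2) * (N / 2 - G (1 - 2 * \<delta>))"
    using C_ge'[of 1] C_upper[of 1] d1 by (intro add_mono) auto
  also have "\<dots> \<le> E\<^sup>2 * c1 * exp (2 * k) + E * (E * (N / 2 + c3 * g\<^sup>2)) / g\<^sup>2 * (1 + E\<^sup>2 / k\<^sup>2) * N"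
    using Q_upper[of "2 * \<delta> + 1"] GN d1 E Q_nonneg[of "2 * \<delta> + 1"] G_le[of "1 - 2 * \<delta>"] consts_pos N_pos
    by (intro add_left_mono mult_mono divide_right_mono mult_left_mono mult_nonneg_nonneg divide_nonneg_nonneg) auto
  also have "\<dots> = y\<^sup>2 * (N\<^sup>2 / 2) + (y\<^sup>2 * g) * g * (c1 * exp (2 * k) + c3 * N + (N / 2 + c3 * g\<^sup>2) * (y\<^sup>2 / k\<^sup>2) * N)"
  proof -
    have e1: "E * (E * (N / 2 + c3 * g\<^sup>2)) / g\<^sup>2 = y\<^sup>2 * (N / 2 + c3 * g\<^sup>2)"
      using g_pos by (simp add: y_def power_divide power2_eq_square)
    have e2: "E\<^sup>2 = (y * g)\<^sup>2" "E\<^sup>2 / k\<^sup>2 = (y\<^sup>2 / k\<^sup>2) * g\<^sup>2"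
      using g_pos by (simp_all add: y_def power_divide)
    have id: "(v * g)\<^sup>2 * a * b + v\<^sup>2 * (N / 2 + c * g\<^sup>2) * (1 + z * g\<^sup>2) * N
      = v\<^sup>2 * (N\<^sup>2 / 2) + (v\<^sup>2 * g) * g * (a * b + c * N + (N / 2 + c * g\<^sup>2) * z * N)" for v a b c z :: real
      by (simp add: field_simps power2_eq_square)
    show ?thesis unfolding e1 e2(2) by (simp only: e2(1) id)
  qed
  also have "\<dots> \<le> y\<^sup>2 * (N\<^sup>2 / 2) + (c2\<^sup>2 * M\<^sup>2) * g * (c1 * exp (2 * k) + c3 * N + (N / 2 + c3 * M ^ 4) * (c2\<^sup>2 / k\<^sup>2) * N)"
  proof -
    have g4: "g\<^sup>2 \<le> M ^ 4" using power_mono[OF g_le, of 2] g_pos by (simp flip: power_mult)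
    have y2: "y\<^sup>2 \<le> c2\<^sup>2" using y by (intro power_mono) auto
    have s1: "N / 2 + c3 * g\<^sup>2 \<le> N / 2 + c3 * M ^ 4" using g4 consts_pos by simp
    have s2: "y\<^sup>2 / k\<^sup>2 \<le> c2\<^sup>2 / k\<^sup>2" using y2 by (intro divide_right_mono) auto
    have n1: "0 \<le> N / 2 + c3 * M ^ 4" using N_pos consts_pos by simp
    have s3: "(N / 2 + c3 * g\<^sup>2) * (y\<^sup>2 / k\<^sup>2) * N \<le> (N / 2 + c3 * M ^ 4) * (c2\<^sup>2 / k\<^sup>2) * N"
      by (rule mult_right_mono[OF mult_mono[OF s1 s2 n1]]) (use N_pos in auto)
    have s4: "(y\<^sup>2 * g) * g \<le> (c2\<^sup>2 * M\<^sup>2) * g"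
      by (rule mult_right_mono[OF mult_mono[OF y2 g_le]]) (use g_pos in auto)
    have n2: "0 \<le> (N / 2 + c3 * g\<^sup>2) * (y\<^sup>2 / k\<^sup>2) * N"
      using N_pos consts_pos by (intro mult_nonneg_nonneg add_nonneg_nonneg) auto
    have n3: "0 \<le> c1 * exp (2 * k) + c3 * N" using N_pos consts_pos by (intro add_nonneg_nonneg) auto
    show ?thesis
      by (rule add_left_mono[OF mult_mono[OF s4 add_left_mono[OF s3]]]) (use n2 n3 g_pos in auto)
  qed
  also have "\<dots> = y\<^sup>2 * (N\<^sup>2 / 2) + c4 * g" by (simp add: c4_def)
  finally show ?thesis .
qed

lemma E2_delta: "E\<^sup>2 * \<delta> \<le> c2\<^sup>2 * M\<^sup>2 / (2 * k) * g"
proof -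
  have "E\<^sup>2 * \<delta> \<le> c2\<^sup>2 * g\<^sup>2 * \<delta>" using E2_le d1 by (intro mult_right_mono) auto
  also have "\<dots> = c2\<^sup>2 * g * (g * \<delta>)" by (simp add: power2_eq_square)
  also have "\<dots> \<le> c2\<^sup>2 * g * (M\<^sup>2 / (2 * k))" using g_delta g_pos by (intro mult_left_mono) auto
  finally show ?thesis by (simp add: mult_ac)
qed

text \<open>The matching bound looks at the midpoint \<open>\<delta>\<close>: there \<open>Q\<close> has reached \<open>E N / 2\<close> up to a relative error of order \<open>g\<close>,
  and the profile beyond \<open>\<delta>\<close> carries the mass \<open>N\<close> up to an error of the same order.\<close>

lemma y_upper: "y\<^sup>2 * (N\<^sup>2 / 2) \<le> 1 + c7 * g"
proof -
  have q: "E * (N / 2 - c6 * g) \<le> Q \<delta>"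
  proof -
    have "E\<^sup>2 * c1 * M\<^sup>2 * \<delta> = c1 * M\<^sup>2 * (E\<^sup>2 * \<delta>)" by simp
    also have "\<dots> \<le> c1 * M\<^sup>2 * (c2\<^sup>2 * M\<^sup>2 / (2 * k) * g)" using E2_delta consts_pos(1) by (intro mult_left_mono) auto
    also have "\<dots> = c2\<^sup>2 * c1 * M ^ 4 / (2 * k) * g" by (simp add: power2_eq_square power4_eq_xxxx)
    finally have 1: "E\<^sup>2 * c1 * M\<^sup>2 * \<delta> \<le> c2\<^sup>2 * c1 * M ^ 4 / (2 * k) * g" .
    have "c6 * g = g / (2 * k) + c2\<^sup>2 * c1 * M ^ 4 / (2 * k) * g" by (simp add: c6_def distrib_right)
    then have "N / 2 - c6 * g \<le> G \<delta> - E\<^sup>2 * c1 * M\<^sup>2 * \<delta>" using 1 G_right[of \<delta>] d1 by (simp add: g_def)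
    then have "E * (N / 2 - c6 * g) \<le> E * (G \<delta> - E\<^sup>2 * c1 * M\<^sup>2 * \<delta>)" using E by (intro mult_left_mono) auto
    then show ?thesis using Q_lower[of \<delta>] d1 by simp
  qed
  have GN: "N / 2 - G (\<delta> - 2 * \<delta>) = N - g / (2 * k)"
    using G_odd[of \<delta>] G_right[of \<delta>] d1 by (simp add: g_def)
  have "E / g\<^sup>2 * (N * (E * (N / 2 - c6 * g)) - E * (N / 2) * (g / (2 * k))) \<le> E / g\<^sup>2 * (N * Q \<delta> - Q \<delta> * (g / (2 * k)))"
    using q Q_le[of \<delta>] d1 E N_pos g_pos k0 by (intro mult_left_mono diff_mono mult_right_mono) auto
  also have "\<dots> = E * Q \<delta> / g\<^sup>2 * (N / 2 - G (\<delta> - 2 * \<delta>))" 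
  proof -
    have "N * Q \<delta> - Q \<delta> * (g / (2 * k)) = Q \<delta> * (N - g / (2 * k))" by (simp add: right_diff_distrib)
    then show ?thesis unfolding GN by simp
  qed
  also have "\<dots> \<le> 1" using C_lower[of \<delta>] C_le_1[of \<delta>] d1 by simp
  finally have "E / g\<^sup>2 * (N * (E * (N / 2 - c6 * g)) - E * (N / 2) * (g / (2 * k))) \<le> 1" .
  also have "E / g\<^sup>2 * (N * (E * (N / 2 - c6 * g)) - E * (N / 2) * (g / (2 * k))) = y\<^sup>2 * (N\<^sup>2 / 2) - y\<^sup>2 * (N * c6 + N / (4 * k)) * g"
  proof -
    have "E / g\<^sup>2 * (N * (E * (N / 2 - c6 * g)) - E * (N / 2) * (g / (2 * k))) = (E * E / g\<^sup>2) * (N * (N / 2 - c6 * g) - (N / 2) * (g / (2 * k)))"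
      by (simp add: algebra_simps)
    also have "E * E / g\<^sup>2 = y\<^sup>2" by (simp add: y_def power2_eq_square)
    finally show ?thesis using k0 by (simp add: algebra_simps power2_eq_square)
  qed
  finally have "y\<^sup>2 * (N\<^sup>2 / 2) \<le> 1 + y\<^sup>2 * (N * c6 + N / (4 * k)) * g" by simp
  also have "\<dots> \<le> 1 + c2\<^sup>2 * (N * c6 + N / (4 * k)) * g"
    using y consts_pos N_pos k0 g_pos by (intro add_left_mono mult_right_mono power_mono) auto
  finally show ?thesis by (simp add: c7_def)
qed

lemma y_error: "\<bar>y - sqrt 2 / N\<bar> \<le> c9 * g"
proof -
  define r where "r = sqrt 2 / N"
  have r: "r > 0" "r\<^sup>2 = 2 / N\<^sup>2" using N_pos by (auto simp: r_def power_divide)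
  have cg: "0 \<le> c4 * g" "0 \<le> c7 * g" using consts_pos g_pos by auto
  have "\<bar>y\<^sup>2 * (N\<^sup>2 / 2) - 1\<bar> \<le> (c4 + c7) * g"
    using y_lower y_upper cg unfolding distrib_right abs_le_iff by linarith
  then have "2 / N\<^sup>2 * \<bar>y\<^sup>2 * (N\<^sup>2 / 2) - 1\<bar> \<le> 2 / N\<^sup>2 * ((c4 + c7) * g)" by (intro mult_left_mono) auto
  moreover have "2 / N\<^sup>2 * \<bar>y\<^sup>2 * (N\<^sup>2 / 2) - 1\<bar> = \<bar>y - r\<bar> * (y + r)"
  proof -
    have "2 / N\<^sup>2 * \<bar>y\<^sup>2 * (N\<^sup>2 / 2) - 1\<bar> = \<bar>2 / N\<^sup>2 * (y\<^sup>2 * (N\<^sup>2 / 2) - 1)\<bar>"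
    proof -
      have "0 \<le> 2 / N\<^sup>2" by simp
      then show ?thesis by (simp only: abs_mult abs_of_nonneg)
    qed
    also have "2 / N\<^sup>2 * (y\<^sup>2 * (N\<^sup>2 / 2) - 1) = y\<^sup>2 - r\<^sup>2" using N_pos by (simp add: r field_simps)
    also have "\<bar>y\<^sup>2 - r\<^sup>2\<bar> = \<bar>(y - r) * (y + r)\<bar>" by (simp add: power2_eq_square algebra_simps)
    finally show ?thesis using y r by (simp add: abs_mult)
  qed
  moreover have "\<bar>y - r\<bar> * r \<le> \<bar>y - r\<bar> * (y + r)" using y by (intro mult_left_mono) auto
  ultimately have "\<bar>y - r\<bar> * r \<le> 2 / N\<^sup>2 * ((c4 + c7) * g)" by linarith
  then have "\<bar>y - r\<bar> \<le> 2 / N\<^sup>2 * ((c4 + c7) * g) / r" by (simp only: pos_le_divide_eq[OF r(1)])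
  moreover have "2 / a * (b * z) / s = 2 * b / (a * s) * z" for a b z s :: real by simp
  ultimately show ?thesis by (simp only: r_def c9_def)
qed

lemma E_error: "\<bar>E - sqrt 2 / N * g\<bar> \<le> c9 * g\<^sup>2"
proof -
  have "E - sqrt 2 / N * g = (y - sqrt 2 / N) * g" using g_pos by (simp add: y_def left_diff_distrib)
  then show ?thesis using mult_right_mono[OF y_error, of g] g_pos by (simp add: abs_mult power2_eq_square)
qed

end

section \<open>Asymptotics of the eigenfunction\<close>

context domain_wall
begin

text \<open>Further constants: the errors of the two components are \<open>a1\<close> and \<open>a2\<close> times \<open>eps\<close> times exponentials of
  rates \<open>w0\<close> and \<open>w1\<close>.  Here \<open>w0\<close> is the decay rate at energy \<open>K\<close>, the smallest possible one, and half of it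
  is given away in \<open>w1\<close> to absorb a factor growing linearly in \<open>x\<close>.\<close>

definition a1 :: real where "a1 = M ^ 5 * c1 * c2\<^sup>2 + M ^ 3 * exp (2 * k)"
definition b1 :: real where "b1 = c3 * M ^ 4 + c1 * M\<^sup>2 * (c2\<^sup>2 * M ^ 4 / k) + M\<^sup>2 * exp (2 * k) / (2 * k)"
definition b2 :: real where "b2 = c2 * M ^ 3 / (2 * k) + c2 * b1 * M + N / 2 * c9 * M ^ 3"
definition w0 :: "real \<Rightarrow> real" where "w0 K = sqrt (k\<^sup>2 - K\<^sup>2)"
definition w1 :: "real \<Rightarrow> real" where "w1 K = w0 K / 2"
definition a2 :: "real \<Rightarrow> real" where
  "a2 K = (c2 * M ^ 3 * (N / 2) + M) * exp (2 * k) + b2 + (2 * b2 + M * (c2\<^sup>2 * M ^ 4 / (k * w1 K))) * exp k"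

lemma consts_nonneg: "a1 \<ge> 0" "b1 \<ge> 0" "c9 \<ge> 0" "b2 \<ge> 0"
proof -
  have M: "M \<ge> 0" using M_ge_1 by simp
  have c: "c1 \<ge> 0" "c2 \<ge> 0" "c3 \<ge> 0" "c4 \<ge> 0" "c7 \<ge> 0" using consts_pos by auto
  show "a1 \<ge> 0" using c M by (simp add: a1_def)
  show b: "b1 \<ge> 0" using c M k0 by (simp add: b1_def)
  show c9: "c9 \<ge> 0" using c N_pos by (simp add: c9_def)
  show "b2 \<ge> 0" using c M k0 N_pos b c9 by (simp add: b2_def)
qed

end

context three_wall_profile
begin

abbreviation \<omega> :: real where "\<omega> \<equiv> sqrt (k\<^sup>2 - E\<^sup>2)"

lemma rates: "0 < w0 K" "w0 K \<le> \<omega>" "\<omega> \<le> k" "k - \<omega> \<le> E\<^sup>2 / k" "0 < w1 K" "w1 K \<le> w0 K" "w1 K \<le> k"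
proof -
  have KE: "E\<^sup>2 \<le> K\<^sup>2" "K\<^sup>2 < k\<^sup>2" using E K by (auto intro: power_mono power_strict_mono)
  show w0: "0 < w0 K" using KE by (simp add: w0_def)
  show le: "w0 K \<le> \<omega>" using KE by (simp add: w0_def)
  show \<omega>k: "\<omega> \<le> k" using real_sqrt_le_mono[of "k\<^sup>2 - E\<^sup>2" "k\<^sup>2"] k0 by simp
  have "\<omega>\<^sup>2 = k\<^sup>2 - E\<^sup>2" using KE by simp
  then have "(k - \<omega>) * (k + \<omega>) = E\<^sup>2" by (simp add: power2_eq_square algebra_simps)
  moreover have "(k - \<omega>) * k \<le> (k - \<omega>) * (k + \<omega>)" using \<omega>k KE by (intro mult_left_mono) auto
  ultimately show "k - \<omega> \<le> E\<^sup>2 / k" using k0 by (simp add: pos_le_divide_eq)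
  show "0 < w1 K" "w1 K \<le> w0 K" using w0 by (auto simp: w1_def)
  then show "w1 K \<le> k" using le \<omega>k by linarith
qed

lemma eps_exp: "eps * exp (k * x) = exp (- k * (2 * \<delta> - x))"
  by (simp add: eps_def algebra_simps flip: exp_add)

lemma g2_eps: "g\<^sup>2 \<le> M ^ 4 * eps\<^sup>2"
  using power_mono[OF g_eps(1), of 2] g_pos by (simp add: power_mult_distrib flip: power_mult)

lemma eps2: "eps\<^sup>2 \<le> eps" using eps by (simp add: power2_eq_square)

lemma E2_eps: "E\<^sup>2 \<le> c2\<^sup>2 * M ^ 4 * eps\<^sup>2"
  using order_trans[OF E2_le mult_left_mono[OF g2_eps, of "c2\<^sup>2"]] by (simp add: mult.assoc)

lemma exp_le_u: "w \<le> k \<Longrightarrow> 0 \<le> w \<Longrightarrow> x \<le> 2 * \<delta> \<Longrightarrow> exp (- k * (2 * \<delta> - x)) \<le> exp (- w * \<bar>x - 2 * \<delta>\<bar>)"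
  using mult_right_mono[of w k "2 * \<delta> - x"] by simp

lemma h_tail: assumes "2 * \<delta> - 1 \<le> x" shows "h x \<le> M * exp k * (exp (- k * (x - 2 * \<delta> + 1)) * eps)"
proof -
  have "h x \<le> M * exp (- k * x)" using h_le[of x] assms d1 by simp
  also have "exp (- k * x) = exp k * (exp (- k * (x - 2 * \<delta> + 1)) * eps)"
    by (simp add: eps_def algebra_simps flip: exp_add)
  finally show ?thesis by (simp add: mult.assoc)
qed

lemma c_middle: assumes "2 * \<delta> - 1 \<le> x" "x \<le> 2 * \<delta> + 1" shows "c x \<le> M ^ 3 * exp k * eps"
proof -
  have "c x = (g * (1 / h (x - 2 * \<delta>))) * C x"
    using e_right[of x] g_pos h_pos[of "x - 2 * \<delta>"] assms d1 by (simp add: C_def)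
  also have "\<dots> \<le> (g * (M * exp k)) * 1"
  proof (intro mult_mono)
    have "1 / h (x - 2 * \<delta>) \<le> M * exp (k * \<bar>x - 2 * \<delta>\<bar>)" by (rule inverse_h_le)
    also have "\<dots> \<le> M * exp k"
      using k0 M_ge_1 assms mult_left_mono[of "\<bar>x - 2 * \<delta>\<bar>" 1 k] by (intro mult_left_mono) auto
    finally show "1 / h (x - 2 * \<delta>) \<le> M * exp k" .
  qed (use g_pos C_le_1[of x] C_nonneg[of x] assms d1 h_pos[of "x - 2 * \<delta>"] M_ge_1 in \<open>auto intro: order_trans[OF _ C_nonneg]\<close>)
  also have "\<dots> \<le> M\<^sup>2 * eps * (M * exp k)" using g_eps(1) M_ge_1 by (simp add: mult_right_mono)
  also have "\<dots> = M ^ 3 * exp k * eps" by (simp add: power2_eq_square power3_eq_cube)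
  finally show ?thesis .
qed

text \<open>Up to the right wall \<open>\<bar>c - h\<bar> = h (1 - C)\<close> grows like \<open>eps\<^sup>2 exp (k x)\<close>, which is \<open>eps exp (- k (2\<delta> - x))\<close>.
  From there on both functions are of size \<open>eps\<close> themselves and decay.\<close>

lemma c_error:
  assumes x: "0 \<le> x"
  shows "\<bar>c x - h x\<bar> \<le> a1 * eps * exp (- w0 K * \<bar>x - 2 * \<delta>\<bar>)"
proof -
  have M: "M > 0" using M_ge_1 by simp
  have e0: "0 \<le> eps * exp (- w0 K * \<bar>x - 2 * \<delta>\<bar>)" using eps by simp
  note w = rates
  have fin: ?thesis if "\<bar>c x - h x\<bar> \<le> a * (eps * exp (- w0 K * \<bar>x - 2 * \<delta>\<bar>))" "a \<le> a1" for a
    using that mult_right_mono[OF that(2) e0] by (simp add: mult.assoc)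
  have part: "M ^ 5 * c1 * c2\<^sup>2 \<le> a1" "M ^ 3 * exp (2 * k) \<le> a1"
    using M consts_pos by (simp_all add: a1_def)
  consider "x \<le> 2 * \<delta> - 1" | "2 * \<delta> - 1 \<le> x" "x \<le> 2 * \<delta> + 1" | "2 * \<delta> + 1 \<le> x" by linarith
  then show ?thesis
  proof cases
    case 1
    have eq: "c x = h x * C x" using e_left[OF x 1] h_pos[of x] by (simp add: C_def)
    have "c x - h x = - (h x * (1 - C x))" unfolding eq by (simp add: algebra_simps)
    then have "\<bar>c x - h x\<bar> = h x * (1 - C x)" using h_pos[of x] C_le_1[OF x] by (simp add: abs_mult)
    also have "\<dots> \<le> (M * exp (- k * \<bar>x\<bar>)) * (E\<^sup>2 * c1 * exp (2 * k * x))"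
      using h_le[of x] C_ge'[OF x 1] C_le_1[OF x] M by (intro mult_mono) auto
    also have "\<dots> = M * c1 * exp (k * x) * E\<^sup>2"
    proof -
      have "exp (- k * \<bar>x\<bar>) * exp (2 * k * x) = exp (k * x)" using x by (simp flip: exp_add)
      then show ?thesis by (simp add: mult_ac)
    qed
    also have "\<dots> \<le> M * c1 * exp (k * x) * (c2\<^sup>2 * M ^ 4 * eps\<^sup>2)"
      using E2_eps M consts_pos by (intro mult_left_mono) auto
    also have "\<dots> = M ^ 5 * c1 * c2\<^sup>2 * (eps * (eps * exp (k * x)))"
      by (simp add: power2_eq_square eval_nat_numeral)
    also have "\<dots> \<le> M ^ 5 * c1 * c2\<^sup>2 * (eps * exp (- w0 K * \<bar>x - 2 * \<delta>\<bar>))"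
      unfolding eps_exp using exp_le_u[of "w0 K" x] w 1 M consts_pos eps by (intro mult_left_mono) auto
    finally show ?thesis by (rule fin) (rule part)
  next
    case 2
    have hx: "h x \<le> M ^ 3 * exp k * eps"
    proof -
      have "exp (- k * (x - 2 * \<delta> + 1)) \<le> 1" using k0 2 by (simp add: mult_nonneg_nonneg)
      then have "M * exp k * (exp (- k * (x - 2 * \<delta> + 1)) * eps) \<le> M * exp k * (1 * eps)"
        using M eps by (intro mult_left_mono mult_right_mono) auto
      also have "\<dots> \<le> M ^ 3 * exp k * eps"
        using M_ge_1 eps power_increasing[of 1 3 M] by (simp add: mult_right_mono)
      finally show ?thesis using h_tail[OF 2(1)] by linarith
    qed
    have "\<bar>c x - h x\<bar> \<le> M ^ 3 * exp k * eps"
      using hx c_middle[OF 2] h_pos[of x] c_nonneg[OF x] by linarith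
    also have "\<dots> \<le> M ^ 3 * exp k * eps * (exp k * exp (- w0 K * \<bar>x - 2 * \<delta>\<bar>))"
    proof -
      have "w0 K * \<bar>x - 2 * \<delta>\<bar> \<le> k * 1" using w 2 k0 by (intro mult_mono) auto
      then have "1 \<le> exp k * exp (- w0 K * \<bar>x - 2 * \<delta>\<bar>)" by (simp flip: exp_add)
      from mult_left_mono[OF this, of "M ^ 3 * exp k * eps"] show ?thesis using M eps by simp
    qed
    also have "\<dots> = M ^ 3 * exp (2 * k) * (eps * exp (- w0 K * \<bar>x - 2 * \<delta>\<bar>))"
      by (simp add: exp_double power2_eq_square)
    finally show ?thesis by (rule fin) (rule part)
  next
    case 3
    let ?t = "x - (2 * \<delta> + 1)"
    have u: "exp k * exp (- w0 K * \<bar>x - 2 * \<delta>\<bar>) \<ge> exp (- w0 K * ?t)"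
      using w 3 by (simp add: algebra_simps flip: exp_add)
    have "c x = c (2 * \<delta> + 1) * exp (- \<omega> * ?t)" by (rule c_tail[OF 3])
    also have "\<dots> \<le> (M ^ 3 * exp k * eps) * exp (- w0 K * ?t)"
      using c_middle[of "2 * \<delta> + 1"] c_nonneg[of "2 * \<delta> + 1"] d1 w 3 M eps mult_right_mono[OF w(2), of ?t]
      by (intro mult_mono) auto
    also have "\<dots> \<le> (M ^ 3 * exp k * eps) * (exp k * exp (- w0 K * \<bar>x - 2 * \<delta>\<bar>))"
      using u M eps by (intro mult_left_mono) auto
    finally have cx: "c x \<le> (M ^ 3 * exp k * eps) * (exp k * exp (- w0 K * \<bar>x - 2 * \<delta>\<bar>))" .
    have "h x \<le> M * exp k * (exp (- k * (x - 2 * \<delta> + 1)) * eps)" by (rule h_tail) (use 3 in simp)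
    also have "\<dots> \<le> M ^ 3 * exp k * (exp (- w0 K * \<bar>x - 2 * \<delta>\<bar>) * eps)"
    proof -
      have "w0 K * (x - 2 * \<delta>) \<le> k * (x - 2 * \<delta> + 1)" using w 3 k0 by (intro mult_mono) auto
      then have "exp (- k * (x - 2 * \<delta> + 1)) \<le> exp (- w0 K * \<bar>x - 2 * \<delta>\<bar>)" using 3 by simp
      moreover have "M \<le> M ^ 3" using M_ge_1 power_increasing[of 1 3 M] by simp
      ultimately show ?thesis using M eps by (intro mult_mono) auto
    qed
    also have "\<dots> \<le> (M ^ 3 * exp k * eps) * (exp k * exp (- w0 K * \<bar>x - 2 * \<delta>\<bar>))"
    proof -
      have "1 \<le> exp k" using k0 by simp
      from mult_right_mono[OF this, of "M ^ 3 * exp k * eps * exp (- w0 K * \<bar>x - 2 * \<delta>\<bar>)"]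
      show ?thesis using M eps by (simp add: mult_ac)
    qed
    finally have "\<bar>c x - h x\<bar> \<le> (M ^ 3 * exp k * eps) * (exp k * exp (- w0 K * \<bar>x - 2 * \<delta>\<bar>))"
      using cx h_pos[of x] c_nonneg[OF x] by linarith
    also have "\<dots> = M ^ 3 * exp (2 * k) * (eps * exp (- w0 K * \<bar>x - 2 * \<delta>\<bar>))"
      by (simp add: exp_double power2_eq_square)
    finally show ?thesis by (rule fin) (rule part)
  qed
qed

text \<open>Two errors enter: the part of the integral of \<open>h\<^sup>2\<close> not yet collected at \<open>x\<close>, which is of order
  \<open>exp (- 2 k x)\<close>, and the defect of \<open>C\<close>, whose accumulated effect is of order \<open>E\<^sup>2 \<delta>\<close> and thus below \<open>eps\<close>.\<close>

lemma Q_near: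
  assumes x: "1 \<le> x" "x \<le> 2 * \<delta> + 1"
  shows "\<bar>Q x - E * (N / 2)\<bar> \<le> E * (M\<^sup>2 * exp (- 2 * k * x) / (2 * k) + b1 * eps)"
proof -
  have M: "M > 0" using M_ge_1 by simp
  define t where "t = M\<^sup>2 * exp (- 2 * k * x) / (2 * k)"
  have t0: "t \<ge> 0" using k0 by (simp add: t_def)
  have p1: "c3 * g\<^sup>2 \<le> c3 * M ^ 4 * eps"
  proof -
    have "M ^ 4 * eps\<^sup>2 \<le> M ^ 4 * eps" using eps2 by (intro mult_left_mono) auto
    then have "g\<^sup>2 \<le> M ^ 4 * eps" using g2_eps by linarith
    from mult_left_mono[OF this, of c3] show ?thesis using consts_pos by simp
  qed
  have p2: "E\<^sup>2 * c1 * M\<^sup>2 * z \<le> c1 * M\<^sup>2 * (c2\<^sup>2 * M ^ 4 / k) * eps" if z: "0 \<le> z" "z \<le> 2 * \<delta>" for z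
  proof -
    have "E\<^sup>2 * z \<le> E\<^sup>2 * (2 * \<delta>)" using z by (intro mult_left_mono) auto
    also have "\<dots> \<le> 2 * (c2\<^sup>2 * M\<^sup>2 / (2 * k) * g)" using E2_delta by simp
    also have "\<dots> \<le> 2 * (c2\<^sup>2 * M\<^sup>2 / (2 * k) * (M\<^sup>2 * eps))" using g_eps k0 by (intro mult_left_mono) auto
    also have "\<dots> = c2\<^sup>2 * M ^ 4 / k * eps" by (simp add: eval_nat_numeral)
    finally have "c1 * M\<^sup>2 * (E\<^sup>2 * z) \<le> c1 * M\<^sup>2 * (c2\<^sup>2 * M ^ 4 / k * eps)" using consts_pos by (intro mult_left_mono) auto
    then show ?thesis by (simp add: mult_ac)
  qed
  have b: "b1 * eps = c3 * M ^ 4 * eps + c1 * M\<^sup>2 * (c2\<^sup>2 * M ^ 4 / k) * eps + M\<^sup>2 * exp (2 * k) / (2 * k) * eps"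
    by (simp add: b1_def distrib_right)
  have nn: "0 \<le> c3 * M ^ 4 * eps" "0 \<le> c1 * M\<^sup>2 * (c2\<^sup>2 * M ^ 4 / k) * eps" "0 \<le> M\<^sup>2 * exp (2 * k) / (2 * k) * eps"
    using consts_pos k0 eps M by auto
  have up: "Q x - E * (N / 2) \<le> E * (t + b1 * eps)"
  proof -
    have "Q x - E * (N / 2) \<le> E * (c3 * g\<^sup>2)" using Q_upper[of x] x by (simp add: distrib_left)
    also have "\<dots> \<le> E * (t + b1 * eps)" using p1 b nn t0 E by (intro mult_left_mono) auto
    finally show ?thesis .
  qed
  have h2: "(h z)\<^sup>2 \<le> M\<^sup>2 * exp (- 2 * k * z)" if "0 \<le> z" for z
  proof -
    have "(h z)\<^sup>2 \<le> (M * exp (- k * \<bar>z\<bar>))\<^sup>2" using h_le[of z] h_pos[of z] by (intro power_mono) auto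
    also have "\<dots> = M\<^sup>2 * exp (- 2 * k * z)" using that by (simp add: power_mult_distrib flip: exp_double)
    finally show ?thesis .
  qed
  have "E * (N / 2) - Q x \<le> E * (t + b1 * eps)"
  proof (cases "x \<le> 2 * \<delta> - 1")
    case True
    have "(h x)\<^sup>2 / (2 * k) \<le> t" unfolding t_def using h2[of x] x k0 by (intro divide_right_mono) auto
    then have "N / 2 - (t + b1 * eps) \<le> G x - E\<^sup>2 * c1 * M\<^sup>2 * x"
      using G_right[OF x(1)] p2[of x] x True nn b by simp
    then have "E * (N / 2 - (t + b1 * eps)) \<le> E * (G x - E\<^sup>2 * c1 * M\<^sup>2 * x)" using E by (intro mult_left_mono) auto
    then show ?thesis using Q_lower[of x] x True by (simp add: algebra_simps)
  next
    case False
    let ?D = "2 * \<delta> - 1"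
    have "(h ?D)\<^sup>2 / (2 * k) \<le> M\<^sup>2 * exp (2 * k) / (2 * k) * eps"
    proof -
      have "exp (- 2 * k * ?D) = exp (2 * k) * (eps * eps)" by (simp add: eps_def algebra_simps flip: exp_add)
      also have "\<dots> \<le> exp (2 * k) * (eps * 1)" using eps by (intro mult_left_mono) auto
      finally have "M\<^sup>2 * exp (- 2 * k * ?D) \<le> M\<^sup>2 * (exp (2 * k) * eps)" by (intro mult_left_mono) auto
      then have "(h ?D)\<^sup>2 \<le> M\<^sup>2 * (exp (2 * k) * eps)" using h2[of ?D] d1 by simp
      from divide_right_mono[OF this, of "2 * k"] show ?thesis using k0 by (simp add: mult_ac)
    qed
    then have "N / 2 - (t + b1 * eps) \<le> G ?D - E\<^sup>2 * c1 * M\<^sup>2 * ?D"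
      using G_right[of ?D] p2[of ?D] d1 nn b t0 by simp
    then have "E * (N / 2 - (t + b1 * eps)) \<le> E * (G ?D - E\<^sup>2 * c1 * M\<^sup>2 * ?D)" using E by (intro mult_left_mono) auto
    then show ?thesis using Q_lower[of ?D] Q_mono[of ?D x] False d1 by (simp add: algebra_simps)
  qed
  with up show ?thesis unfolding t_def[symmetric] by (simp add: abs_le_iff)
qed

definition u :: "real \<Rightarrow> real" where "u x = exp (- w1 K * \<bar>x - 2 * \<delta>\<bar>)"
definition v :: "real \<Rightarrow> real" where "v x = exp (- w1 K * x)"

lemma p_middle:
  assumes x: "1 \<le> x" "x \<le> 2 * \<delta> + 1"
  shows "\<bar>p x - h (x - 2 * \<delta>) / sqrt 2\<bar> \<le> b2 * eps * (u x + v x)"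
proof -
  have M: "M > 0" using M_ge_1 by simp
  note w = rates
  define H where "H = h (x - 2 * \<delta>)"
  have H0: "H > 0" by (simp add: H_def h_pos)
  have He: "H \<le> M * exp (- k * \<bar>x - 2 * \<delta>\<bar>)" unfolding H_def by (rule h_le)
  have "exp (- k * \<bar>x - 2 * \<delta>\<bar>) \<le> u x" unfolding u_def using mult_right_mono[OF w(7), of "\<bar>x - 2 * \<delta>\<bar>"] by simp
  then have Hu: "H \<le> M * u x" using He M mult_left_mono[of "exp (- k * \<bar>x - 2 * \<delta>\<bar>)" "u x" M] by linarith
  have Hv: "H * exp (- 2 * k * x) \<le> M * eps * v x"
  proof -
    have "H * exp (- 2 * k * x) \<le> M * exp (- k * \<bar>x - 2 * \<delta>\<bar>) * exp (- 2 * k * x)" using He by (intro mult_right_mono) auto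
    also have "\<dots> \<le> M * exp (- k * (2 * \<delta> - x)) * exp (- 2 * k * x)"
      using M k0 mult_left_mono[of "2 * \<delta> - x" "\<bar>x - 2 * \<delta>\<bar>" k] by (intro mult_right_mono mult_left_mono) auto
    also have "\<dots> = M * eps * exp (- k * x)" by (simp add: eps_def algebra_simps flip: exp_add)
    also have "\<dots> \<le> M * eps * v x"
      unfolding v_def using M eps x w(7) by (intro mult_left_mono) (auto intro: mult_right_mono)
    finally show ?thesis .
  qed
  have px: "p x = H * (Q x / g)"
    using e_right[OF x(1)] g_pos H0 by (simp add: Q_def H_def)
  define T where "T = M\<^sup>2 * exp (- 2 * k * x) / (2 * k) + b1 * eps"
  have s: "1 / sqrt 2 = N / 2 * (sqrt 2 / N)" using N_pos by (simp add: real_div_sqrt)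
  have "Q x / g - 1 / sqrt 2 = (Q x - E * (N / 2)) / g + N / 2 * (y - sqrt 2 / N)"
    unfolding s y_def by (simp only: diff_divide_distrib right_diff_distrib) simp
  then have "\<bar>Q x / g - 1 / sqrt 2\<bar> \<le> \<bar>(Q x - E * (N / 2)) / g\<bar> + \<bar>N / 2 * (y - sqrt 2 / N)\<bar>"
    by (simp only: abs_triangle_ineq)
  also have "\<dots> \<le> E * T / g + N / 2 * (c9 * g)"
  proof (rule add_mono)
    show "\<bar>(Q x - E * (N / 2)) / g\<bar> \<le> E * T / g"
      using divide_right_mono[OF Q_near[OF x], of g] g_pos by (simp add: abs_divide T_def)
    show "\<bar>N / 2 * (y - sqrt 2 / N)\<bar> \<le> N / 2 * (c9 * g)"
      using mult_left_mono[OF y_error, of "N / 2"] N_pos by (simp add: abs_mult)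
  qed
  also have "E * T / g = y * T" by (simp add: y_def)
  also have "y * T \<le> c2 * T"
    using y k0 consts_nonneg eps by (intro mult_right_mono) (auto simp: T_def)
  finally have q: "\<bar>Q x / g - 1 / sqrt 2\<bar> \<le> c2 * T + N / 2 * (c9 * g)" by simp
  have "\<bar>p x - H / sqrt 2\<bar> = H * \<bar>Q x / g - 1 / sqrt 2\<bar>"
  proof -
    have "p x - H / sqrt 2 = H * (Q x / g - 1 / sqrt 2)" by (simp add: px right_diff_distrib)
    then show ?thesis using H0 by (simp add: abs_mult)
  qed
  also have "\<dots> \<le> H * (c2 * T + N / 2 * (c9 * g))" using q H0 by (intro mult_left_mono) auto
  also have "\<dots> = c2 * M\<^sup>2 / (2 * k) * (H * exp (- 2 * k * x)) + c2 * b1 * eps * H + N / 2 * c9 * g * H"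
    by (simp add: T_def algebra_simps)
  also have "\<dots> \<le> c2 * M\<^sup>2 / (2 * k) * (M * eps * v x) + c2 * b1 * eps * (M * u x) + N / 2 * c9 * (M\<^sup>2 * eps) * (M * u x)"
  proof (intro add_mono)
    show "c2 * M\<^sup>2 / (2 * k) * (H * exp (- 2 * k * x)) \<le> c2 * M\<^sup>2 / (2 * k) * (M * eps * v x)"
      by (rule mult_left_mono[OF Hv]) (use consts_pos k0 in auto)
    show "c2 * b1 * eps * H \<le> c2 * b1 * eps * (M * u x)"
      by (rule mult_left_mono[OF Hu]) (use consts_pos consts_nonneg eps in auto)
    have "N / 2 * c9 * g \<le> N / 2 * c9 * (M\<^sup>2 * eps)"
      by (rule mult_left_mono[OF g_eps(1)]) (use N_pos consts_nonneg in auto)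
    then show "N / 2 * c9 * g * H \<le> N / 2 * c9 * (M\<^sup>2 * eps) * (M * u x)"
      by (rule mult_mono[OF _ Hu]) (use N_pos consts_nonneg H0 eps in auto)
  qed
  also have "\<dots> = c2 * M ^ 3 / (2 * k) * eps * v x + (c2 * b1 * M + N / 2 * c9 * M ^ 3) * eps * u x"
    by (simp add: algebra_simps eval_nat_numeral)
  also have "\<dots> \<le> b2 * eps * v x + b2 * eps * u x"
  proof -
    have "0 \<le> c2 * M ^ 3 / (2 * k)" "0 \<le> c2 * b1 * M + N / 2 * c9 * M ^ 3"
      using consts_pos consts_nonneg M k0 N_pos by auto
    then show ?thesis
      using eps by (intro add_mono mult_right_mono) (auto simp: b2_def u_def v_def)
  qed
  finally show ?thesis by (simp add: H_def algebra_simps)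
qed

text \<open>Left of \<open>1\<close> both functions are of size \<open>eps\<close>.  In the tail \<open>p\<close> decays with rate \<open>sqrt (k\<^sup>2 - E\<^sup>2)\<close> and the
  profile with rate \<open>k\<close>; the rates differ by at most \<open>E\<^sup>2 / k\<close>.\<close>

lemma p_error:
  assumes x: "0 \<le> x"
  shows "\<bar>p x - h (x - 2 * \<delta>) / sqrt 2\<bar> \<le> a2 K * eps * (u x + v x)"
proof -
  have M: "M > 0" using M_ge_1 by simp
  note w = rates
  have uv: "u x > 0" "v x > 0" by (simp_all add: u_def v_def)
  define A1 where "A1 = (c2 * M ^ 3 * (N / 2) + M) * exp (2 * k)"
  define A3 where "A3 = (2 * b2 + M * (c2\<^sup>2 * M ^ 4 / (k * w1 K))) * exp k"
  have a: "a2 K = A1 + b2 + A3" "A1 \<ge> 0" "A3 \<ge> 0"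
    using consts_pos consts_nonneg M N_pos k0 w by (auto simp: a2_def A1_def A3_def)
  have fin: ?thesis if "\<bar>p x - h (x - 2 * \<delta>) / sqrt 2\<bar> \<le> b * eps * (u x + v x)" "b \<le> a2 K" for b
  proof -
    have "b * (eps * (u x + v x)) \<le> a2 K * (eps * (u x + v x))"
      using that(2) eps uv by (intro mult_right_mono) auto
    then show ?thesis using that(1) by (simp add: mult.assoc)
  qed
  consider "x \<le> 1" | "1 \<le> x" "x \<le> 2 * \<delta> + 1" | "2 * \<delta> + 1 \<le> x" by linarith
  then show ?thesis
  proof cases
    case 1
    have px: "p x = Q x * (1 / h x)" using e_left[of x] x 1 d1 h_pos[of x] by (simp add: Q_def)
    have "p x \<le> (c2 * (M\<^sup>2 * eps) * (N / 2)) * (M * exp k)"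
      unfolding px
    proof (rule mult_mono)
      have "Q x \<le> E * (N / 2)" using Q_le[of x] x 1 d1 by simp
      also have "\<dots> \<le> c2 * (M\<^sup>2 * eps) * (N / 2)"
        by (rule mult_right_mono[OF order_trans[OF E_le mult_left_mono[OF g_eps(1)]]])
          (use consts_pos N_pos in auto)
      finally show "Q x \<le> c2 * (M\<^sup>2 * eps) * (N / 2)" .
      have "1 / h x \<le> M * exp (k * \<bar>x\<bar>)" by (rule inverse_h_le)
      also have "\<dots> \<le> M * exp k" using M k0 x 1 by (intro mult_left_mono) auto
      finally show "1 / h x \<le> M * exp k" .
    qed (use consts_pos M eps N_pos h_pos[of x] in auto)
    also have "\<dots> = c2 * M ^ 3 * (N / 2) * (exp k * eps)" by (simp add: eval_nat_numeral)
    finally have 2: "p x \<le> c2 * M ^ 3 * (N / 2) * (exp k * eps)" .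
    have "h (x - 2 * \<delta>) / sqrt 2 \<le> h (x - 2 * \<delta>) / 1"
      using h_pos[of "x - 2 * \<delta>"] by (intro divide_left_mono) auto
    also have "\<dots> \<le> M * exp (- k * \<bar>x - 2 * \<delta>\<bar>)" using h_le by simp
    also have "exp (- k * \<bar>x - 2 * \<delta>\<bar>) = eps * exp (k * x)" using 1 d1 by (simp add: eps_exp)
    also have "M * (eps * exp (k * x)) \<le> M * (eps * exp k)" using M eps k0 x 1 by (intro mult_left_mono) auto
    finally have 3: "h (x - 2 * \<delta>) / sqrt 2 \<le> M * (exp k * eps)" by (simp add: mult_ac)
    have nn: "0 \<le> c2 * M ^ 3 * (N / 2) * (exp k * eps)" "0 \<le> M * (exp k * eps)"
      using consts_pos M eps N_pos by auto
    have "\<bar>p x - h (x - 2 * \<delta>) / sqrt 2\<bar> \<le> c2 * M ^ 3 * (N / 2) * (exp k * eps) + M * (exp k * eps)"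
    proof -
      have "0 \<le> h (x - 2 * \<delta>) / sqrt 2" using h_pos[of "x - 2 * \<delta>"] by simp
      then show ?thesis using 2 3 p_nonneg[OF x] nn by linarith
    qed
    also have "\<dots> = (c2 * M ^ 3 * (N / 2) + M) * (exp k * eps) * 1" by (simp add: distrib_right)
    also have "\<dots> \<le> (c2 * M ^ 3 * (N / 2) + M) * (exp k * eps) * (exp k * v x)"
    proof (rule mult_left_mono)
      have "w1 K * x \<le> k * 1" using w x 1 k0 by (intro mult_mono) auto
      then show "1 \<le> exp k * v x" by (simp add: v_def flip: exp_add)
    qed (use consts_pos M eps N_pos in auto)
    also have "\<dots> = A1 * eps * v x" by (simp add: A1_def exp_double power2_eq_square)
    also have "\<dots> \<le> A1 * eps * (u x + v x)" using a eps uv by (intro mult_left_mono) auto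
    finally show ?thesis by (rule fin) (use a consts_nonneg in simp)
  next
    case 2
    show ?thesis by (rule fin[OF p_middle[OF 2]]) (use a in simp)
  next
    case 3
    let ?t = "x - (2 * \<delta> + 1)"
    have t0: "0 \<le> ?t" using 3 by simp
    have hx: "h (x - 2 * \<delta>) = h 1 * exp (- k * ?t)" using h_right[of "x - 2 * \<delta>"] 3 by (simp add: algebra_simps)
    have h1: "h 1 \<le> M"
    proof -
      have "M * exp (- k * \<bar>1\<bar>) \<le> M * 1" using M k0 by (intro mult_left_mono) auto
      then show ?thesis using h_le[of 1] by linarith
    qed
    have uX: "u (2 * \<delta> + 1) + v (2 * \<delta> + 1) \<le> 2"
    proof -
      have "u (2 * \<delta> + 1) \<le> 1" using w by (simp add: u_def)
      moreover have "v (2 * \<delta> + 1) \<le> 1" using w d1 by (simp add: v_def)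
      ultimately show ?thesis by simp
    qed
    have P: "\<bar>p (2 * \<delta> + 1) - h 1 / sqrt 2\<bar> \<le> 2 * b2 * eps"
    proof -
      have "\<bar>p (2 * \<delta> + 1) - h 1 / sqrt 2\<bar> \<le> b2 * eps * (u (2 * \<delta> + 1) + v (2 * \<delta> + 1))"
        using p_middle[of "2 * \<delta> + 1"] d1 by simp
      also have "\<dots> \<le> b2 * eps * 2" using uX consts_nonneg eps by (intro mult_left_mono) auto
      finally show ?thesis by simp
    qed
    have ew: "exp (- \<omega> * ?t) \<le> exp (- w0 K * ?t)" using mult_right_mono[OF w(2) t0] by simp
    have e01: "exp (- w0 K * ?t) \<le> exp (- w1 K * ?t)" using mult_right_mono[OF w(6) t0] by simp
    have dexp: "exp (- \<omega> * ?t) - exp (- k * ?t) \<le> (E\<^sup>2 / k) * (exp (- w1 K * ?t) / w1 K)"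
    proof -
      have "exp (- \<omega> * ?t) - exp (- k * ?t) = exp (- \<omega> * ?t) * (1 - exp (- ((k - \<omega>) * ?t)))"
        by (simp add: right_diff_distrib algebra_simps flip: exp_add)
      also have "\<dots> \<le> exp (- w0 K * ?t) * ((E\<^sup>2 / k) * ?t)"
      proof (rule mult_mono[OF ew])
        have "1 - exp (- ((k - \<omega>) * ?t)) \<le> (k - \<omega>) * ?t"
          using exp_ge_add_one_self[of "- ((k - \<omega>) * ?t)"] by linarith
        also have "\<dots> \<le> (E\<^sup>2 / k) * ?t" by (rule mult_right_mono[OF w(4) t0])
        finally show "1 - exp (- ((k - \<omega>) * ?t)) \<le> (E\<^sup>2 / k) * ?t" .
      qed (use w(3) t0 in auto)
      also have "\<dots> = (E\<^sup>2 / k) * (exp (- w0 K * ?t) * ?t)" by simp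
      also have "\<dots> \<le> (E\<^sup>2 / k) * (exp (- w1 K * ?t) / w1 K)"
      proof (rule mult_left_mono)
        have "w1 K * ?t \<le> exp (w1 K * ?t)" using exp_ge_add_one_self[of "w1 K * ?t"] by linarith
        then have "exp (- w0 K * ?t) * (w1 K * ?t) \<le> exp (- w0 K * ?t) * exp (w1 K * ?t)" by (intro mult_left_mono) auto
        also have "\<dots> = exp (- w1 K * ?t)" by (simp add: w1_def flip: exp_add)
        finally show "exp (- w0 K * ?t) * ?t \<le> exp (- w1 K * ?t) / w1 K"
          using w(5) by (simp add: pos_le_divide_eq mult_ac)
      qed (use k0 in auto)
      finally show ?thesis .
    qed
    have dnn: "0 \<le> exp (- \<omega> * ?t) - exp (- k * ?t)" using mult_right_mono[OF w(3) t0] by simp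
    have dd: "h 1 / sqrt 2 * (exp (- \<omega> * ?t) - exp (- k * ?t)) \<le> M * ((c2\<^sup>2 * M ^ 4 * eps / k) * (exp (- w1 K * ?t) / w1 K))"
    proof (rule mult_mono)
      have "h 1 / sqrt 2 \<le> h 1 / 1" using h_pos[of 1] by (intro divide_left_mono) auto
      then show "h 1 / sqrt 2 \<le> M" using h1 by simp
      have "E\<^sup>2 \<le> c2\<^sup>2 * M ^ 4 * eps"
        using order_trans[OF E2_eps mult_left_mono[OF eps2, of "c2\<^sup>2 * M ^ 4"]] by simp
      then have "(E\<^sup>2 / k) * (exp (- w1 K * ?t) / w1 K) \<le> (c2\<^sup>2 * M ^ 4 * eps / k) * (exp (- w1 K * ?t) / w1 K)"
        using k0 w(5) by (intro mult_right_mono divide_right_mono) auto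
      then show "exp (- \<omega> * ?t) - exp (- k * ?t) \<le> (c2\<^sup>2 * M ^ 4 * eps / k) * (exp (- w1 K * ?t) / w1 K)"
        using dexp by linarith
    qed (use M dnn in auto)
    have "p x - h (x - 2 * \<delta>) / sqrt 2 = (p (2 * \<delta> + 1) - h 1 / sqrt 2) * exp (- \<omega> * ?t) + h 1 / sqrt 2 * (exp (- \<omega> * ?t) - exp (- k * ?t))"
      unfolding p_tail[OF 3] hx by (simp add: algebra_simps)
    then have "\<bar>p x - h (x - 2 * \<delta>) / sqrt 2\<bar> \<le> \<bar>(p (2 * \<delta> + 1) - h 1 / sqrt 2) * exp (- \<omega> * ?t)\<bar> + \<bar>h 1 / sqrt 2 * (exp (- \<omega> * ?t) - exp (- k * ?t))\<bar>"
      by (simp only: abs_triangle_ineq)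
    also have "\<dots> \<le> 2 * b2 * eps * exp (- w1 K * ?t) + M * ((c2\<^sup>2 * M ^ 4 * eps / k) * (exp (- w1 K * ?t) / w1 K))"
    proof (rule add_mono)
      show "\<bar>(p (2 * \<delta> + 1) - h 1 / sqrt 2) * exp (- \<omega> * ?t)\<bar> \<le> 2 * b2 * eps * exp (- w1 K * ?t)"
        unfolding abs_mult abs_exp_cancel using P ew e01 consts_nonneg eps by (intro mult_mono) auto
      show "\<bar>h 1 / sqrt 2 * (exp (- \<omega> * ?t) - exp (- k * ?t))\<bar> \<le> M * ((c2\<^sup>2 * M ^ 4 * eps / k) * (exp (- w1 K * ?t) / w1 K))"
        using dd dnn h_pos[of 1] by (simp add: abs_mult)
    qed
    also have "\<dots> = (2 * b2 + M * (c2\<^sup>2 * M ^ 4 / (k * w1 K))) * eps * exp (- w1 K * ?t)"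
      by (simp add: algebra_simps)
    also have "\<dots> \<le> (2 * b2 + M * (c2\<^sup>2 * M ^ 4 / (k * w1 K))) * eps * (exp k * u x)"
    proof (rule mult_left_mono)
      show "exp (- w1 K * ?t) \<le> exp k * u x" using w 3 by (simp add: u_def algebra_simps flip: exp_add)
    qed (use consts_nonneg consts_pos M k0 w eps in auto)
    also have "\<dots> = A3 * eps * u x" by (simp add: A3_def)
    also have "\<dots> \<le> A3 * eps * (u x + v x)" using a eps uv by (intro mult_left_mono) auto
    finally show ?thesis by (rule fin) (use a consts_nonneg in simp)
  qed
qed

end

section \<open>From profiles to normalized eigenfunctions\<close>

lemma dirac_solution_scale:
  assumes "dirac_solution m E a c" shows "dirac_solution m E (\<lambda>x. t * a x) (\<lambda>x. t * c x)"
  using DERIV_cmult[OF dirac_solutionD(1)[OF assms], of t] DERIV_cmult[OF dirac_solutionD(2)[OF assms], of t]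
  unfolding dirac_solution_def by (simp add: algebra_simps)

text \<open>At \<open>E = 0\<close> the decaying angle is identically zero, and the decaying solution is a multiple of the zero mode.\<close>

lemma (in odd_wall) zero_mode_normalized: "normalized_eigenfunction m 0 (zero_mode m)"
proof -
  have 0: "\<bar>0::real\<bar> < k" using k_pos by simp
  have z: "sin (2 * Theta 0) = 0" by (simp add: Theta_0)
  have a0: "angle 0 x = 0" for x using angle_eqI[of 0 "\<lambda>_. 0" X x] by (simp add: prufer_at_def angle_X)
  have s: "solA 0 = (\<lambda>x. exp (- mass_integral m x))" "solC 0 = (\<lambda>_. 0)"
    by (auto simp: solA_def solC_def a0 rad_def prufer_radius_def)
  define I where "I = (\<integral>x. (exp (- mass_integral m x))\<^sup>2 \<partial>lborel)"
  have "norm_H (rspinor (solA 0) (solC 0)) \<noteq> 0"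
    using sol_eigenfunction[OF 0 z] by (simp add: eigenfunction_def)
  moreover have "(norm_H (rspinor (solA 0) (solC 0)))\<^sup>2 = I"
    unfolding norm_H_square norm_spinor s I_def by simp
  ultimately have I: "I > 0" by (metis zero_less_power2)
  define t where "t = sqrt 2 * gamma_const m"
  have t: "t\<^sup>2 = 1 / I" "t > 0"
    using I by (auto simp: t_def gamma_const_def L2_norm_real_def I_def[symmetric] power_divide)
  have zm: "zero_mode m = rspinor (\<lambda>x. t * solA 0 x) (\<lambda>x. t * solC 0 x)"
    unfolding zero_mode_rspinor s t_def by simp
  obtain A where A: "\<And>x. \<bar>solA 0 x\<bar> \<le> A * exp (- rate 0 * \<bar>x\<bar>)" "\<And>x. \<bar>solC 0 x\<bar> \<le> A * exp (- rate 0 * \<bar>x\<bar>)"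
    using sol_decay[OF 0 z] by metis
  have e: "eigenfunction m 0 (zero_mode m)"
    unfolding zm
  proof (rule eigenfunction_of_solution[OF dirac_solution_scale[OF sol[of 0], of t] m_cont m_bound,
        where A = "t * A" and w = "rate 0"])
    show "\<bar>t * solA 0 x\<bar> \<le> t * A * exp (- rate 0 * \<bar>x\<bar>)" "\<bar>t * solC 0 x\<bar> \<le> t * A * exp (- rate 0 * \<bar>x\<bar>)" for x
      using mult_left_mono[OF A(1), of t x] mult_left_mono[OF A(2), of t x] t(2) by (simp_all add: abs_mult)
    show "(t * solA 0 x)\<^sup>2 + (t * solC 0 x)\<^sup>2 \<noteq> 0" for x using t(2) by (simp add: s)
  qed (rule rate(1)[OF 0])
  have "norm_H (zero_mode m) = 1"
  proof (rule norm_H_eqI)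
    have "(\<integral>x. (norm (zero_mode m x))\<^sup>2 \<partial>lborel) = (\<integral>x. t\<^sup>2 * (exp (- mass_integral m x))\<^sup>2 \<partial>lborel)"
      unfolding zm norm_spinor s by (simp add: norm_mult power_mult_distrib)
    also have "\<dots> = 1\<^sup>2" using I t by (simp flip: I_def)
    finally show "(\<integral>x. (norm (zero_mode m x))\<^sup>2 \<partial>lborel) = 1\<^sup>2" .
  qed simp
  with e show ?thesis by (simp add: normalized_eigenfunction_def)
qed

text \<open>The half-angle formula gives \<open>q / (1 + sqrt (1 - q\<^sup>2))\<close> with \<open>q = E / k\<close>, and \<open>1 - q\<^sup>2 \<le> sqrt (1 - q\<^sup>2) \<le> 1\<close>.\<close>

lemma tan_decay_angle:
  assumes E: "0 < E" "E < k"
  shows "E / (2 * k) \<le> tan (decay_angle k E)" "tan (decay_angle k E) \<le> E / (2 * k) * (1 + E\<^sup>2 / k\<^sup>2)"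
proof -
  have aE: "\<bar>E\<bar> < k" and k: "k > 0" using E by auto
  define q s where "q = E / k" and "s = sqrt (1 - q\<^sup>2)"
  have q: "0 < q" "q < 1" using E k by (auto simp: q_def)
  have q2: "q\<^sup>2 \<le> 1" using q by (simp add: power_le_one)
  have s: "0 \<le> s" "s \<le> 1" "s\<^sup>2 = 1 - q\<^sup>2" using q2 by (auto simp: s_def)
  have s2: "1 - q\<^sup>2 \<le> s" using mult_left_le[of s s] s by (simp add: power2_eq_square)
  have sn: "sin (2 * decay_angle k E) = q" using decay_angle(3)[OF aE] k by (simp add: q_def field_simps)
  have t: "tan (decay_angle k E) = q / (s + 1)"
    unfolding tan_half sn decay_angle(4)[OF aE] by (simp add: s_def q_def)
  have "q / 2 \<le> q / (s + 1)" using q s by (intro divide_left_mono) auto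
  then show "E / (2 * k) \<le> tan (decay_angle k E)" unfolding t by (simp add: q_def mult.commute)
  have "q\<^sup>2 * q\<^sup>2 \<le> q\<^sup>2 * 1" using q2 by (intro mult_left_mono) auto
  then have "2 \<le> (1 + q\<^sup>2) * (1 + (1 - q\<^sup>2))" by (simp add: algebra_simps)
  also have "\<dots> \<le> (1 + q\<^sup>2) * (1 + s)" using s2 by (intro mult_left_mono) auto
  finally have "q * 2 \<le> q * ((1 + q\<^sup>2) * (1 + s))" using q by (intro mult_left_mono) auto
  then have "q / (s + 1) \<le> q / 2 * (1 + q\<^sup>2)" using s by (simp add: field_simps)
  then show "tan (decay_angle k E) \<le> E / (2 * k) * (1 + E\<^sup>2 / k\<^sup>2)" unfolding t by (simp add: q_def power_divide mult.commute)
qed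

text \<open>If \<open>(f1, f2)\<close> is close to an almost normalized pair, then so is its normalization.  The cross terms are split
  by \<open>2 \<bar>a b\<bar> \<le> \<epsilon> a\<^sup>2 + b\<^sup>2 / \<epsilon>\<close>, which keeps the error of the norm of first order in \<open>\<epsilon>\<close>.\<close>

lemma normalize_close:
  fixes f1 f2 A B :: "real \<Rightarrow> real"
  assumes i: "integrable lborel (\<lambda>x. (f1 x)\<^sup>2 + (f2 x)\<^sup>2)" "integrable lborel (\<lambda>x. (A x)\<^sup>2 + (B x)\<^sup>2)"
    "integrable lborel (\<lambda>x. (f1 x - A x)\<^sup>2 + (f2 x - B x)\<^sup>2)"
    and im: "(\<lambda>x. (f1 x / n - A x)\<^sup>2 + (f2 x / n - B x)\<^sup>2) \<in> borel_measurable lborel"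
    and n: "n > 0" "n\<^sup>2 = (\<integral>x. (f1 x)\<^sup>2 + (f2 x)\<^sup>2 \<partial>lborel)"
    and N: "1 - d * \<epsilon> \<le> (\<integral>x. (A x)\<^sup>2 + (B x)\<^sup>2 \<partial>lborel)" "(\<integral>x. (A x)\<^sup>2 + (B x)\<^sup>2 \<partial>lborel) \<le> 1"
    and R: "(\<integral>x. (f1 x - A x)\<^sup>2 + (f2 x - B x)\<^sup>2 \<partial>lborel) \<le> D * \<epsilon>\<^sup>2"
    and \<epsilon>: "0 < \<epsilon>" "\<epsilon> \<le> 1" and d: "0 \<le> d" "0 \<le> D"
  shows "(\<integral>x. (f1 x / n - A x)\<^sup>2 + (f2 x / n - B x)\<^sup>2 \<partial>lborel) \<le> (2 * (1 + 2 * D + d)\<^sup>2 + 2 * D) * \<epsilon>\<^sup>2"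
proof -
  define F S T where "F = (\<lambda>x. (f1 x)\<^sup>2 + (f2 x)\<^sup>2)" and "S = (\<lambda>x. (A x)\<^sup>2 + (B x)\<^sup>2)"
    and "T = (\<lambda>x. (f1 x - A x)\<^sup>2 + (f2 x - B x)\<^sup>2)"
  have it: "integrable lborel F" "integrable lborel S" "integrable lborel T"
    using i by (auto simp: F_def S_def T_def)
  have amgm: "2 * \<bar>a * b\<bar> \<le> \<epsilon> * a\<^sup>2 + b\<^sup>2 / \<epsilon>" for a b :: real
  proof -
    have "0 \<le> (\<epsilon> * \<bar>a\<bar> - \<bar>b\<bar>)\<^sup>2 / \<epsilon>" using \<epsilon> by simp
    also have "(\<epsilon> * \<bar>a\<bar> - \<bar>b\<bar>)\<^sup>2 / \<epsilon> = \<epsilon> * a\<^sup>2 + b\<^sup>2 / \<epsilon> - 2 * (\<bar>a\<bar> * \<bar>b\<bar>)"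
      using \<epsilon> by (simp add: power2_diff power_mult_distrib field_simps power2_eq_square)
    finally show ?thesis by (simp add: abs_mult)
  qed
  have pt: "\<bar>F x - S x\<bar> \<le> \<epsilon> * S x + (1 / \<epsilon> + 1) * T x" for x
  proof -
    have "F x - S x = 2 * (A x * (f1 x - A x)) + 2 * (B x * (f2 x - B x)) + T x"
      by (simp add: F_def S_def T_def power2_eq_square algebra_simps)
    moreover have "T x \<ge> 0" by (simp add: T_def)
    moreover have "\<epsilon> * S x + (1 / \<epsilon> + 1) * T x = (\<epsilon> * (A x)\<^sup>2 + (f1 x - A x)\<^sup>2 / \<epsilon>) + (\<epsilon> * (B x)\<^sup>2 + (f2 x - B x)\<^sup>2 / \<epsilon>) + T x"
      by (simp add: S_def T_def algebra_simps add_divide_distrib)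
    ultimately show ?thesis
      using amgm[of "A x" "f1 x - A x"] amgm[of "B x" "f2 x - B x"] by linarith
  qed
  have T0: "0 \<le> (\<integral>x. T x \<partial>lborel)" by (simp add: T_def)
  have "\<bar>(\<integral>x. F x \<partial>lborel) - (\<integral>x. S x \<partial>lborel)\<bar> = \<bar>\<integral>x. F x - S x \<partial>lborel\<bar>" using it by simp
  also have "\<dots> \<le> (\<integral>x. \<bar>F x - S x\<bar> \<partial>lborel)" by (rule integral_abs_bound)
  also have "\<dots> \<le> (\<integral>x. \<epsilon> * S x + (1 / \<epsilon> + 1) * T x \<partial>lborel)"
    using it pt by (intro integral_mono) auto
  also have "\<dots> = \<epsilon> * (\<integral>x. S x \<partial>lborel) + (1 / \<epsilon> + 1) * (\<integral>x. T x \<partial>lborel)" using it by simp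
  also have "\<dots> \<le> \<epsilon> * 1 + (2 / \<epsilon>) * (D * \<epsilon>\<^sup>2)"
    using N R \<epsilon> T0 by (intro add_mono mult_left_mono mult_mono) (auto simp: S_def T_def field_simps)
  also have "\<dots> = (1 + 2 * D) * \<epsilon>" using \<epsilon> by (simp add: power2_eq_square algebra_simps)
  finally have FS: "\<bar>n\<^sup>2 - (\<integral>x. S x \<partial>lborel)\<bar> \<le> (1 + 2 * D) * \<epsilon>" using n by (simp add: F_def)
  define L where "L = 1 + 2 * D + d"
  have "\<bar>n\<^sup>2 - 1\<bar> \<le> L * \<epsilon>"
    using FS N by (simp add: S_def L_def algebra_simps abs_le_iff)
  moreover have "\<bar>n - 1\<bar> \<le> \<bar>n\<^sup>2 - 1\<bar>"
  proof -
    have "n\<^sup>2 - 1 = (n - 1) * (n + 1)" by (simp add: power2_eq_square algebra_simps)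
    then have "\<bar>n\<^sup>2 - 1\<bar> = \<bar>n - 1\<bar> * (n + 1)" using n by (simp add: abs_mult)
    then show ?thesis using mult_left_mono[of 1 "n + 1" "\<bar>n - 1\<bar>"] n by simp
  qed
  ultimately have "\<bar>n - 1\<bar> \<le> L * \<epsilon>" by linarith
  then have n1: "(1 - n)\<^sup>2 \<le> (L * \<epsilon>)\<^sup>2"
    using power_mono[of "\<bar>n - 1\<bar>" "L * \<epsilon>" 2] by (simp add: power2_commute)
  have pt2: "(f1 x / n - A x)\<^sup>2 + (f2 x / n - B x)\<^sup>2 \<le> 2 * (1 / n - 1)\<^sup>2 * F x + 2 * T x" for x
  proof -
    have sq: "(v / n - w)\<^sup>2 \<le> 2 * ((1 / n - 1)\<^sup>2 * v\<^sup>2) + 2 * (v - w)\<^sup>2" for v w :: real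
    proof -
      have eq: "v / n - w = (1 / n - 1) * v + (v - w)" by (simp add: left_diff_distrib)
      have "(v / n - w)\<^sup>2 = ((1 / n - 1) * v + (v - w))\<^sup>2" unfolding eq ..
      also have "\<dots> \<le> 2 * ((1 / n - 1) * v)\<^sup>2 + 2 * (v - w)\<^sup>2"
        using sum_squares_bound[of "(1 / n - 1) * v" "v - w"] by (simp add: power2_sum)
      finally show ?thesis by (simp add: power_mult_distrib)
    qed
    show ?thesis using sq[of "f1 x" "A x"] sq[of "f2 x" "B x"] by (simp add: F_def T_def algebra_simps)
  qed
  have "(\<integral>x. (f1 x / n - A x)\<^sup>2 + (f2 x / n - B x)\<^sup>2 \<partial>lborel) \<le> (\<integral>x. 2 * (1 / n - 1)\<^sup>2 * F x + 2 * T x \<partial>lborel)"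
  proof (rule integral_mono)
    show g: "integrable lborel (\<lambda>x. 2 * (1 / n - 1)\<^sup>2 * F x + 2 * T x)" using it by simp
    show "integrable lborel (\<lambda>x. (f1 x / n - A x)\<^sup>2 + (f2 x / n - B x)\<^sup>2)"
    proof (rule Bochner_Integration.integrable_bound[OF g im])
      show "AE x in lborel. norm ((f1 x / n - A x)\<^sup>2 + (f2 x / n - B x)\<^sup>2) \<le> norm (2 * (1 / n - 1)\<^sup>2 * F x + 2 * T x)"
        using pt2 by (intro AE_I2) (auto simp: abs_of_nonneg intro: order_trans[OF _ abs_ge_self])
    qed
  qed (rule pt2)
  also have "\<dots> = 2 * (1 / n - 1)\<^sup>2 * n\<^sup>2 + 2 * (\<integral>x. T x \<partial>lborel)" using it n by (simp add: F_def)
  also have "2 * (1 / n - 1)\<^sup>2 * n\<^sup>2 = 2 * (1 - n)\<^sup>2"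
  proof -
    have "(1 / n - 1) * n = 1 - n" using n(1) by (simp add: left_diff_distrib)
    then have "(1 / n - 1)\<^sup>2 * n\<^sup>2 = (1 - n)\<^sup>2" by (simp flip: power_mult_distrib)
    then show ?thesis by simp
  qed
  also have "2 * (1 - n)\<^sup>2 + 2 * (\<integral>x. T x \<partial>lborel) \<le> 2 * (L * \<epsilon>)\<^sup>2 + 2 * (D * \<epsilon>\<^sup>2)"
    using n1 R by (simp add: T_def)
  also have "\<dots> = (2 * (1 + 2 * D + d)\<^sup>2 + 2 * D) * \<epsilon>\<^sup>2" 
    unfolding L_def[symmetric] by (simp add: power_mult_distrib distrib_right)
  finally show ?thesis .
qed

context domain_wall
begin

abbreviation \<gamma> :: real where "\<gamma> \<equiv> gamma_const \<kappa>"

lemma three_profile: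
  assumes K: "0 < K" "K < k" and d: "2 \<le> \<delta>" and E: "0 < E" "E \<le> K"
    and t: "odd_wall.Theta (\<kappa>3 \<delta>) k (2 * \<delta> + 1) E = - (pi / 2)"
  shows "three_wall_profile \<kappa> k K \<delta> E (tan (decay_angle k E))
    (odd_wall.solA (\<kappa>3 \<delta>) k (2 * \<delta> + 1) E) (\<lambda>x. - odd_wall.solC (\<kappa>3 \<delta>) k (2 * \<delta> + 1) E x)"
proof -
  have d1: "\<delta> > 1" using d by simp
  interpret three: odd_wall "\<kappa>3 \<delta>" k "2 * \<delta> + 1" by (rule three_odd_wall[OF d1])
  have aE: "\<bar>E\<bar> < k" and Ek: "E < k" using E K by auto
  note dd = dirac_solutionD(1,2)[OF three.sol[of E]]
  define \<theta> where "\<theta> = three.angle E"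
  have \<theta>c: "continuous_on UNIV \<theta>" unfolding \<theta>_def by (rule three.angle_continuous)
  have \<theta>p: "prufer_at (\<kappa>3 \<delta>) E \<theta> x" for x unfolding \<theta>_def by (rule three.angle_prufer)
  have \<phi>: "0 < decay_angle k E" "decay_angle k E < pi / 4"
    using decay_angle_less[of 0 k E] decay_angle(2)[OF aE] aE E by auto
  have lo: "- (pi / 2) \<le> \<theta> x" if x: "0 \<le> x" for x
  proof (rule ccontr)
    assume "\<not> - (pi / 2) \<le> \<theta> x"
    then have "\<theta> 0 < - (pi / 2)"
      by (intro prufer_backward(2)[OF three.m_cont three.m_bound continuous_on_const \<theta>c x, of 0 _ E])
        (use \<theta>p E in \<open>auto simp: prufer_at_def\<close>)
    then show False using t by (simp add: \<theta>_def three.Theta_def)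
  qed
  have hi: "\<theta> x \<le> 0" if x: "0 \<le> x" for x
  proof (cases "x \<le> 2 * \<delta> + 1")
    case True
    show ?thesis
      by (rule prufer_backward(1)[OF three.m_cont three.m_bound continuous_on_const \<theta>c True, of 0 0 E])
        (use \<theta>p E \<phi> in \<open>auto simp: prufer_at_def \<theta>_def three.angle_X\<close>)
  next
    case False
    then show ?thesis using three.angle_plateau[OF aE, of x] \<phi> by (simp add: \<theta>_def)
  qed
  show ?thesis
  proof unfold_locales
    show "(three.solA E has_real_derivative - \<kappa>3 \<delta> x * three.solA E x + E * - three.solC E x) (at x)" for x
      using dd(1)[of x] by simp
    show "((\<lambda>x. - three.solC E x) has_real_derivative \<kappa>3 \<delta> x * - three.solC E x - E * three.solA E x) (at x)" for x
      using DERIV_minus[OF dd(2)[of x]] by simp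
    show "three.solA E 0 = 0" "- three.solC E 0 = 1"
      using t by (simp_all add: three.solA_def three.solC_def three.Theta_def)
    fix x :: real assume x: "0 \<le> x"
    show "0 \<le> three.solA E x"
      unfolding three.solA_def using three.rad_pos[of E x] lo[OF x] hi[OF x] pi_gt_zero
      by (intro mult_nonneg_nonneg cos_ge_zero) (auto simp: \<theta>_def)
    have "0 \<le> sin (- \<theta> x)" using lo[OF x] hi[OF x] pi_gt_zero by (intro sin_ge_zero) linarith+
    then have "0 \<le> three.rad E x * sin (- \<theta> x)" using three.rad_pos[of E x] by (intro mult_nonneg_nonneg) auto
    then show "0 \<le> - three.solC E x" by (simp add: three.solC_def \<theta>_def)
  next
    have "cos (decay_angle k E) > 0" using \<phi> by (intro cos_gt_zero_pi) auto
    then show "- three.solC E (2 * \<delta> + 1) = tan (decay_angle k E) * three.solA E (2 * \<delta> + 1)"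
      by (simp add: three.solC_def three.solA_def three.angle_X tan_def)
    show "three.solA E x = three.solA E (2 * \<delta> + 1) * exp (- sqrt (k\<^sup>2 - E\<^sup>2) * (x - (2 * \<delta> + 1)))"
      "- three.solC E x = - three.solC E (2 * \<delta> + 1) * exp (- sqrt (k\<^sup>2 - E\<^sup>2) * (x - (2 * \<delta> + 1)))"
      if x: "2 * \<delta> + 1 \<le> x" for x
      using three.rad_plateau[OF aE x] three.angle_plateau[OF aE x]
      by (simp_all add: three.solA_def three.solC_def three.angle_X three.rate_def)
  qed (use K d E tan_decay_angle[OF E(1) Ek] in auto)
qed

text \<open>In the real coordinates the three shifted modes separate: the outer ones make up the first
  component, the middle one the second.\<close>

lemma approx_mode_rspinor:
  "approx_mode \<kappa> s \<delta> = rspinor (\<lambda>x. \<gamma> * ((h (x - 2 * \<delta>) - h (x + 2 * \<delta>)) / sqrt 2)) (\<lambda>x. - s * \<gamma> * h x)"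
proof
  fix x
  have z: "zero_mode \<kappa> y = spinor (of_real (sqrt 2 * \<gamma> * h y)) 0" for y
    unfolding zero_mode_rspinor h_def by simp
  have s2: "complex_of_real (sqrt 2) * (complex_of_real (sqrt 2) * w) = 2 * w" for w
    by (metis mult.assoc sqrt2_sq)
  have s3: "x / complex_of_real (sqrt 2) = x * complex_of_real (sqrt 2) / 2" for x
  proof -
    have "x * complex_of_real (sqrt 2) / 2 = x * complex_of_real (sqrt 2) / (complex_of_real (sqrt 2) * complex_of_real (sqrt 2))"
      by (simp only: sqrt2_sq)
    also have "\<dots> = x / complex_of_real (sqrt 2)" by simp
    finally show ?thesis by (rule sym)
  qed
  have c0: "compA (zero_mode_0 \<kappa> x) = 0" "compC (zero_mode_0 \<kappa> x) = \<i> * of_real (sqrt 2 * \<gamma> * h x)"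
    unfolding compA_def compC_def zero_mode_0_def zero_mode_def h_def
    by (simp_all add: s3, simp_all add: algebra_simps)
  show "approx_mode \<kappa> s \<delta> x = rspinor (\<lambda>x. \<gamma> * ((h (x - 2 * \<delta>) - h (x + 2 * \<delta>)) / sqrt 2)) (\<lambda>x. - s * \<gamma> * h x) x"
    unfolding spinor_eq_iff approx_mode_def zero_mode_R_def zero_mode_L_def
    by (simp add: c0 z s2 s3 sqrt2_sq algebra_simps diff_divide_distrib)
qed

lemma shifted_product_integral:
  assumes d: "\<delta> > 0"
  shows "integrable lborel (\<lambda>x. h (x - 2 * \<delta>) * h (x + 2 * \<delta>))"
    "0 \<le> (\<integral>x. h (x - 2 * \<delta>) * h (x + 2 * \<delta>) \<partial>lborel)"
    "(\<integral>x. h (x - 2 * \<delta>) * h (x + 2 * \<delta>) \<partial>lborel) \<le> M\<^sup>2 * (2 / k) * exp (- 2 * k * \<delta>)"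
proof -
  have M: "M > 0" using M_ge_1 by simp
  have nn: "0 \<le> h (x - 2 * \<delta>) * h (x + 2 * \<delta>)" for x using h_pos[of "x - 2 * \<delta>"] h_pos[of "x + 2 * \<delta>"] by simp
  have b: "h (x - 2 * \<delta>) * h (x + 2 * \<delta>) \<le> M\<^sup>2 * exp (- 2 * k * \<delta>) * exp (- k * \<bar>x - 0\<bar>)" for x
  proof -
    have "h (x - 2 * \<delta>) * h (x + 2 * \<delta>) \<le> (M * exp (- k * \<bar>x - 2 * \<delta>\<bar>)) * (M * exp (- k * \<bar>x + 2 * \<delta>\<bar>))"
      using h_le h_pos[of "x + 2 * \<delta>"] M by (intro mult_mono) auto
    also have "\<dots> = M\<^sup>2 * exp (- (k * (\<bar>x - 2 * \<delta>\<bar> + \<bar>x + 2 * \<delta>\<bar>)))"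
      by (simp add: power2_eq_square algebra_simps flip: exp_add)
    also have "\<dots> \<le> M\<^sup>2 * exp (- (k * (2 * \<delta> + \<bar>x\<bar>)))"
      using k0 by (intro mult_left_mono) (auto intro!: mult_left_mono)
    also have "\<dots> = M\<^sup>2 * exp (- 2 * k * \<delta>) * exp (- k * \<bar>x - 0\<bar>)" by (simp add: algebra_simps flip: exp_add)
    finally show ?thesis .
  qed
  have g: "integrable lborel (\<lambda>x. M\<^sup>2 * exp (- 2 * k * \<delta>) * exp (- k * \<bar>x - 0\<bar>))"
    by (intro integrable_mult_right integrable_exp_abs k0)
  have "continuous_on UNIV (\<lambda>x. h (x - 2 * \<delta>) * h (x + 2 * \<delta>))"
    by (intro continuous_intros continuous_on_compose2[OF h_cont]) auto
  then have m: "(\<lambda>x. h (x - 2 * \<delta>) * h (x + 2 * \<delta>)) \<in> borel_measurable lborel"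
    by (simp add: borel_measurable_continuous_onI)
  show i: "integrable lborel (\<lambda>x. h (x - 2 * \<delta>) * h (x + 2 * \<delta>))"
    by (rule Bochner_Integration.integrable_bound[OF g m])
      (intro AE_I2, use b nn in \<open>simp add: order_trans[OF _ abs_ge_self]\<close>)
  show "0 \<le> (\<integral>x. h (x - 2 * \<delta>) * h (x + 2 * \<delta>) \<partial>lborel)" by (rule Bochner_Integration.integral_nonneg) (rule nn)
  have "(\<integral>x. h (x - 2 * \<delta>) * h (x + 2 * \<delta>) \<partial>lborel) \<le> (\<integral>x. M\<^sup>2 * exp (- 2 * k * \<delta>) * exp (- k * \<bar>x - 0\<bar>) \<partial>lborel)"
    by (rule integral_mono[OF i g b])
  also have "\<dots> = M\<^sup>2 * exp (- 2 * k * \<delta>) * (2 / k)"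
    by (subst integral_mult_right_zero) (simp only: integrable_exp_abs(2)[OF k0])
  finally show "(\<integral>x. h (x - 2 * \<delta>) * h (x + 2 * \<delta>) \<partial>lborel) \<le> M\<^sup>2 * (2 / k) * exp (- 2 * k * \<delta>)" by (simp add: mult_ac)
qed

text \<open>The only deviation from norm one is the overlap of the two outer modes.\<close>

lemma approx_mode_norm:
  assumes d: "\<delta> > 0" and s: "s\<^sup>2 = 1"
  defines "A \<equiv> \<lambda>x. \<gamma> * ((h (x - 2 * \<delta>) - h (x + 2 * \<delta>)) / sqrt 2)" and "B \<equiv> \<lambda>x. - s * \<gamma> * h x"
  shows "integrable lborel (\<lambda>x. (A x)\<^sup>2 + (B x)\<^sup>2)" "(\<integral>x. (A x)\<^sup>2 + (B x)\<^sup>2 \<partial>lborel) \<le> 1"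
    "1 - \<gamma>\<^sup>2 * M\<^sup>2 * (2 / k) * exp (- 2 * k * \<delta>) \<le> (\<integral>x. (A x)\<^sup>2 + (B x)\<^sup>2 \<partial>lborel)"
proof -
  note hh = h_square_integral and pr = shifted_product_integral[OF d]
  have sh: "integrable lborel (\<lambda>x. (h (x - 2 * \<delta>))\<^sup>2)" "(\<integral>x. (h (x - 2 * \<delta>))\<^sup>2 \<partial>lborel) = N"
    "integrable lborel (\<lambda>x. (h (x + 2 * \<delta>))\<^sup>2)" "(\<integral>x. (h (x + 2 * \<delta>))\<^sup>2 \<partial>lborel) = N"
    using lborel_integrable_real_affine[OF hh(1), of 1 "- 2 * \<delta>"] lborel_integral_real_affine[of 1 "\<lambda>x. (h x)\<^sup>2" "- 2 * \<delta>"]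
      lborel_integrable_real_affine[OF hh(1), of 1 "2 * \<delta>"] lborel_integral_real_affine[of 1 "\<lambda>x. (h x)\<^sup>2" "2 * \<delta>"] hh(2)
    by (simp_all add: add.commute)
  define J where "J = (\<integral>x. h (x - 2 * \<delta>) * h (x + 2 * \<delta>) \<partial>lborel)"
  have eq: "(A x)\<^sup>2 + (B x)\<^sup>2 = \<gamma>\<^sup>2 * ((h (x - 2 * \<delta>))\<^sup>2 / 2 + (h (x + 2 * \<delta>))\<^sup>2 / 2 - h (x - 2 * \<delta>) * h (x + 2 * \<delta>) + (h x)\<^sup>2)" for x
    unfolding A_def B_def power_mult_distrib power_divide power2_minus s power2_diff
    by (simp add: field_simps)
  show i: "integrable lborel (\<lambda>x. (A x)\<^sup>2 + (B x)\<^sup>2)" unfolding eq using sh hh(1) pr(1) by simp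
  have "(\<integral>x. (A x)\<^sup>2 + (B x)\<^sup>2 \<partial>lborel) = \<gamma>\<^sup>2 * (N / 2 + N / 2 - J + N)"
    unfolding eq using sh hh pr(1) by (simp add: J_def)
  also have "\<dots> = 1 - \<gamma>\<^sup>2 * J" using gamma(2) N_pos by (simp add: right_diff_distrib distrib_left)
  finally have v: "(\<integral>x. (A x)\<^sup>2 + (B x)\<^sup>2 \<partial>lborel) = 1 - \<gamma>\<^sup>2 * J" .
  show "(\<integral>x. (A x)\<^sup>2 + (B x)\<^sup>2 \<partial>lborel) \<le> 1" unfolding v using pr(2) by (simp add: J_def)
  have "\<gamma>\<^sup>2 * J \<le> \<gamma>\<^sup>2 * (M\<^sup>2 * (2 / k) * exp (- 2 * k * \<delta>))" unfolding J_def using pr(3) by (intro mult_left_mono) auto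
  then show "1 - \<gamma>\<^sup>2 * M\<^sup>2 * (2 / k) * exp (- 2 * k * \<delta>) \<le> (\<integral>x. (A x)\<^sup>2 + (B x)\<^sup>2 \<partial>lborel)"
    unfolding v by (simp add: mult.assoc)
qed

definition a3 :: "real \<Rightarrow> real" where "a3 K = 2 * (a2 K + M)\<^sup>2 + a1\<^sup>2"
definition a4 :: "real \<Rightarrow> real" where "a4 K = \<gamma>\<^sup>2 * a3 K * (6 / w0 K)"
definition a5 :: "real \<Rightarrow> real" where "a5 K = 2 * (1 + 2 * a4 K + \<gamma>\<^sup>2 * M\<^sup>2 * (2 / k))\<^sup>2 + 2 * a4 K"

end

context three_wall_profile
begin

lemma pointwise_error:
  assumes x: "0 \<le> x"
  shows "(p x - (h (x - 2 * \<delta>) - h (x + 2 * \<delta>)) / sqrt 2)\<^sup>2 + (c x - h x)\<^sup>2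
    \<le> eps\<^sup>2 * a3 K * (exp (- w0 K * \<bar>x - 2 * \<delta>\<bar>) + exp (- w0 K * x))"
proof -
  have M: "M > 0" using M_ge_1 by simp
  note w = rates
  have uv: "u x > 0" "v x > 0" by (simp_all add: u_def v_def)
  have u2: "(u x)\<^sup>2 = exp (- w0 K * \<bar>x - 2 * \<delta>\<bar>)" "(v x)\<^sup>2 = exp (- w0 K * x)"
    by (simp_all add: u_def v_def w1_def flip: exp_double)
  have hL: "h (x + 2 * \<delta>) / sqrt 2 \<le> M * eps * (u x + v x)"
  proof -
    have "h (x + 2 * \<delta>) / sqrt 2 \<le> h (x + 2 * \<delta>) / 1" using h_pos[of "x + 2 * \<delta>"] by (intro divide_left_mono) auto
    also have "\<dots> \<le> M * exp (- k * (x + 2 * \<delta>))" using h_le[of "x + 2 * \<delta>"] x d1 by simp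
    also have "\<dots> = M * eps * exp (- k * x)" by (simp add: eps_def algebra_simps flip: exp_add)
    also have "\<dots> \<le> M * eps * (u x + v x)"
    proof (rule mult_left_mono)
      have "exp (- k * x) \<le> v x" unfolding v_def using mult_right_mono[OF w(7) x] by simp
      then show "exp (- k * x) \<le> u x + v x" using uv by simp
    qed (use M eps in simp)
    finally show ?thesis .
  qed
  have "\<bar>p x - (h (x - 2 * \<delta>) - h (x + 2 * \<delta>)) / sqrt 2\<bar> \<le> \<bar>p x - h (x - 2 * \<delta>) / sqrt 2\<bar> + h (x + 2 * \<delta>) / sqrt 2"
  proof -
    have "0 \<le> h (x + 2 * \<delta>) / sqrt 2" using h_pos[of "x + 2 * \<delta>"] by simp
    moreover have "(h (x - 2 * \<delta>) - h (x + 2 * \<delta>)) / sqrt 2 = h (x - 2 * \<delta>) / sqrt 2 - h (x + 2 * \<delta>) / sqrt 2"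
      by (rule diff_divide_distrib)
    ultimately show ?thesis by linarith
  qed
  also have "\<dots> \<le> (a2 K + M) * eps * (u x + v x)" using p_error[OF x] hL by (simp add: distrib_right distrib_left)
  finally have "(p x - (h (x - 2 * \<delta>) - h (x + 2 * \<delta>)) / sqrt 2)\<^sup>2 \<le> ((a2 K + M) * eps * (u x + v x))\<^sup>2"
    using power_mono[of "\<bar>p x - (h (x - 2 * \<delta>) - h (x + 2 * \<delta>)) / sqrt 2\<bar>" _ 2] by simp
  also have "\<dots> = (a2 K + M)\<^sup>2 * eps\<^sup>2 * (u x + v x)\<^sup>2" by (simp add: power_mult_distrib)
  also have "\<dots> \<le> (a2 K + M)\<^sup>2 * eps\<^sup>2 * (2 * ((u x)\<^sup>2 + (v x)\<^sup>2))"
  proof (rule mult_left_mono)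
    show "(u x + v x)\<^sup>2 \<le> 2 * ((u x)\<^sup>2 + (v x)\<^sup>2)"
      using sum_squares_bound[of "u x" "v x"] by (simp add: power2_sum)
  qed simp
  finally have P: "(p x - (h (x - 2 * \<delta>) - h (x + 2 * \<delta>)) / sqrt 2)\<^sup>2 \<le> (a2 K + M)\<^sup>2 * eps\<^sup>2 * (2 * ((u x)\<^sup>2 + (v x)\<^sup>2))" .
  have "exp (- w0 K * \<bar>x - 2 * \<delta>\<bar>) \<le> u x" unfolding u_def using mult_right_mono[OF w(6), of "\<bar>x - 2 * \<delta>\<bar>"] by simp
  then have "\<bar>c x - h x\<bar> \<le> a1 * eps * u x"
    using c_error[OF x] mult_left_mono[of _ "u x" "a1 * eps"] consts_nonneg eps by (meson less_imp_le mult_nonneg_nonneg order_trans)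
  then have "(c x - h x)\<^sup>2 \<le> (a1 * eps * u x)\<^sup>2" using power_mono[of "\<bar>c x - h x\<bar>" _ 2] by simp
  also have "\<dots> \<le> a1\<^sup>2 * eps\<^sup>2 * ((u x)\<^sup>2 + (v x)\<^sup>2)" by (simp add: power_mult_distrib distrib_left)
  finally have "(p x - (h (x - 2 * \<delta>) - h (x + 2 * \<delta>)) / sqrt 2)\<^sup>2 + (c x - h x)\<^sup>2
    \<le> (a2 K + M)\<^sup>2 * eps\<^sup>2 * (2 * ((u x)\<^sup>2 + (v x)\<^sup>2)) + a1\<^sup>2 * eps\<^sup>2 * ((u x)\<^sup>2 + (v x)\<^sup>2)"
    using P by (rule add_mono[rotated])
  also have "\<dots> = eps\<^sup>2 * a3 K * ((u x)\<^sup>2 + (v x)\<^sup>2)" by (simp add: a3_def algebra_simps)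
  finally show ?thesis by (simp only: u2)
qed

text \<open>By parity the bounds on the right half-line extend to the whole line, with exponentials centred at the
  three walls.\<close>

lemma square_error:
  assumes odd_p: "\<And>x. p (- x) = - p x" and even_c: "\<And>x. c (- x) = c x"
  defines "T \<equiv> \<lambda>x. (p x - (h (x - 2 * \<delta>) - h (x + 2 * \<delta>)) / sqrt 2)\<^sup>2 + (c x - h x)\<^sup>2"
  shows "integrable lborel T" "(\<integral>x. T x \<partial>lborel) \<le> a3 K * (6 / w0 K) * eps\<^sup>2"
proof -
  define b where "b = (\<lambda>x. eps\<^sup>2 * a3 K * (exp (- w0 K * \<bar>x - 2 * \<delta>\<bar>) + exp (- w0 K * \<bar>x - (- 2 * \<delta>)\<bar>) + exp (- w0 K * \<bar>x - 0\<bar>)))"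
  have a3: "a3 K \<ge> 0" by (simp add: a3_def)
  have Te: "T (- x) = T x" for x
  proof -
    have e: "h (- x - 2 * \<delta>) = h (x + 2 * \<delta>)" "h (- x + 2 * \<delta>) = h (x - 2 * \<delta>)"
      using h_even[of "x + 2 * \<delta>"] h_even[of "x - 2 * \<delta>"] by (simp_all add: algebra_simps)
    have "p (- x) - (h (- x - 2 * \<delta>) - h (- x + 2 * \<delta>)) / sqrt 2 = - (p x - (h (x - 2 * \<delta>) - h (x + 2 * \<delta>)) / sqrt 2)"
      unfolding e odd_p by (simp add: diff_divide_distrib)
    then show ?thesis unfolding T_def by (simp only: power2_minus even_c h_even)
  qed
  have le: "T x \<le> b x" for x
  proof -
    have "T x = T \<bar>x\<bar>" using Te[of x] by (simp add: abs_if)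
    also have "\<dots> \<le> eps\<^sup>2 * a3 K * (exp (- w0 K * \<bar>\<bar>x\<bar> - 2 * \<delta>\<bar>) + exp (- w0 K * \<bar>x\<bar>))"
      unfolding T_def by (rule pointwise_error) simp
    also have "\<dots> \<le> b x"
    proof -
      have "\<bar>\<bar>x\<bar> - 2 * \<delta>\<bar> = \<bar>x - 2 * \<delta>\<bar> \<or> \<bar>\<bar>x\<bar> - 2 * \<delta>\<bar> = \<bar>x - (- 2 * \<delta>)\<bar>"
        by (auto simp: abs_if)
      then have "exp (- w0 K * \<bar>\<bar>x\<bar> - 2 * \<delta>\<bar>) \<le> exp (- w0 K * \<bar>x - 2 * \<delta>\<bar>) + exp (- w0 K * \<bar>x - (- 2 * \<delta>)\<bar>)"
        by (elim disjE) simp_all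
      then show ?thesis unfolding b_def using a3 by (intro mult_left_mono) auto
    qed
    finally show ?thesis .
  qed
  have bi: "integrable lborel b"
    unfolding b_def by (intro integrable_mult_right Bochner_Integration.integrable_add integrable_exp_abs rates)
  have cc: "continuous_on UNIV p" "continuous_on UNIV c"
    using p_deriv c_deriv by (meson DERIV_isCont continuous_at_imp_continuous_on)+
  have "continuous_on UNIV T"
    unfolding T_def by (intro continuous_intros cc h_cont continuous_on_compose2[OF h_cont]) auto
  then have m: "T \<in> borel_measurable lborel" by (simp add: borel_measurable_continuous_onI)
  show i: "integrable lborel T"
  proof (rule Bochner_Integration.integrable_bound[OF bi m])
    have "0 \<le> T x" for x by (simp add: T_def)
    then show "AE x in lborel. norm (T x) \<le> norm (b x)"
      using le by (intro AE_I2) (simp add: order_trans[OF _ abs_ge_self])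
  qed
  have "(\<integral>x. T x \<partial>lborel) \<le> (\<integral>x. b x \<partial>lborel)" by (rule integral_mono[OF i bi le])
  also have "\<dots> = eps\<^sup>2 * a3 K * (2 / w0 K + 2 / w0 K + 2 / w0 K)"
    unfolding b_def
    by (simp only: integral_mult_right_zero Bochner_Integration.integral_add Bochner_Integration.integrable_add
        integrable_exp_abs[OF rates(1)])
  also have "\<dots> = a3 K * (6 / w0 K) * eps\<^sup>2" by simp
  finally show "(\<integral>x. T x \<partial>lborel) \<le> a3 K * (6 / w0 K) * eps\<^sup>2" .
qed

text \<open>The factor \<open>z\<close> is known up to its phase, which \<open>w\<close> cancels; its modulus is fixed by the normalization.\<close>

lemma eigenfunction_error:
  assumes odd_p: "\<And>x. p (- x) = - p x" and even_c: "\<And>x. c (- x) = c x"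
    and pi: "integrable lborel (\<lambda>x. (p x)\<^sup>2)" and ci: "integrable lborel (\<lambda>x. (c x)\<^sup>2)"
    and s: "s\<^sup>2 = (1::real)"
    and \<alpha>: "\<alpha> \<in> borel_measurable lborel" "norm_H \<alpha> = 1" "AE x in lborel. \<alpha> x = z *s rspinor p (\<lambda>x. - s * c x) x"
  shows "\<exists>w. cmod w = 1 \<and> norm_H (\<lambda>x. w *s \<alpha> x - approx_mode \<kappa> s \<delta> x) \<le> sqrt (a5 K) * eps"
proof -
  note g = gamma
  have cc: "continuous_on UNIV p" "continuous_on UNIV c"
    using p_deriv c_deriv by (meson DERIV_isCont continuous_at_imp_continuous_on)+
  define A where "A = (\<lambda>x. \<gamma> * ((h (x - 2 * \<delta>) - h (x + 2 * \<delta>)) / sqrt 2))"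
  define B where "B = (\<lambda>x. - s * \<gamma> * h x)"
  define f1 where "f1 = (\<lambda>x. \<gamma> * p x)"
  define f2 where "f2 = (\<lambda>x. - s * \<gamma> * c x)"
  have AB: "continuous_on UNIV A" "continuous_on UNIV B"
    unfolding A_def B_def by (intro continuous_intros h_cont continuous_on_compose2[OF h_cont]; simp)+
  have f12: "continuous_on UNIV f1" "continuous_on UNIV f2"
    unfolding f1_def f2_def by (intro continuous_intros cc)+
  have mm: "A \<in> borel_measurable borel" "B \<in> borel_measurable borel" "f1 \<in> borel_measurable borel" "f2 \<in> borel_measurable borel"
    using AB f12 by (simp_all add: borel_measurable_continuous_onI)
  have F: "(f1 x)\<^sup>2 + (f2 x)\<^sup>2 = \<gamma>\<^sup>2 * ((p x)\<^sup>2 + (c x)\<^sup>2)" for x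
    unfolding f1_def f2_def power_mult_distrib power2_minus s by (simp add: distrib_left)
  have T: "(f1 x - A x)\<^sup>2 + (f2 x - B x)\<^sup>2 = \<gamma>\<^sup>2 * ((p x - (h (x - 2 * \<delta>) - h (x + 2 * \<delta>)) / sqrt 2)\<^sup>2 + (c x - h x)\<^sup>2)" for x
  proof -
    have "f1 x - A x = \<gamma> * (p x - (h (x - 2 * \<delta>) - h (x + 2 * \<delta>)) / sqrt 2)"
      unfolding f1_def A_def by (rule right_diff_distrib[symmetric])
    moreover have "f2 x - B x = - s * (\<gamma> * (c x - h x))" unfolding f2_def B_def by (simp add: algebra_simps)
    ultimately show ?thesis unfolding power_mult_distrib power2_minus s by (simp add: power_mult_distrib s distrib_left)
  qed
  note sq = square_error[OF odd_p even_c]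
  define J where "J = (\<integral>x. (p x)\<^sup>2 + (c x)\<^sup>2 \<partial>lborel)"
  have nz: "(\<integral>x. (norm (\<alpha> x))\<^sup>2 \<partial>lborel) = 1" using \<alpha>(2) norm_H_square[of \<alpha>] by simp
  have "(\<integral>x. (norm (\<alpha> x))\<^sup>2 \<partial>lborel) = (\<integral>x. (cmod z)\<^sup>2 * ((p x)\<^sup>2 + (c x)\<^sup>2) \<partial>lborel)"
  proof (rule integral_cong_AE)
    show "(\<lambda>x. (norm (\<alpha> x))\<^sup>2) \<in> borel_measurable lborel" using \<alpha>(1) by simp
    show "(\<lambda>x. (cmod z)\<^sup>2 * ((p x)\<^sup>2 + (c x)\<^sup>2)) \<in> borel_measurable lborel" using pi ci by simp
    show "AE x in lborel. (norm (\<alpha> x))\<^sup>2 = (cmod z)\<^sup>2 * ((p x)\<^sup>2 + (c x)\<^sup>2)"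
      using \<alpha>(3)
    proof eventually_elim
      case (elim x)
      have "(cmod (of_real (- s * c x)))\<^sup>2 = (c x)\<^sup>2" by (simp add: norm_mult power_mult_distrib s)
      then show ?case
        unfolding elim norm_spinor comp_linear compA_spinor compC_spinor norm_mult power_mult_distrib
        by (simp add: distrib_left)
    qed
  qed
  then have zJ: "(cmod z)\<^sup>2 * J = 1" using nz by (simp add: J_def)
  have z0: "cmod z > 0" using zJ by (cases "z = 0") auto
  define n where "n = \<gamma> / cmod z"
  have n: "n > 0" using z0 g by (simp add: n_def)
  have n2: "n\<^sup>2 = (\<integral>x. (f1 x)\<^sup>2 + (f2 x)\<^sup>2 \<partial>lborel)"
  proof -
    have "n\<^sup>2 = \<gamma>\<^sup>2 * J" using zJ z0 by (simp add: n_def power_divide field_simps)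
    then show ?thesis unfolding F J_def by simp
  qed
  have d0: "\<delta> > 0" using d1 by simp
  have E: "exp (- 2 * k * \<delta>) = eps" by (simp add: eps_def)
  have an: "integrable lborel (\<lambda>x. (A x)\<^sup>2 + (B x)\<^sup>2)" "(\<integral>x. (A x)\<^sup>2 + (B x)\<^sup>2 \<partial>lborel) \<le> 1"
    "1 - \<gamma>\<^sup>2 * M\<^sup>2 * (2 / k) * eps \<le> (\<integral>x. (A x)\<^sup>2 + (B x)\<^sup>2 \<partial>lborel)"
    unfolding A_def B_def using approx_mode_norm[OF d0 s] unfolding E by blast+
  have a4: "a4 K \<ge> 0" using rates by (simp add: a4_def a3_def)
  have bound: "(\<integral>x. (f1 x / n - A x)\<^sup>2 + (f2 x / n - B x)\<^sup>2 \<partial>lborel) \<le> a5 K * eps\<^sup>2"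
    unfolding a5_def
  proof (rule normalize_close)
    show "integrable lborel (\<lambda>x. (f1 x)\<^sup>2 + (f2 x)\<^sup>2)" unfolding F using pi ci by simp
    show "integrable lborel (\<lambda>x. (f1 x - A x)\<^sup>2 + (f2 x - B x)\<^sup>2)" unfolding T using sq(1) by simp
    show "(\<lambda>x. (f1 x / n - A x)\<^sup>2 + (f2 x / n - B x)\<^sup>2) \<in> borel_measurable lborel" using mm by simp
    have "(\<integral>x. (f1 x - A x)\<^sup>2 + (f2 x - B x)\<^sup>2 \<partial>lborel) = \<gamma>\<^sup>2 * (\<integral>x. (p x - (h (x - 2 * \<delta>) - h (x + 2 * \<delta>)) / sqrt 2)\<^sup>2 + (c x - h x)\<^sup>2 \<partial>lborel)"
      unfolding T by simp
    also have "\<dots> \<le> \<gamma>\<^sup>2 * (a3 K * (6 / w0 K) * eps\<^sup>2)" using sq(2) by (intro mult_left_mono) auto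
    finally show "(\<integral>x. (f1 x - A x)\<^sup>2 + (f2 x - B x)\<^sup>2 \<partial>lborel) \<le> a4 K * eps\<^sup>2" by (simp add: a4_def mult.assoc)
    show "0 \<le> \<gamma>\<^sup>2 * M\<^sup>2 * (2 / k)" using k0 by simp
  qed (use an n n2 eps a4 in auto)
  define w where "w = cnj z / of_real (cmod z)"
  have w1: "cmod w = 1" using z0 by (simp add: w_def norm_divide)
  have wz: "w * z = of_real (cmod z)"
  proof -
    have "cnj z * z = of_real ((cmod z)\<^sup>2)" using complex_norm_square[of z] by (simp add: mult.commute)
    then show ?thesis using z0 by (simp add: w_def power2_eq_square)
  qed
  have ap: "approx_mode \<kappa> s \<delta> = rspinor A B" unfolding A_def B_def by (rule approx_mode_rspinor)
  have "(\<integral>x. (norm (w *s \<alpha> x - approx_mode \<kappa> s \<delta> x))\<^sup>2 \<partial>lborel) = (\<integral>x. (f1 x / n - A x)\<^sup>2 + (f2 x / n - B x)\<^sup>2 \<partial>lborel)"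
  proof (rule integral_cong_AE)
    show "(\<lambda>x. (norm (w *s \<alpha> x - approx_mode \<kappa> s \<delta> x))\<^sup>2) \<in> borel_measurable lborel"
      unfolding norm_spinor ap using comp_measurable[OF \<alpha>(1)] mm by simp
    show "(\<lambda>x. (f1 x / n - A x)\<^sup>2 + (f2 x / n - B x)\<^sup>2) \<in> borel_measurable lborel" using mm by simp
    show "AE x in lborel. (norm (w *s \<alpha> x - approx_mode \<kappa> s \<delta> x))\<^sup>2 = (f1 x / n - A x)\<^sup>2 + (f2 x / n - B x)\<^sup>2"
      using \<alpha>(3)
    proof eventually_elim
      case (elim x)
      have nz: "f1 x / n = cmod z * p x" "f2 x / n = cmod z * (- s * c x)"
        using z0 g by (simp_all add: n_def f1_def f2_def)
      have "compA (w *s \<alpha> x - approx_mode \<kappa> s \<delta> x) = (w * z) * of_real (p x) - of_real (A x)"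
        "compC (w *s \<alpha> x - approx_mode \<kappa> s \<delta> x) = (w * z) * of_real (- s * c x) - of_real (B x)"
        unfolding elim ap by simp_all
      then have "compA (w *s \<alpha> x - approx_mode \<kappa> s \<delta> x) = of_real (f1 x / n - A x)"
        "compC (w *s \<alpha> x - approx_mode \<kappa> s \<delta> x) = of_real (f2 x / n - B x)"
        unfolding wz nz by simp_all
      then show ?case unfolding norm_spinor by (simp only: norm_of_real power2_abs)
    qed
  qed
  then have "(norm_H (\<lambda>x. w *s \<alpha> x - approx_mode \<kappa> s \<delta> x))\<^sup>2 \<le> (sqrt (a5 K) * eps)\<^sup>2"
    using bound a4 by (simp add: norm_H_square power_mult_distrib a5_def)
  then have "norm_H (\<lambda>x. w *s \<alpha> x - approx_mode \<kappa> s \<delta> x) \<le> sqrt (a5 K) * eps"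
    by (rule power2_le_imp_le) (use eps a4 in \<open>simp add: a5_def\<close>)
  with w1 show ?thesis by blast
qed

end

section \<open>The near-zero eigenvalues of the three-wall operator\<close>

context domain_wall
begin

lemma three_wall_eigenpairs:
  assumes K: "0 < K" "K < k" and d: "2 \<le> \<delta>" and E: "0 < E" "E < K"
    and t: "odd_wall.Theta (\<kappa>3 \<delta>) k (2 * \<delta> + 1) E = - (pi / 2)"
  shows "\<bar>E - 2 * sqrt 2 * \<gamma>\<^sup>2 * exp (- 2 * mass_integral \<kappa> \<delta>)\<bar> \<le> c9 * M ^ 4 * exp (- 4 * k * \<delta>)"
    and "s = 1 \<or> s = -1 \<Longrightarrow> normalized_eigenfunction (\<kappa>3 \<delta>) (s * E) \<alpha> \<Longrightarrow>
      \<exists>w. cmod w = 1 \<and> norm_H (\<lambda>x. w *s \<alpha> x - approx_mode \<kappa> s \<delta> x) \<le> sqrt (a5 K) * exp (- 2 * k * \<delta>)"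
proof -
  have d1: "\<delta> > 1" using d by simp
  interpret three: odd_wall "\<kappa>3 \<delta>" k "2 * \<delta> + 1" by (rule three_odd_wall[OF d1])
  interpret pr: three_wall_profile \<kappa> k K \<delta> E "tan (decay_angle k E)" "three.solA E" "\<lambda>x. - three.solC E x"
    by (rule three_profile[OF K d E(1) less_imp_le[OF E(2)] t])
  have aE: "\<bar>E\<bar> < k" using E K by simp
  have g: "exp (- 2 * mass_integral \<kappa> \<delta>) = pr.g" by (simp add: pr.g_def h_def flip: exp_double)
  have e2: "pr.eps\<^sup>2 = exp (- 4 * k * \<delta>)" by (simp add: pr.eps_def flip: exp_double)
  have "2 * sqrt 2 * \<gamma>\<^sup>2 = sqrt 2 / N" by (simp add: gamma)
  then have "\<bar>E - 2 * sqrt 2 * \<gamma>\<^sup>2 * exp (- 2 * mass_integral \<kappa> \<delta>)\<bar> \<le> c9 * pr.g\<^sup>2"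
    using pr.E_error by (simp only: g)
  also have "\<dots> \<le> c9 * (M ^ 4 * pr.eps\<^sup>2)" using pr.g2_eps consts_nonneg by (intro mult_left_mono)
  finally show "\<bar>E - 2 * sqrt 2 * \<gamma>\<^sup>2 * exp (- 2 * mass_integral \<kappa> \<delta>)\<bar> \<le> c9 * M ^ 4 * exp (- 4 * k * \<delta>)"
    by (simp add: e2 mult.assoc)
  assume s: "s = 1 \<or> s = -1" and n: "normalized_eigenfunction (\<kappa>3 \<delta>) (s * E) \<alpha>"
  have asE: "\<bar>s * E\<bar> < k" using s aE by auto
  have e: "eigenfunction (\<kappa>3 \<delta>) (s * E) \<alpha>" "norm_H \<alpha> = 1" using n by (auto simp: normalized_eigenfunction_def)
  obtain z where z: "AE x in lborel. \<alpha> x = z *s rspinor (three.solA (s * E)) (three.solC (s * E)) x"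
    using three.eigenfunction_classification(2)[OF asE e(1)] by blast
  have eq: "three.solA (s * E) x = three.solA E x" "three.solC (s * E) x = - s * - three.solC E x" for x
    using s three.sol_minus[OF aE] by auto
  have zt: "sin (2 * three.Theta E) = 0" by (simp add: t)
  obtain A where A: "\<And>x. \<bar>three.solA E x\<bar> \<le> A * exp (- three.rate E * \<bar>x\<bar>)" "\<And>x. \<bar>three.solC E x\<bar> \<le> A * exp (- three.rate E * \<bar>x\<bar>)"
    using three.sol_decay[OF aE zt] by metis
  note ds = dirac_solutionD(3,4)[OF three.sol[of E]]
  have i: "integrable lborel (\<lambda>x. (three.solA E x)\<^sup>2)" "integrable lborel (\<lambda>x. (- three.solC E x)\<^sup>2)"
    using continuous_exp_decay_square_integrable[OF ds(1) A(1) three.rate(1)[OF aE]]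
      continuous_exp_decay_square_integrable[OF ds(2) A(2) three.rate(1)[OF aE]] by simp_all
  have "\<exists>w. cmod w = 1 \<and> norm_H (\<lambda>x. w *s \<alpha> x - approx_mode \<kappa> s \<delta> x) \<le> sqrt (a5 K) * pr.eps"
  proof (rule pr.eigenfunction_error[where z = z])
    show "three.solA E (- x) = - three.solA E x" "- three.solC E (- x) = - three.solC E x" for x
      by (simp_all add: three.sol_parity[OF t])
    show "\<alpha> \<in> borel_measurable lborel" using e(1) by (simp add: eigenfunction_def H1_space_def L2_space_def)
    show "AE x in lborel. \<alpha> x = z *s rspinor (three.solA E) (\<lambda>x. - s * - three.solC E x) x" using z by (simp only: eq)
    show "s\<^sup>2 = 1" using s by auto
  qed (use i e in auto)
  then show "\<exists>w. cmod w = 1 \<and> norm_H (\<lambda>x. w *s \<alpha> x - approx_mode \<kappa> s \<delta> x) \<le> sqrt (a5 K) * exp (- 2 * k * \<delta>)"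
    by (simp add: pr.eps_def)
qed

end

theorem theorem4p1:
  fixes \<kappa> :: "real \<Rightarrow> real" and \<kappa>_inf K :: real
  assumes "one_domain_wall \<kappa>_inf \<kappa>"
    and "spectral_gap \<kappa>_inf \<kappa>"
    and "0 < K"
    and "{-K..K} \<subseteq> {-\<kappa>_inf<..<\<kappa>_inf}"
  shows "\<exists>\<delta>K \<ge> 2. \<exists>(Ep :: real \<Rightarrow> real) (Em :: real \<Rightarrow> real) (C :: real). \<forall>\<delta> > \<delta>K.
    normalized_eigenfunction (three_domain_wall \<kappa> \<delta>) 0 (zero_mode (three_domain_wall \<kappa> \<delta>)) \<and>
    distinct [0, Ep \<delta>, Em \<delta>] \<and>
    {E \<in> {-K..K}. eigenvalue (three_domain_wall \<kappa> \<delta>) E} = {0, Ep \<delta>, Em \<delta>} \<and>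
    \<bar>Ep \<delta> - 2 * sqrt 2 * (gamma_const \<kappa>)\<^sup>2 * exp (- 2 * mass_integral \<kappa> \<delta>)\<bar>
      \<le> C * exp (- 4 * \<kappa>_inf * \<delta>) \<and>
    \<bar>Em \<delta> + 2 * sqrt 2 * (gamma_const \<kappa>)\<^sup>2 * exp (- 2 * mass_integral \<kappa> \<delta>)\<bar>
      \<le> C * exp (- 4 * \<kappa>_inf * \<delta>) \<and>
    (\<forall>\<alpha>. normalized_eigenfunction (three_domain_wall \<kappa> \<delta>) (Ep \<delta>) \<alpha> \<longrightarrow>
      (\<exists>c :: complex. cmod c = 1 \<and>
        norm_H (\<lambda>x. c *s \<alpha> x - approx_mode \<kappa> 1 \<delta> x) \<le> C * exp (- 2 * \<kappa>_inf * \<delta>))) \<and>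
    (\<forall>\<alpha>. normalized_eigenfunction (three_domain_wall \<kappa> \<delta>) (Em \<delta>) \<alpha> \<longrightarrow>
      (\<exists>c :: complex. cmod c = 1 \<and>
        norm_H (\<lambda>x. c *s \<alpha> x - approx_mode \<kappa> (-1) \<delta> x) \<le> C * exp (- 2 * \<kappa>_inf * \<delta>)))"
proof -
  interpret domain_wall \<kappa> \<kappa>_inf by unfold_locales (rule assms(1))
  have K: "0 < K" "K < \<kappa>_inf"
    using assms(3,4) subsetD[OF assms(4), of K] by auto
  obtain \<delta>0 where \<delta>0: "\<delta>0 \<ge> 2" "\<And>\<delta>. \<delta> > \<delta>0 \<Longrightarrow> - pi < odd_wall.Theta (\<kappa>3 \<delta>) \<kappa>_inf (2 * \<delta> + 1) K
      \<and> odd_wall.Theta (\<kappa>3 \<delta>) \<kappa>_inf (2 * \<delta> + 1) K < - (pi / 2)"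
    using three_Theta[OF assms(2) K] by blast
  define P where "P \<delta> E \<longleftrightarrow> 0 < E \<and> E < K \<and> odd_wall.Theta (\<kappa>3 \<delta>) \<kappa>_inf (2 * \<delta> + 1) E = - (pi / 2) \<and>
      {E' \<in> {-K..K}. eigenvalue (\<kappa>3 \<delta>) E'} = {0, E, - E}" for \<delta> E
  define Ep where "Ep \<delta> = (SOME E. P \<delta> E)" for \<delta>
  have P: "P \<delta> (Ep \<delta>)" if "\<delta> > \<delta>0" for \<delta>
  proof -
    have d1: "\<delta> > 1" using that \<delta>0(1) by simp
    interpret three: odd_wall "\<kappa>3 \<delta>" \<kappa>_inf "2 * \<delta> + 1" by (rule three_odd_wall[OF d1])
    have "\<exists>E. P \<delta> E" unfolding P_def using three.eigenvalues_in_window[OF K] \<delta>0(2)[OF that] by blast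
    then show ?thesis unfolding Ep_def by (rule someI_ex)
  qed
  define C where "C = c9 * M ^ 4 + sqrt (a5 K)"
  have C0: "0 \<le> c9 * M ^ 4" using consts_nonneg M_ge_1 by simp
  have C: "c9 * M ^ 4 * r \<le> C * r" "sqrt (a5 K) * r \<le> C * r" if "r > 0" "\<delta> > \<delta>0" for r \<delta>
  proof -
    have "0 \<le> a5 K" using K by (simp add: a5_def a4_def a3_def w0_def power_mono)
    then show "c9 * M ^ 4 * r \<le> C * r" "sqrt (a5 K) * r \<le> C * r"
      using C0 that by (auto simp: C_def intro!: mult_right_mono)
  qed
  show ?thesis
  proof (rule exI[of _ \<delta>0], intro conjI \<delta>0(1), rule exI[of _ Ep], rule exI[of _ "\<lambda>\<delta>. - Ep \<delta>"], rule exI[of _ C], intro allI impI)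
    fix \<delta> assume d: "\<delta> > \<delta>0"
    then have d2: "2 \<le> \<delta>" and d1: "\<delta> > 1" using \<delta>0(1) by auto
    interpret three: odd_wall "\<kappa>3 \<delta>" \<kappa>_inf "2 * \<delta> + 1" by (rule three_odd_wall[OF d1])
    have E: "0 < Ep \<delta>" "Ep \<delta> < K" "three.Theta (Ep \<delta>) = - (pi / 2)"
      and ev: "{E' \<in> {-K..K}. eigenvalue (\<kappa>3 \<delta>) E'} = {0, Ep \<delta>, - Ep \<delta>}"
      using P[OF d] by (auto simp: P_def)
    note ep = three_wall_eigenpairs[OF K d2 E]
    have c4: "c9 * M ^ 4 * exp (- 4 * \<kappa>_inf * \<delta>) \<le> C * exp (- 4 * \<kappa>_inf * \<delta>)"
      and c5: "sqrt (a5 K) * exp (- 2 * \<kappa>_inf * \<delta>) \<le> C * exp (- 2 * \<kappa>_inf * \<delta>)"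
      by (rule C[OF exp_gt_zero d])+
    have e1: "\<bar>Ep \<delta> - 2 * sqrt 2 * \<gamma>\<^sup>2 * exp (- 2 * mass_integral \<kappa> \<delta>)\<bar> \<le> C * exp (- 4 * \<kappa>_inf * \<delta>)"
      using ep(1) c4 by linarith
    have e2: "\<bar>- Ep \<delta> + 2 * sqrt 2 * \<gamma>\<^sup>2 * exp (- 2 * mass_integral \<kappa> \<delta>)\<bar> \<le> C * exp (- 4 * \<kappa>_inf * \<delta>)"
      using e1 by linarith
    have fp: "\<exists>c. cmod c = 1 \<and> norm_H (\<lambda>x. c *s \<alpha> x - approx_mode \<kappa> 1 \<delta> x) \<le> C * exp (- 2 * \<kappa>_inf * \<delta>)"
      if "normalized_eigenfunction (\<kappa>3 \<delta>) (Ep \<delta>) \<alpha>" for \<alpha>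
    proof -
      have "normalized_eigenfunction (\<kappa>3 \<delta>) (1 * Ep \<delta>) \<alpha>" using that by simp
      then obtain w where "cmod w = 1"
        "norm_H (\<lambda>x. w *s \<alpha> x - approx_mode \<kappa> (1) \<delta> x) \<le> sqrt (a5 K) * exp (- 2 * \<kappa>_inf * \<delta>)"
        using ep(2) by blast
      then show ?thesis using c5 by (intro exI[of _ w] conjI) (auto intro: order_trans)
    qed
    have fm: "\<exists>c. cmod c = 1 \<and> norm_H (\<lambda>x. c *s \<alpha> x - approx_mode \<kappa> (-1) \<delta> x) \<le> C * exp (- 2 * \<kappa>_inf * \<delta>)"
      if "normalized_eigenfunction (\<kappa>3 \<delta>) (- Ep \<delta>) \<alpha>" for \<alpha>
    proof -
      have "normalized_eigenfunction (\<kappa>3 \<delta>) (-1 * Ep \<delta>) \<alpha>" using that by simp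
      then obtain w where "cmod w = 1"
        "norm_H (\<lambda>x. w *s \<alpha> x - approx_mode \<kappa> (-1) \<delta> x) \<le> sqrt (a5 K) * exp (- 2 * \<kappa>_inf * \<delta>)"
        using ep(2) by blast
      then show ?thesis using c5 by (intro exI[of _ w] conjI) (auto intro: order_trans)
    qed
    have ds: "distinct [0, Ep \<delta>, - Ep \<delta>]" using E(1) by simp
    show "normalized_eigenfunction (\<kappa>3 \<delta>) 0 (zero_mode (\<kappa>3 \<delta>)) \<and>
      distinct [0, Ep \<delta>, - Ep \<delta>] \<and>
      {E \<in> {-K..K}. eigenvalue (\<kappa>3 \<delta>) E} = {0, Ep \<delta>, - Ep \<delta>} \<and>
      \<bar>Ep \<delta> - 2 * sqrt 2 * \<gamma>\<^sup>2 * exp (- 2 * mass_integral \<kappa> \<delta>)\<bar> \<le> C * exp (- 4 * \<kappa>_inf * \<delta>) \<and>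
      \<bar>- Ep \<delta> + 2 * sqrt 2 * \<gamma>\<^sup>2 * exp (- 2 * mass_integral \<kappa> \<delta>)\<bar> \<le> C * exp (- 4 * \<kappa>_inf * \<delta>) \<and>
      (\<forall>\<alpha>. normalized_eigenfunction (\<kappa>3 \<delta>) (Ep \<delta>) \<alpha> \<longrightarrow>
        (\<exists>c :: complex. cmod c = 1 \<and> norm_H (\<lambda>x. c *s \<alpha> x - approx_mode \<kappa> 1 \<delta> x) \<le> C * exp (- 2 * \<kappa>_inf * \<delta>))) \<and>
      (\<forall>\<alpha>. normalized_eigenfunction (\<kappa>3 \<delta>) (- Ep \<delta>) \<alpha> \<longrightarrow>
        (\<exists>c :: complex. cmod c = 1 \<and> norm_H (\<lambda>x. c *s \<alpha> x - approx_mode \<kappa> (-1) \<delta> x) \<le> C * exp (- 2 * \<kappa>_inf * \<delta>)))"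
      using three.zero_mode_normalized ds ev e1 e2 fp fm by blast
  qed
qed

end
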